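(* Let $X$ be a complex Banach space, $A$ an injective sectorial operator in $X$ with dense domain and dense range, $s\in[1,\infty]$, $\sigma>\omega(A)$. (a) For every $\varphi\in\Phi^\Sigma_{\sigma,0}$ there is a constant $C>0$ such that for all $x\in X$ $$C^{-1}\Big(\sum_{j\in\mathbb Z}\|\varphi(2^jA)x\|_X^s\Big)^{1/s}\le\Big(\int_0^\infty\|\varphi(tA)x\|_X^s\,\frac{dt}t\Big)^{1/s}\le C\Big(\sum_{j\in\mathbb Z}\|\varphi(2^jA)x\|_X^s\Big)^{1/s}.$$ (b) For all $\varphi,\psi\in\Phi^\Sigma_{\sigma,0}$ there is a constant $C>0$ such that for all $f\in H^\infty(\Sigma_\sigma)$ and $x\in X$ $$\Big(\sum_{j\in\mathbb Z}\|f(A)\varphi(2^jA)x\|_X^s\Big)^{1/s}\le C\,\|f\|_{\infty,\sigma}\Big(\sum_{j\in\mathbb Z}\|\psi(2^jA)x\|_X^s\Big)^{1/s}.$$ (Sums and integrals are replaced by suprema if $s=\infty$; the expressions are elements of $[0,\infty]$.)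
   Context: **Sectors and operators.** $\Sigma_\sigma=\{z\in\mathbb C\setminus(-\infty,0]:|\arg z|<\sigma\}$ for $\sigma\in(0,\pi]$, $\Sigma_0=(0,\infty)$. $A$ is sectorial of type $\omega\in[0,\pi)$ if $\sigma(A)\subseteq\overline{\Sigma}_\omega$ and $\sup_{z\notin\overline\Sigma_\sigma}\|zR(z,A)\|<\infty$ for every $\sigma\in(\omega,\pi)$; $\omega(A)$ is the infimum of such $\omega$. **Functional calculus.** $H^\infty(\Sigma_\sigma)$: bounded analytic functions on $\Sigma_\sigma$ with norm $\|f\|_{\infty,\sigma}=\sup_{\Sigma_\sigma}|f|$. $H_0^\infty(\Sigma_\sigma)$: those with $\sup_{z\in\Sigma_\sigma}(|z|^\varepsilon\vee|z|^{-\varepsilon})|f(z)|<\infty$ for some $\varepsilon>0$. For $\varphi\in H_0^\infty(\Sigma_\sigma)$, $\varphi(A)=\frac1{2\pi i}\int_{\partial\Sigma_\omega}\varphi(\lambda)R(\lambda,A)\,d\lambda$, $\omega\in(\omega(A),\sigma)$ ($\sigma(A)$ lying to the left of the contour); $\varphi(tA)=(\varphi(t\,\cdot))(A)$. For $f\in H^\infty(\Sigma_\sigma)$ and $\rho(z)=z(1+z)^{-2}$, $f(A)=\rho(A)^{-1}(\rho f)(A)$ is a closed operator, and $f(A)\varphi(2^jA)=(f\cdot\varphi(2^j\,\cdot))(A)\in L(X)$. $\mathcal E(\Sigma_\sigma)=H_0^\infty(\Sigma_\sigma)\oplus\mathbb C\frac1{1+z}\oplus\mathbb C\mathbf 1$;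 its elements have limits $f(0),f(\infty)$ at $0$ and $\infty$. **The class $\Phi^\Sigma_{\sigma,0}$** is the set of $\varphi\in H_0^\infty(\Sigma_\sigma)$ with $0\notin\varphi(\Sigma_\sigma)$ for which there are $d\in\mathbb Z$ and a set $\mathcal F\subseteq\mathcal E(\Sigma_\sigma)$ such that for some $\varepsilon>0$ $$\sup_{f\in\mathcal F}\|f\|_{\infty,\sigma}<\infty,\qquad \sup_{f\in\mathcal F}\sup_{z\in\Sigma_\sigma}(|z|^\varepsilon\vee|z|^{-\varepsilon})\Big|f(z)-\frac{f(0)+f(\infty)z}{1+z}\Big|<\infty,$$ and $\{\varphi(2^jt\,\cdot)/\varphi(2^{j-d}\,\cdot),\ \varphi(2^{j+d}\,\cdot)/\varphi(2^jt\,\cdot): j\in\mathbb Z,\ t\in[1,2]\}\subseteq\{f(r\,\cdot):f\in\mathcal F,\ r>0\}$. *)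

theory Defs
  imports "HOL-Analysis.Analysis"
begin

subsection \<open>Complex Banach spaces\<close>

class complex_banach = banach +
  fixes scaleC :: "complex \<Rightarrow> 'a \<Rightarrow> 'a"  (infixr \<open>*\<^sub>C\<close> 75)
  assumes scaleC_add_right: "a *\<^sub>C (x + y) = a *\<^sub>C x + a *\<^sub>C y"
    and scaleC_add_left: "(a + b) *\<^sub>C x = a *\<^sub>C x + b *\<^sub>C x"
    and scaleC_scaleC: "a *\<^sub>C (b *\<^sub>C x) = (a * b) *\<^sub>C x"
    and scaleC_of_real: "complex_of_real r *\<^sub>C x = r *\<^sub>R x"
    and norm_scaleC: "norm (a *\<^sub>C x) = cmod a * norm x"

subsection \<open>Sectors and sectorial operators\<close>

definition sector :: "real \<Rightarrow> complex set" where
  "sector \<sigma> = (if \<sigma> = 0 then complex_of_real ` {0<..}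
               else {z. z \<notin> \<real>\<^sub>\<le>\<^sub>0 \<and> \<bar>Arg z\<bar> < \<sigma>})"

text \<open>An operator in \<open>X\<close> with domain \<open>D(A)\<close> is a partial map with \<open>dom A = D(A)\<close>.\<close>

definition linear_op :: "('a::complex_banach \<rightharpoonup> 'a) \<Rightarrow> bool" where
  "linear_op A \<longleftrightarrow> A 0 = Some 0 \<and>
     (\<forall>a b x y u v. A x = Some u \<longrightarrow> A y = Some v \<longrightarrow>
        A (a *\<^sub>C x + b *\<^sub>C y) = Some (a *\<^sub>C u + b *\<^sub>C v))"

definition shifted :: "('a::complex_banach \<rightharpoonup> 'a) \<Rightarrow> complex \<Rightarrow> 'a \<Rightarrow> 'a" where
  "shifted A z x = z *\<^sub>C x - the (A x)"

definition resolvent :: "('a::complex_banach \<rightharpoonup> 'a) \<Rightarrow> complex \<Rightarrow> 'a \<Rightarrow> 'a" where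
  "resolvent A z = inv_into (dom A) (shifted A z)"

definition spectrum :: "('a::complex_banach \<rightharpoonup> 'a) \<Rightarrow> complex set" where
  "spectrum A = {z. \<not> (bij_betw (shifted A z) (dom A) UNIV \<and> bounded_linear (resolvent A z))}"

text \<open>Closedness of \<open>A\<close> need not be demanded separately: the spectrum is not all of the plane,
  and an operator with a bounded everywhere defined resolvent is closed.\<close>

definition sectorial_of_type :: "real \<Rightarrow> ('a::complex_banach \<rightharpoonup> 'a) \<Rightarrow> bool" where
  "sectorial_of_type \<omega> A \<longleftrightarrow> linear_op A \<and> 0 \<le> \<omega> \<and> \<omega> < pi \<and>
     spectrum A \<subseteq> closure (sector \<omega>) \<and>
     (\<forall>\<sigma>. \<omega> < \<sigma> \<and> \<sigma> < pi \<longrightarrow>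
        bdd_above ((\<lambda>z. onorm (\<lambda>x. z *\<^sub>C resolvent A z x)) ` (- closure (sector \<sigma>))))"

definition sectorial :: "('a::complex_banach \<rightharpoonup> 'a) \<Rightarrow> bool" where
  "sectorial A \<longleftrightarrow> (\<exists>\<omega>. sectorial_of_type \<omega> A)"

definition sectorial_angle :: "('a::complex_banach \<rightharpoonup> 'a) \<Rightarrow> real" where
  "sectorial_angle A = Inf {\<omega>. sectorial_of_type \<omega> A}"

subsection \<open>Function classes on sectors\<close>

text \<open>Functions on a sector are represented by functions on the whole plane; only their values on
  the sector matter.\<close>

definition H_inf :: "real \<Rightarrow> (complex \<Rightarrow> complex) set" where
  "H_inf \<sigma> = {f. f holomorphic_on sector \<sigma> \<and> bounded (f ` sector \<sigma>)}"

definition H_inf_norm :: "real \<Rightarrow> (complex \<Rightarrow> complex) \<Rightarrow> real" where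
  "H_inf_norm \<sigma> f = (SUP z\<in>sector \<sigma>. cmod (f z))"

definition weight :: "real \<Rightarrow> complex \<Rightarrow> real" where
  "weight \<epsilon> z = max (cmod z powr \<epsilon>) (cmod z powr (-\<epsilon>))"

definition H0_inf :: "real \<Rightarrow> (complex \<Rightarrow> complex) set" where
  "H0_inf \<sigma> = {f \<in> H_inf \<sigma>. \<exists>\<epsilon>>0. bdd_above ((\<lambda>z. weight \<epsilon> z * cmod (f z)) ` sector \<sigma>)}"

definition E_class :: "real \<Rightarrow> (complex \<Rightarrow> complex) set" where
  "E_class \<sigma> = {f. \<exists>g\<in>H0_inf \<sigma>. \<exists>a b. \<forall>z\<in>sector \<sigma>. f z = g z + a * (1 / (1 + z)) + b}"

definition lim_zero :: "real \<Rightarrow> (complex \<Rightarrow> complex) \<Rightarrow> complex" where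
  "lim_zero \<sigma> f = Lim (at 0 within sector \<sigma>) f"

definition lim_infinity :: "real \<Rightarrow> (complex \<Rightarrow> complex) \<Rightarrow> complex" where
  "lim_infinity \<sigma> f = Lim (inf at_infinity (principal (sector \<sigma>))) f"

definition dil :: "real \<Rightarrow> (complex \<Rightarrow> complex) \<Rightarrow> complex \<Rightarrow> complex" where
  "dil t f z = f (complex_of_real t * z)"

text \<open>The suprema over the family \<open>F\<close> are required to be finite as suprema over all pairs
  \<open>(f, z)\<close>, since elements of \<open>E_class pi\<close> need not be bounded.\<close>

definition Phi_class :: "real \<Rightarrow> (complex \<Rightarrow> complex) set" where
  "Phi_class \<sigma> = {\<phi> \<in> H0_inf \<sigma>. 0 \<notin> \<phi> ` sector \<sigma> \<and>
     (\<exists>(d::int) F. F \<subseteq> E_class \<sigma> \<and>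
       (\<exists>\<epsilon>>0.
          bdd_above ((\<lambda>(f, z). cmod (f z)) ` (F \<times> sector \<sigma>)) \<and>
          bdd_above ((\<lambda>(f, z). weight \<epsilon> z *
             cmod (f z - (lim_zero \<sigma> f + lim_infinity \<sigma> f * z) / (1 + z))) ` (F \<times> sector \<sigma>))) \<and>
       (\<forall>j::int. \<forall>t\<in>{1..2}.
          (\<exists>f\<in>F. \<exists>r>0. \<forall>z\<in>sector \<sigma>.
             dil (2 powi j * t) \<phi> z / dil (2 powi (j - d)) \<phi> z = dil r f z) \<and>
          (\<exists>f\<in>F. \<exists>r>0. \<forall>z\<in>sector \<sigma>.
             dil (2 powi (j + d)) \<phi> z / dil (2 powi j * t) \<phi> z = dil r f z)))}"

subsection \<open>Functional calculus\<close>

text \<open>Integral over the boundary of \<open>sector \<nu>\<close>, the sector lying to the left: inwards along the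
  upper ray, outwards along the lower one. Both rays are parametrized by
  \<open>u \<mapsto> exp (u \<plusminus> \<i> \<nu>)\<close>, \<open>u \<in> \<real>\<close>, so that \<open>d\<lambda> = \<lambda> du\<close>.
  The gauge integral is used because the Bochner integral of the library is restricted to
  separable spaces.\<close>

definition ray :: "real \<Rightarrow> real \<Rightarrow> complex" where
  "ray \<nu> u = exp (complex_of_real u + \<i> * complex_of_real \<nu>)"

definition sector_contour_integral :: "real \<Rightarrow> (complex \<Rightarrow> 'a::complex_banach) \<Rightarrow> 'a" where
  "sector_contour_integral \<nu> G =
     integral UNIV (\<lambda>u. ray (-\<nu>) u *\<^sub>C G (ray (-\<nu>) u)) - integral UNIV (\<lambda>u. ray \<nu> u *\<^sub>C G (ray \<nu> u))"

text \<open>By Cauchy's theorem the value does not depend on the angle of the contour, for which an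
  arbitrary choice is made.\<close>

definition H0_calc ::
    "real \<Rightarrow> ('a::complex_banach \<rightharpoonup> 'a) \<Rightarrow> (complex \<Rightarrow> complex) \<Rightarrow> 'a \<Rightarrow> 'a" where
  "H0_calc \<sigma> A \<phi> x =
     (1 / (2 * complex_of_real pi * \<i>)) *\<^sub>C
       sector_contour_integral (SOME \<nu>. sectorial_angle A < \<nu> \<and> \<nu> < \<sigma>)
         (\<lambda>z. \<phi> z *\<^sub>C resolvent A z x)"

definition rho :: "complex \<Rightarrow> complex" where
  "rho z = z / (1 + z)\<^sup>2"

text \<open>\<open>f(A) = \<rho>(A)\<^sup>-\<^sup>1 (\<rho> f)(A)\<close>, with its natural domain.\<close>

definition H_calc ::
    "real \<Rightarrow> ('a::complex_banach \<rightharpoonup> 'a) \<Rightarrow> (complex \<Rightarrow> complex) \<Rightarrow> 'a \<rightharpoonup> 'a" where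
  "H_calc \<sigma> A f x =
     (let y = H0_calc \<sigma> A (\<lambda>z. rho z * f z) x
      in if y \<in> range (H0_calc \<sigma> A rho) then Some (inv (H0_calc \<sigma> A rho) y) else None)"

subsection \<open>Discrete and continuous \<open>s\<close>-norms with values in \<open>[0, \<infinity>]\<close>\<close>

text \<open>Only used for \<open>p > 0\<close>.\<close>

definition ennreal_power :: "ennreal \<Rightarrow> real \<Rightarrow> ennreal" where
  "ennreal_power a p = (if a = \<infinity> then \<infinity> else ennreal (enn2real a powr p))"

definition sum_norm :: "ennreal \<Rightarrow> (int \<Rightarrow> 'a::real_normed_vector) \<Rightarrow> ennreal" where
  "sum_norm s u =
     (if s = \<infinity> then SUP j. ennreal (norm (u j))
      else ennreal_power (\<Sum>\<^sub>\<infinity>j\<in>UNIV. ennreal (norm (u j) powr enn2real s)) (1 / enn2real s))"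

definition int_norm :: "ennreal \<Rightarrow> (real \<Rightarrow> 'a::real_normed_vector) \<Rightarrow> ennreal" where
  "int_norm s u =
     (if s = \<infinity> then SUP t\<in>{0<..}. ennreal (norm (u t))
      else ennreal_power (\<integral>\<^sup>+t\<in>{0<..}. ennreal (norm (u t) powr enn2real s / t) \<partial>lborel)
             (1 / enn2real s))"

end

theory Submission
  imports Defs "HOL-Complex_Analysis.Complex_Analysis" "HOL-Real_Asymp.Real_Asymp" "HOL-Library.Nat_Bijection"
begin

text \<open>
  Everything is done in the logarithmic coordinate \<open>z = exp w\<close>: the contours become horizontal lines,
  dilations become translations, and \<open>z R(z, A)\<close> is bounded. Cauchy's theorem (independence of the angle)
  for functions with values in \<open>X\<close> is obtained by differentiating the integral over a line with respect
  to its height. Together with Fubini's theorem and the scalar Cauchy formula it gives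
  \<open>\<psi>(A) \<phi>(A) = (\<psi> \<phi>)(A)\<close>.

  For (a), each quotient \<open>\<phi>(2\<^sup>j t z) / \<phi>(2\<^bsup>j-d\<^esup> z)\<close> is a uniformly decaying function plus
  \<open>(a + b r z) / (1 + r z)\<close> with bounded \<open>a\<close>, \<open>b\<close>, hence acts as a uniformly bounded operator. So
  \<open>\<parallel>\<phi>(2\<^sup>j t A) x\<parallel>\<close>, \<open>t \<in> [1, 2]\<close>, lies between constant multiples of terms of the discrete norm.

  For (b), there are a function \<open>g\<close> and \<open>c \<noteq> 0\<close> with \<open>\<Sum>\<^sub>k g(2\<^sup>k z) = c\<close> for which
  \<open>G = g / \<psi>(2\<^bsup>-d\<^esup> \<cdot>)\<close> decays at \<open>0\<close> and \<open>\<infinity>\<close>. Then \<open>c f(A) \<phi>(2\<^sup>j A) x\<close> is the sum over \<open>k\<close> of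
  \<open>(f \<phi>(2\<^sup>j \<cdot>) G(2\<^sup>k \<cdot>))(A) \<psi>(2\<^bsup>k-d\<^esup> A) x\<close>, whose operators have norm at most \<open>C \<parallel>f\<parallel> q\<^bsup>\<bar>j-k\<bar>\<^esup>\<close> with
  \<open>q < 1\<close>, and Young's inequality concludes.
\<close>

section \<open>Complex scalars\<close>

text \<open>Two obstacles shape the estimates. The quotients supplied by \<open>Phi_class\<close> do
  not decay, so they enter the calculus only multiplied by a dilate of phi; their rational part is
  split as b + (a - b) / (1 + r z), a constant and one value of z R(z, A) at z = -1 / r, at a cost
  independent of r. And sigma may be pi, where 1 / (1 + z) and rho are unbounded near the negative
  half-line; such factors are estimated on a sector of intermediate angle, between the contour and
  sigma. In logarithmic coordinates a symbol is a bump. Operator bounds see its height and rate but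
  not its centre, hence constants uniform in j and t. The number q comes from two bumps at distance
  ln 2 |j - k|: half of the rate pays for the distance, half for integrability. That f(A) phi(2^j A)
  is (f phi(2^j .))(A) rests on injectivity of rho(A). As 1 / (1 + z) does not decay at 0,
  multiplicativity alone does not identify rho(A), and it is computed by hand as A (1 +
  A)^(-2).\<close>

lemma bounded_bilinear_scaleC: "bounded_bilinear (scaleC :: complex \<Rightarrow> 'a::complex_banach \<Rightarrow> 'a)"
proof
  fix a a' :: complex and b b' :: 'a and r :: real
  show "(a + a') *\<^sub>C b = a *\<^sub>C b + a' *\<^sub>C b" by (rule scaleC_add_left)
  show "a *\<^sub>C (b + b') = a *\<^sub>C b + a *\<^sub>C b'" by (rule scaleC_add_right)
  show "(r *\<^sub>R a) *\<^sub>C b = r *\<^sub>R a *\<^sub>C b"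
    by (simp add: scaleC_of_real[symmetric] scaleC_scaleC scaleR_conv_of_real)
  show "a *\<^sub>C r *\<^sub>R b = r *\<^sub>R a *\<^sub>C b"
    by (simp add: scaleC_of_real[symmetric] scaleC_scaleC mult.commute)
  show "\<exists>K. \<forall>a (b::'a). norm (a *\<^sub>C b) \<le> norm a * norm b * K"
    by (rule exI[of _ 1]) (simp add: norm_scaleC)
qed

interpretation scaleC: bounded_bilinear "scaleC :: complex \<Rightarrow> 'a::complex_banach \<Rightarrow> 'a"
  by (rule bounded_bilinear_scaleC)

lemmas [simp] = scaleC.zero_left scaleC.zero_right

lemma scaleC_one [simp]: "1 *\<^sub>C (x :: 'a::complex_banach) = x"
  using scaleC_of_real[of 1 x] by simp

lemma scaleC_minus_one [simp]: "(- 1) *\<^sub>C (x :: 'a::complex_banach) = - x"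
  by (simp add: scaleC.minus_left)

lemmas [continuous_intros] = scaleC.continuous_on

text \<open>Scalar functions thereby become a case of X-valued ones, so the contour shift and the
  product rule are proved once for both.\<close>

instantiation complex :: complex_banach
begin
definition scaleC_complex :: "complex \<Rightarrow> complex \<Rightarrow> complex" where
  "scaleC_complex a b = a * b"
instance
  by standard (auto simp: scaleC_complex_def algebra_simps norm_mult scaleR_conv_of_real)
end

section \<open>Integrals of exponentially decaying functions\<close>

text \<open>The integral over a half-line, doubled by evenness and translated. The value does not
  depend on the centre \<open>- a\<close>; uniformity over all dilations rests on this.\<close>

lemma has_integral_exp_abs:
  fixes e a :: real
  assumes "e > 0"
  shows "((\<lambda>u. exp (- e * \<bar>u + a\<bar>)) has_integral 2 / e) UNIV"
proof -
  have "(\<integral>\<^sup>+u. ennreal (exp (- e * u)) * indicator {0..} u \<partial>lborel) = ennreal (0 - (- exp (- e * 0) / e))"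
  proof (rule nn_integral_FTC_atLeast)
    show "((\<lambda>u. - exp (- e * u) / e) \<longlongrightarrow> 0) at_top"
      using assms by real_asymp
    show "DERIV (\<lambda>u. - exp (- e * u) / e) x :> exp (- e * x)" for x
      using assms by (auto intro!: derivative_eq_intros)
  qed (use assms in auto)
  then have "(\<integral>\<^sup>+u. ennreal (indicator {0..} u *\<^sub>R exp (- e * \<bar>u\<bar>)) \<partial>lborel) = ennreal (1 / e)"
    by (subst nn_integral_cong[of _ _ "\<lambda>u. ennreal (exp (- e * u)) * indicator {0..} u"])
       (auto simp: indicator_def)
  then have "has_bochner_integral lborel (\<lambda>u. indicator {0..} u *\<^sub>R exp (- e * \<bar>u\<bar>)) (1 / e)"
    using assms by (intro has_bochner_integral_nn_integral) auto
  then have "has_bochner_integral lborel (\<lambda>u. exp (- e * \<bar>u\<bar>)) (2 *\<^sub>R (1 / e))"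
    by (rule has_bochner_integral_even_function) simp
  then have "has_bochner_integral lborel (\<lambda>u. exp (- e * \<bar>a + 1 * u\<bar>)) (2 / e)"
    by (subst (asm) lborel_has_bochner_integral_real_affine_iff[where c=1 and t=a]) simp_all
  then show ?thesis
    using has_integral_integral_lborel[of "\<lambda>u. exp (- e * \<bar>a + 1 * u\<bar>)"]
    by (simp add: has_bochner_integral_iff add.commute)
qed

text \<open>Continuity settles compact intervals, and domination by an integrable scalar function
  settles the whole line. This is the basic source of integrability for X-valued functions.\<close>

lemma
  fixes f :: "real \<Rightarrow> 'a::banach"
  assumes "continuous_on UNIV f" and e: "e > 0"
    and le: "\<And>u. norm (f u) \<le> K * exp (- e * \<bar>u + a\<bar>)"
  shows exp_decay_integrable: "f integrable_on UNIV"
    and exp_decay_norm_integral_le: "norm (integral UNIV f) \<le> 2 * K / e"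
proof -
  have g: "((\<lambda>u. K * exp (- e * \<bar>u + a\<bar>)) has_integral K * (2 / e)) UNIV"
    by (intro has_integral_mult_right has_integral_exp_abs e)
  show f: "f integrable_on UNIV"
  proof (rule integrable_on_all_intervals_UNIV)
    show "f integrable_on cbox c d" for c d
      by (rule integrable_continuous) (use assms(1) continuous_on_subset in blast)
  qed (use le has_integral_integrable[OF g] in auto)
  have "norm (integral UNIV f) \<le> integral UNIV (\<lambda>u. K * exp (- e * \<bar>u + a\<bar>))"
    by (rule integral_norm_bound_integral[OF f]) (use le has_integral_integrable[OF g] in auto)
  then show "norm (integral UNIV f) \<le> 2 * K / e"
    using integral_unique[OF g] by (simp add: mult.commute)
qed

text \<open>The rate is split into halves: beyond \<open>n\<close> one half gives the factor
  \<open>exp (- (e / 2) * n)\<close>, the other keeps an integrable bound, whose integral 2 / (e /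
  2) accounts for the 4 in the constant.\<close>

lemma exp_decay_tail_le:
  fixes f :: "real \<Rightarrow> 'a::banach"
  assumes f: "continuous_on UNIV f" and e: "e > 0"
    and le: "\<And>u. norm (f u) \<le> K * exp (- e * \<bar>u\<bar>)"
  shows "norm (integral UNIV f - integral {-n..n} f) \<le> 4 * K / e * exp (- (e / 2) * n)"
proof -
  have K: "K \<ge> 0" using le[of 0] norm_ge_zero[of "f 0"] by (simp del: norm_ge_zero)
  let ?g = "\<lambda>u. if u \<in> {-n..n} then f u else 0"
  let ?b = "\<lambda>u. K * exp (- (e / 2) * n) * exp (- (e / 2) * \<bar>u + 0\<bar>)"
  have fi: "f integrable_on UNIV"
    by (rule exp_decay_integrable[of f e K 0]) (use assms in auto)
  have gi: "?g integrable_on UNIV"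
    by (subst integrable_restrict_UNIV)
       (rule integrable_continuous_interval, use f continuous_on_subset in blast)
  have b: "(?b has_integral K * exp (- (e / 2) * n) * (2 / (e / 2))) UNIV"
    by (intro has_integral_mult_right has_integral_exp_abs) (use e in auto)
  have "norm (integral UNIV (\<lambda>u. f u - ?g u)) \<le> integral UNIV ?b"
  proof (rule integral_norm_bound_integral)
    show "norm (f u - ?g u) \<le> ?b u" for u
    proof (cases "u \<in> {-n..n}")
      case False
      then have "- e * \<bar>u\<bar> \<le> - (e / 2) * n + - (e / 2) * \<bar>u\<bar>"
        using e by (auto simp: field_simps abs_if)
      then have "K * exp (- e * \<bar>u\<bar>) \<le> K * exp (- (e / 2) * n + - (e / 2) * \<bar>u\<bar>)"
        using K by (intro mult_left_mono) auto
      with le[of u] have "norm (f u) \<le> K * exp (- (e / 2) * n + - (e / 2) * \<bar>u\<bar>)" by linarith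
      with False show ?thesis by (simp only: exp_add) (auto simp: mult.assoc)
    qed (use K in auto)
  qed (use fi gi b in \<open>auto intro: integrable_diff has_integral_integrable\<close>)
  also have "integral UNIV (\<lambda>u. f u - ?g u) = integral UNIV f - integral {-n..n} f"
    using integral_diff[OF fi gi] integral_restrict_UNIV[of "{-n..n}" f] by simp
  finally show ?thesis using integral_unique[OF b] by (simp add: mult_ac)
qed

lemma exp_decay_integral_tendsto:
  fixes f :: "real \<Rightarrow> 'a::banach"
  assumes f: "continuous_on UNIV f" and e: "e > 0"
    and le: "\<And>u. norm (f u) \<le> K * exp (- e * \<bar>u\<bar>)"
  shows "(\<lambda>n. integral {- real n..real n} f) \<longlonglongrightarrow> integral UNIV f"
proof -
  have "(\<lambda>n. 4 * K / e * exp (- (e / 2) * real n)) \<longlonglongrightarrow> 0"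
    using e by real_asymp
  then have "(\<lambda>n. integral UNIV f - integral {- real n..real n} f) \<longlonglongrightarrow> 0"
    by (rule Lim_null_comparison[rotated])
       (intro always_eventually allI exp_decay_tail_le[OF f e le])
  from tendsto_diff[OF tendsto_const[of "integral UNIV f"] this] show ?thesis by simp
qed

text \<open>For \<open>F\<close> holomorphic on the strip, \<open>J\<close> is multiplication by the imaginary unit.\<close>

lemma integral_strip_shift:
  fixes F D :: "complex \<Rightarrow> 'a::banach"
  assumes J: "bounded_linear J" and e: "e > 0" and ab: "a \<le> b"
    and der: "\<And>w. Im w \<in> {a..b} \<Longrightarrow>
       (F has_derivative (\<lambda>h. Re h *\<^sub>R D w + Im h *\<^sub>R J (D w))) (at w)"
    and D: "continuous_on {w. Im w \<in> {a..b}} D"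
    and le: "\<And>w. Im w \<in> {a..b} \<Longrightarrow> norm (F w) \<le> K * exp (- e * \<bar>Re w\<bar>)"
  shows "integral UNIV (\<lambda>u. F (Complex u a)) = integral UNIV (\<lambda>u. F (Complex u b))"
proof -
  have Fc: "continuous_on {w. Im w \<in> {a..b}} F"
    by (rule continuous_at_imp_continuous_on) (use has_derivative_continuous[OF der] in blast)
  have Fcu: "continuous_on S (\<lambda>u. F (Complex u y))" if "y \<in> {a..b}" for y S
    by (rule continuous_on_compose2[OF Fc]) (use that in \<open>auto intro!: continuous_intros\<close>)
  have Cy: "(Complex u has_derivative Complex 0) (at y within S)" for u y S
    unfolding Complex_eq[abs_def] by (auto intro!: derivative_eq_intros)
  have Cu: "((\<lambda>u. Complex u y) has_derivative (\<lambda>h. Complex h 0)) (at u within S)" for u y S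
    unfolding Complex_eq by (auto intro!: derivative_eq_intros)
  have der_y: "((\<lambda>y. F (Complex u y)) has_vector_derivative J (D (Complex u y))) (at y within S)"
    if "y \<in> {a..b}" for u y S
    unfolding has_vector_derivative_def
    by (rule has_derivative_eq_rhs, rule has_derivative_compose[where f="Complex u" and g=F, OF Cy der])
       (use that in auto)
  have der_u: "((\<lambda>u. F (Complex u y)) has_vector_derivative D (Complex u y)) (at u within S)"
    if "y \<in> {a..b}" for u y S
    unfolding has_vector_derivative_def
    by (rule has_derivative_eq_rhs, rule has_derivative_compose[where f="\<lambda>u. Complex u y" and g=F, OF Cu der])
       (use that in auto)
  \<comment> \<open>\<open>I n y\<close> is the integral over a segment of height \<open>y\<close>.
    Its derivative in \<open>y\<close> is the integral of \<open>J\<close> applied to the horizontal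
    derivative, hence \<open>E n y\<close>, the \<open>J\<close>-image of the difference of the end
    values, which decays in \<open>n\<close>.\<close>
  define I where "I n y = integral (cbox (- real n) (real n)) (\<lambda>u. F (Complex u y))" for n y
  define E where "E n y = J (F (Complex (real n) y) - F (Complex (- real n) y))" for n y
  have Dc: "continuous_on ({a..b} \<times> S) (\<lambda>(y, u). D (Complex u y))" for S
    unfolding split_beta
    by (rule continuous_on_compose2[OF D]) (auto intro!: continuous_intros)
  have I_der: "(I n has_vector_derivative E n y) (at y within {a..b})" if y: "y \<in> {a..b}" for n y
  proof -
    have "(I n has_vector_derivative integral (cbox (- real n) (real n)) (\<lambda>u. J (D (Complex u y)))) (at y within {a..b})"
      unfolding I_def
    proof (rule leibniz_rule_vector_derivative)
      show "continuous_on ({a..b} \<times> cbox (- real n) (real n)) (\<lambda>(x, t). J (D (Complex t x)))"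
        using bounded_linear.continuous_on[OF J Dc] by (simp add: split_beta)
    qed (use y der_y Fcu in \<open>auto intro!: integrable_continuous_interval\<close>)
    moreover have "((\<lambda>u. D (Complex u y)) has_integral (F (Complex (real n) y) - F (Complex (- real n) y))) {- real n..real n}"
      by (rule fundamental_theorem_of_calculus) (use der_u y in auto)
    from integral_unique[OF has_integral_linear[OF this J]]
    have "integral (cbox (- real n) (real n)) (\<lambda>u. J (D (Complex u y))) = E n y"
      by (simp add: E_def o_def)
    ultimately show ?thesis by simp
  qed
  obtain B where B: "B > 0" "\<And>x. norm (J x) \<le> norm x * B"
    using bounded_linear.pos_bounded[OF J] by blast
  have E_le: "norm (E n y) \<le> 2 * K * B * exp (- e * real n)" if "y \<in> {a..b}" for n y
  proof -
    have "norm (F (Complex (real n) y) - F (Complex (- real n) y))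
        \<le> K * exp (- e * real n) + K * exp (- e * real n)"
      using le[of "Complex (real n) y"] le[of "Complex (- real n) y"] that
      by (intro norm_triangle_le_diff add_mono) auto
    from mult_right_mono[OF this, of B] B show ?thesis
      unfolding E_def by (intro order_trans[OF B(2)]) (auto simp: mult_ac)
  qed
  have "norm (I n b - I n a) \<le> 2 * K * B * exp (- e * real n) * norm (b - a)" for n
  proof (rule differentiable_bound[where S="{a..b}" and f'="\<lambda>y h. h *\<^sub>R E n y"])
    show "(I n has_derivative (\<lambda>h. h *\<^sub>R E n y)) (at y within {a..b})" if "y \<in> {a..b}" for y
      using I_der[OF that] by (simp add: has_vector_derivative_def)
    show "onorm (\<lambda>h. h *\<^sub>R E n y) \<le> 2 * K * B * exp (- e * real n)" if "y \<in> {a..b}" for y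
      using E_le[OF that] by (intro onorm_le) (auto simp: mult.commute intro!: mult_left_mono)
  qed (use ab in auto)
  moreover have "(\<lambda>n. 2 * K * B * exp (- e * real n) * norm (b - a)) \<longlonglongrightarrow> 0"
    using e by real_asymp
  ultimately have "(\<lambda>n. I n b - I n a) \<longlonglongrightarrow> 0"
    by - (rule Lim_null_comparison[OF always_eventually, rotated], assumption, blast)
  moreover have "(\<lambda>n. I n y) \<longlonglongrightarrow> integral UNIV (\<lambda>u. F (Complex u y))" if "y \<in> {a..b}" for y
    unfolding I_def box_real
  proof (rule exp_decay_integral_tendsto[OF Fcu e])
    show "norm (F (Complex u y)) \<le> K * exp (- e * \<bar>u\<bar>)" for u
      using le[of "Complex u y"] that by simp
  qed (rule that)
  then have "(\<lambda>n. I n b - I n a) \<longlonglongrightarrow> integral UNIV (\<lambda>u. F (Complex u b)) - integral UNIV (\<lambda>u. F (Complex u a))"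
    using ab by (intro tendsto_diff) auto
  ultimately show ?thesis using LIMSEQ_unique by fastforce
qed

text \<open>On squares the integrals of a continuous function may be swapped. The claim
  \<open>lim\<close> identifies the limit over growing squares with an iterated integral over the
  plane; it is applied to \<open>f\<close> and to its transpose.\<close>

lemma integral_swap_exp_decay:
  fixes f :: "real \<Rightarrow> real \<Rightarrow> 'a::banach"
  assumes c: "continuous_on UNIV (\<lambda>(u, v). f u v)" and e: "e > 0"
    and le: "\<And>u v. norm (f u v) \<le> K * (exp (- e * \<bar>u\<bar>) * exp (- e * \<bar>v\<bar>))"
  shows "integral UNIV (\<lambda>u. integral UNIV (f u)) = integral UNIV (\<lambda>v. integral UNIV (\<lambda>u. f u v))"
proof -
  define R where "R g n = integral {- real n..real n} (\<lambda>u. integral {- real n..real n} (g u))"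
    for g :: "real \<Rightarrow> real \<Rightarrow> 'a" and n :: nat
  have lim: "R g \<longlonglongrightarrow> integral UNIV (\<lambda>u. integral UNIV (g u))"
    if c: "continuous_on UNIV (\<lambda>(u, v). g u v)"
      and le: "\<And>u v. norm (g u v) \<le> K * (exp (- e * \<bar>u\<bar>) * exp (- e * \<bar>v\<bar>))"
    for g :: "real \<Rightarrow> real \<Rightarrow> 'a"
  proof -
    have K: "K \<ge> 0" using le[of 0 0] norm_ge_zero[of "g 0 0"] by (simp del: norm_ge_zero)
    have gc: "continuous_on S (g u)" for S u
      using continuous_on_compose2[OF c, of S "\<lambda>v. (u, v)"] by (simp add: continuous_intros)
    define G where "G n u = integral (cbox (- real n) (real n)) (g u)" for n u
    define H where "H u = integral UNIV (g u)" for u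
    have Gc: "continuous_on S (G n)" for n S
      unfolding G_def
      by (rule continuous_on_subset[OF integral_continuous_on_param[of UNIV]])
         (use continuous_on_subset[OF c] in auto)
    have GH: "norm (H u - G n u) \<le> 4 * (K * exp (- e * \<bar>u\<bar>)) / e * exp (- (e / 2) * real n)" for n u
      unfolding G_def H_def box_real
      by (rule exp_decay_tail_le[OF gc e]) (use le[of u] in \<open>simp only: mult.assoc\<close>)
    have H_le: "norm (H u) \<le> 2 * K / e * exp (- e * \<bar>u\<bar>)" for u
      using exp_decay_norm_integral_le[OF gc e, of u "K * exp (- e * \<bar>u\<bar>)" 0] le[of u]
      by (simp add: H_def mult_ac)
    \<comment> \<open>The tail bound of the inner integral is uniform in \<open>u\<close>, so
      \<open>H\<close> is a uniform limit of continuous functions and can be integrated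
      itself.\<close>
    have Hc: "continuous_on UNIV H"
    proof (rule uniform_limit_theorem[where F=sequentially])
      show "uniform_limit UNIV G H sequentially"
      proof (rule uniform_limitI)
        fix d :: real assume "d > 0"
        have "(\<lambda>n. 4 * K / e * exp (- (e / 2) * real n)) \<longlonglongrightarrow> 0"
          using e by real_asymp
        then have "\<forall>\<^sub>F n in sequentially. 4 * K / e * exp (- (e / 2) * real n) < d"
          using \<open>d > 0\<close> by (rule order_tendstoD)
        then show "\<forall>\<^sub>F n in sequentially. \<forall>u\<in>UNIV. dist (G n u) (H u) < d"
        proof eventually_elim
          case (elim n)
          have "dist (G n u) (H u) \<le> 4 * K / e * exp (- (e / 2) * real n)" for u
          proof -
            have "4 * K / e * exp (- (e / 2) * real n) * exp (- e * \<bar>u\<bar>)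
                \<le> 4 * K / e * exp (- (e / 2) * real n) * 1"
              using e K by (intro mult_left_mono) auto
            with GH[of u n] show ?thesis by (simp add: dist_norm norm_minus_commute mult_ac)
          qed
          with elim show ?case by (auto intro: le_less_trans)
        qed
      qed
    qed (use Gc in auto)
    \<comment> \<open>Only the inner truncation matters here: the error is a uniform tail times the
      length 2 n of the outer interval, and the exponential wins.\<close>
    have "(\<lambda>n. integral {- real n..real n} H - R g n) \<longlonglongrightarrow> 0"
    proof (rule Lim_null_comparison[OF always_eventually])
      show "(\<lambda>n. 4 * K / e * exp (- (e / 2) * real n) * (2 * real n)) \<longlonglongrightarrow> 0"
        using e by real_asymp
      show "\<forall>n. norm (integral {- real n..real n} H - R g n) \<le> 4 * K / e * exp (- (e / 2) * real n) * (2 * real n)"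
      proof
        fix n
        have "integral {- real n..real n} H - R g n = integral {- real n..real n} (\<lambda>u. H u - G n u)"
          unfolding R_def G_def[symmetric, unfolded box_real]
          by (subst integral_diff) (auto intro!: integrable_continuous_interval Gc continuous_on_subset[OF Hc])
        also have "norm \<dots> \<le> 4 * K / e * exp (- (e / 2) * real n) * (real n - - real n)"
        proof (rule integral_bound)
          show "norm (H u - G n u) \<le> 4 * K / e * exp (- (e / 2) * real n)" for u
          proof -
            have "4 * K / e * exp (- (e / 2) * real n) * exp (- e * \<bar>u\<bar>)
                \<le> 4 * K / e * exp (- (e / 2) * real n) * 1"
              using e K by (intro mult_left_mono) auto
            with GH[of u n] show ?thesis by (simp add: mult_ac)
          qed
        qed (auto intro!: continuous_intros Gc continuous_on_subset[OF Hc])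
        finally show "norm (integral {- real n..real n} H - R g n) \<le> 4 * K / e * exp (- (e / 2) * real n) * (2 * real n)"
          by simp
      qed
    qed
    moreover have "(\<lambda>n. integral {- real n..real n} H) \<longlonglongrightarrow> integral UNIV H"
      by (rule exp_decay_integral_tendsto[OF Hc e H_le])
    ultimately have "R g \<longlonglongrightarrow> integral UNIV H"
      using Lim_transform2 tendsto_diff[of "\<lambda>n. integral {- real n..real n} H" "integral UNIV H" sequentially]
      by fastforce
    then show ?thesis by (simp add: H_def[abs_def])
  qed
  have c': "continuous_on UNIV (\<lambda>(v, u). f u v)"
    using continuous_on_compose2[OF c continuous_on_swap, of UNIV] by (simp add: prod.swap_def split_beta)
  have "R f n = R (\<lambda>v u. f u v) n" for n
    using integral_swap_continuous[OF continuous_on_subset[OF c], of "- real n" "- real n" "real n" "real n"]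
    by (simp add: R_def)
  then have "R f = R (\<lambda>v u. f u v)" by (rule ext)
  moreover have "R f \<longlonglongrightarrow> integral UNIV (\<lambda>u. integral UNIV (f u))" by (rule lim[OF c le])
  moreover have "R (\<lambda>v u. f u v) \<longlonglongrightarrow> integral UNIV (\<lambda>v. integral UNIV (\<lambda>u. f u v))"
    by (rule lim[OF c']) (metis le mult.commute)
  ultimately show ?thesis using LIMSEQ_unique by metis
qed

text \<open>Here \<open>J\<close> is multiplication by the imaginary unit; splitting h into real and
  imaginary part turns complex differentiability into the hypothesis of
  \<open>integral_strip_shift\<close>.\<close>

lemma integral_strip_shift_holomorphic:
  fixes F D :: "complex \<Rightarrow> 'a::complex_banach"
  assumes "e > 0" "a \<le> b"
    and der: "\<And>w. Im w \<in> {a..b} \<Longrightarrow> (F has_derivative (\<lambda>h. h *\<^sub>C D w)) (at w)"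
    and "continuous_on {w. Im w \<in> {a..b}} D"
    and "\<And>w. Im w \<in> {a..b} \<Longrightarrow> norm (F w) \<le> K * exp (- e * \<bar>Re w\<bar>)"
  shows "integral UNIV (\<lambda>u. F (Complex u a)) = integral UNIV (\<lambda>u. F (Complex u b))"
proof (rule integral_strip_shift[where J="scaleC \<i>"])
  have eq: "h *\<^sub>C x = Re h *\<^sub>R x + Im h *\<^sub>R \<i> *\<^sub>C x" for h and x :: 'a
  proof -
    have "h = complex_of_real (Re h) + complex_of_real (Im h) * \<i>" by (simp add: complex_eq_iff)
    then have "h *\<^sub>C x = (complex_of_real (Re h) + complex_of_real (Im h) * \<i>) *\<^sub>C x" by simp
    then show ?thesis by (simp only: scaleC_add_left scaleC_scaleC[symmetric] scaleC_of_real)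
  qed
  show "(F has_derivative (\<lambda>h. Re h *\<^sub>R D w + Im h *\<^sub>R \<i> *\<^sub>C D w)) (at w)"
    if "Im w \<in> {a..b}" for w
    using der[OF that] by (simp only: eq[symmetric])
qed (use assms scaleC.bounded_linear_right in auto)

text \<open>Caratheodory's criterion with values in X. It suits the resolvent, whose increments
  factor exactly by the resolvent identity.\<close>

lemma has_derivative_scaleC_caratheodory:
  fixes F G :: "complex \<Rightarrow> 'a::complex_banach"
  assumes "open S" "w \<in> S" and eq: "\<And>v. v \<in> S \<Longrightarrow> F v - F w = (v - w) *\<^sub>C G v" and G: "isCont G w"
  shows "(F has_derivative (\<lambda>h. h *\<^sub>C G w)) (at w)"
  unfolding has_derivative_iff_norm
proof
  show "bounded_linear (\<lambda>h. h *\<^sub>C G w)" by (rule scaleC.bounded_linear_left)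
  have "((\<lambda>v. norm (G v - G w)) \<longlongrightarrow> 0) (at w)"
    using G unfolding isCont_def by (simp add: tendsto_norm_zero_iff LIM_zero)
  moreover have "\<forall>\<^sub>F v in at w. norm (G v - G w) = norm (F v - F w - (v - w) *\<^sub>C G w) / norm (v - w)"
    using eventually_at_in_open[OF assms(1,2)]
  proof eventually_elim
    case (elim v)
    then have "F v - F w - (v - w) *\<^sub>C G w = (v - w) *\<^sub>C (G v - G w)"
      by (simp add: eq scaleC.diff_right)
    with elim show ?case by (simp add: norm_scaleC)
  qed
  ultimately show "((\<lambda>v. norm (F v - F w - (v - w) *\<^sub>C G w) / norm (v - w)) \<longlongrightarrow> 0) (at w)"
    by (rule Lim_transform_eventually)
qed

section \<open>Sectors in logarithmic coordinates\<close>

lemma sector_eq_exp_image: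
  assumes "0 < \<tau>" "\<tau> \<le> pi"
  shows "sector \<tau> = exp ` {w. \<bar>Im w\<bar> < \<tau>}"
proof
  have "exp w \<notin> \<real>\<^sub>\<le>\<^sub>0" if "\<bar>Im w\<bar> < \<tau>" for w
  proof
    assume "exp w \<in> \<real>\<^sub>\<le>\<^sub>0"
    then have "Re (exp w) \<le> 0" "Im (exp w) = 0" by (auto simp: complex_nonpos_Reals_iff)
    moreover from this have "Re (exp w) \<noteq> 0" by (metis complex_eqI exp_not_eq_zero zero_complex.sel)
    ultimately have "Arg (exp w) = pi" by (simp add: Arg_eq_pi)
    with that assms show False by (simp add: Arg_exp abs_less_iff)
  qed
  then show "exp ` {w. \<bar>Im w\<bar> < \<tau>} \<subseteq> sector \<tau>"
    using assms by (auto simp: sector_def Arg_exp abs_less_iff)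
  show "sector \<tau> \<subseteq> exp ` {w. \<bar>Im w\<bar> < \<tau>}"
  proof
    fix z assume "z \<in> sector \<tau>"
    then have "z \<notin> \<real>\<^sub>\<le>\<^sub>0" "\<bar>Arg z\<bar> < \<tau>" using assms by (auto simp: sector_def)
    moreover from this have "z \<noteq> 0" by auto
    ultimately show "z \<in> exp ` {w. \<bar>Im w\<bar> < \<tau>}"
      by (intro image_eqI[of _ _ "Ln z"]) (auto simp: Arg_eq_Im_Ln)
  qed
qed

lemma exp_in_sector: "0 < \<tau> \<Longrightarrow> \<tau> \<le> pi \<Longrightarrow> \<bar>Im w\<bar> < \<tau> \<Longrightarrow> exp w \<in> sector \<tau>"
  by (simp add: sector_eq_exp_image)

lemma sector_mono: "0 < \<tau>' \<Longrightarrow> \<tau>' \<le> \<tau> \<Longrightarrow> sector \<tau>' \<subseteq> sector \<tau>"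
  by (auto simp: sector_def)

text \<open>The cone \<open>?C\<close> is closed, contains the sector, and at \<open>exp w\<close>
  its inequality reads cos omega <= cos (Im w). Cosines make the condition independent of the branch
  of the logarithm, which matters when a contour crosses the negative half-line.\<close>

lemma exp_notin_closure_sector:
  assumes "0 \<le> \<omega>" "\<omega> < pi" "cos (Im w) < cos \<omega>"
  shows "exp w \<notin> closure (sector \<omega>)"
proof -
  let ?C = "{z. cmod z * cos \<omega> \<le> Re z}"
  have "sector \<omega> \<subseteq> ?C"
  proof (cases "\<omega> = 0")
    case True then show ?thesis by (auto simp: sector_def)
  next
    case False
    have "cmod z * cos \<omega> \<le> Re z" if "z \<in> sector \<omega>" for z
    proof -
      have "z \<in> exp ` {w. \<bar>Im w\<bar> < \<omega>}"
        using that sector_eq_exp_image[of \<omega>] assms(1,2) False by simp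
      then obtain v where v: "z = exp v" "\<bar>Im v\<bar> < \<omega>" by (elim imageE CollectE)
      then have "cos \<omega> \<le> cos \<bar>Im v\<bar>"
        using assms(2) by (intro cos_monotone_0_pi_le) auto
      with v show ?thesis by (simp add: Re_exp)
    qed
    then show ?thesis by auto
  qed
  moreover have "closed ?C" by (intro closed_Collect_le continuous_intros)
  ultimately have "closure (sector \<omega>) \<subseteq> ?C" by (rule closure_minimal)
  with assms show ?thesis by (auto simp: Re_exp)
qed

text \<open>By the law of cosines the squared distance is a^2 + b^2 - 2 a b k, where k <= cos delta
  because the arguments stay delta apart modulo 2 pi. This is at least (1 - cos delta) / 2 times a^2
  + b^2, and (1 - cos delta) / 2 is the square of sin (delta / 2).\<close>

lemma exp_diff_lower_bound:
  assumes d: "0 < \<delta>" "\<delta> \<le> pi" and "\<delta> \<le> \<bar>Im v - Im w\<bar>" "\<bar>Im v - Im w\<bar> \<le> 2 * pi - \<delta>"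
  shows "sin (\<delta> / 2) * exp (Re v) \<le> cmod (exp v - exp w)"
proof -
  define a b k where "a = exp (Re v)" "b = exp (Re w)" "k = cos (Im v - Im w)"
  have ab: "a > 0" "b > 0" by (auto simp: a_b_k_def)
  have k: "k \<le> cos \<delta>"
  proof (cases "\<bar>Im v - Im w\<bar> \<le> pi")
    case True
    then have "cos \<bar>Im v - Im w\<bar> \<le> cos \<delta>"
      using assms by (intro cos_monotone_0_pi_le) auto
    then show ?thesis by (simp add: a_b_k_def)
  next
    case False
    then have "cos (2 * pi - \<bar>Im v - Im w\<bar>) \<le> cos \<delta>"
      using assms by (intro cos_monotone_0_pi_le) auto
    moreover have "cos (2 * pi - \<bar>Im v - Im w\<bar>) = cos \<bar>Im v - Im w\<bar>"
      by (simp add: cos_diff del: cos_abs_real)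
    ultimately show ?thesis by (simp add: a_b_k_def)
  qed
  have s: "(sin (\<delta> / 2))\<^sup>2 = (1 - cos \<delta>) / 2"
    using cos_double_sin[of "\<delta> / 2"] by simp
  have "(cmod (exp v - exp w))\<^sup>2 = a\<^sup>2 + b\<^sup>2 - 2 * a * b * k"
  proof -
    have "(cmod (exp v - exp w))\<^sup>2 = a\<^sup>2 * ((cos (Im v))\<^sup>2 + (sin (Im v))\<^sup>2)
        + b\<^sup>2 * ((cos (Im w))\<^sup>2 + (sin (Im w))\<^sup>2) - 2 * a * b * k"
      unfolding cmod_power2 minus_complex.sel Re_exp Im_exp a_b_k_def cos_diff by algebra
    then show ?thesis by simp
  qed
  moreover have "a * b * k \<le> a * b * cos \<delta>" using ab k by (intro mult_left_mono) auto
  moreover have "(1 - cos \<delta>) / 2 * a\<^sup>2 \<le> a\<^sup>2 + b\<^sup>2 - 2 * (a * b * cos \<delta>)"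
  proof -
    have "(1 - cos \<delta>) / 2 * a\<^sup>2 \<le> (1 - cos \<delta>) / 2 * (a\<^sup>2 + b\<^sup>2) "
      by (intro mult_left_mono) auto
    \<comment> \<open>For cos delta >= 0 the mixed term is at most cos delta (a^2 + b^2), which even
      leaves 1 - cos delta; for cos delta < 0 it helps, and (1 - cos delta) / 2 <= 1.\<close>
    also have "\<dots> \<le> a\<^sup>2 + b\<^sup>2 - 2 * (a * b * cos \<delta>)"
    proof (cases "cos \<delta> \<ge> 0")
      case True
      have "cos \<delta> * (2 * (a * b)) \<le> cos \<delta> * (a\<^sup>2 + b\<^sup>2)"
        using True sum_squares_bound[of a b] by (intro mult_left_mono) (auto simp: mult.assoc)
      moreover have "cos \<delta> * (a\<^sup>2 + b\<^sup>2) \<le> 1 * (a\<^sup>2 + b\<^sup>2)" by (intro mult_right_mono) auto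
      ultimately show ?thesis by (simp add: field_simps)
    next
      case False
      have "(1 - cos \<delta>) / 2 * (a\<^sup>2 + b\<^sup>2) \<le> 1 * (a\<^sup>2 + b\<^sup>2)"
        using cos_ge_minus_one[of \<delta>] by (intro mult_right_mono) (auto simp del: cos_ge_minus_one)
      moreover have "a * b * cos \<delta> \<le> 0" using ab False by (simp add: mult_le_0_iff)
      ultimately show ?thesis by simp
    qed
    finally show ?thesis .
  qed
  ultimately have "(sin (\<delta> / 2) * a)\<^sup>2 \<le> (cmod (exp v - exp w))\<^sup>2"
    by (simp add: power_mult_distrib s)
  then show ?thesis unfolding a_b_k_def(1) by (rule power2_le_imp_le) simp
qed

text \<open>In the coordinate w the function is a bump of height \<open>K\<close> and rate
  \<open>e\<close> centred at Re w = -a. A dilation by r adds ln r to \<open>a\<close> and leaves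
  \<open>e\<close> and \<open>K\<close> alone; this is why \<open>a\<close> is carried as a
  parameter.\<close>

definition decays :: "real \<Rightarrow> real \<Rightarrow> real \<Rightarrow> real \<Rightarrow> (complex \<Rightarrow> complex) \<Rightarrow> bool" where
  "decays \<tau> e K a \<phi> \<longleftrightarrow> \<phi> holomorphic_on sector \<tau> \<and>
     (\<forall>w. \<bar>Im w\<bar> < \<tau> \<longrightarrow> cmod (\<phi> (exp w)) \<le> K * exp (- e * \<bar>Re w + a\<bar>))"

lemma decaysD:
  assumes "decays \<tau> e K a \<phi>"
  shows "\<phi> holomorphic_on sector \<tau>"
    and "\<bar>Im w\<bar> < \<tau> \<Longrightarrow> cmod (\<phi> (exp w)) \<le> K * exp (- e * \<bar>Re w + a\<bar>)"
  using assms by (auto simp: decays_def)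

lemma decays_nonneg:
  assumes "decays \<tau> e K a \<phi>" "0 < \<tau>" shows "0 \<le> K"
proof -
  have "0 \<le> K * exp (- e * \<bar>Re 0 + a\<bar>)"
    using decaysD(2)[OF assms(1), of 0] assms(2) by (intro order_trans[OF norm_ge_zero]) auto
  then show ?thesis by (simp add: zero_le_mult_iff)
qed

lemma decays_shift:
  assumes "decays \<tau> e K a \<phi>" "0 < \<tau>" "0 \<le> e"
  shows "decays \<tau> e (K * exp (e * \<bar>a - b\<bar>)) b \<phi>"
proof -
  have "K * exp (- e * \<bar>Re w + a\<bar>) \<le> K * exp (e * \<bar>a - b\<bar>) * exp (- e * \<bar>Re w + b\<bar>)" for w
  proof -
    have "e * \<bar>Re w + b\<bar> \<le> e * (\<bar>a - b\<bar> + \<bar>Re w + a\<bar>)"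
      using assms(3) by (intro mult_left_mono) auto
    then have "exp (- e * \<bar>Re w + a\<bar>) \<le> exp (e * \<bar>a - b\<bar> + - e * \<bar>Re w + b\<bar>)"
      by (simp add: algebra_simps)
    then show ?thesis
      unfolding exp_add mult.assoc using decays_nonneg[OF assms(1,2)] by (rule mult_left_mono)
  qed
  with assms(1) show ?thesis unfolding decays_def by (meson order_trans)
qed

lemma decays_exp:
  assumes "decays \<tau> e K a \<phi>" "0 < \<tau>" "\<tau> \<le> pi"
  shows "(\<lambda>w. \<phi> (exp w)) holomorphic_on {w. \<bar>Im w\<bar> < \<tau>}"
proof -
  have "\<phi> \<circ> exp holomorphic_on {w. \<bar>Im w\<bar> < \<tau>}"
    by (rule holomorphic_on_compose_gen[OF _ decaysD(1)[OF assms(1)]])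
       (use assms exp_in_sector in \<open>auto intro: holomorphic_intros\<close>)
  then show ?thesis by (simp add: o_def)
qed

lemma open_strip: "open {w. \<bar>Im w\<bar> < \<tau>}"
  by (intro open_Collect_less continuous_intros)

lemma convex_strip: "convex {w. \<bar>Im w\<bar> < \<tau>}"
proof -
  have "{w. \<bar>Im w\<bar> < \<tau>} = {w. Im w < \<tau>} \<inter> {w. Im w > - \<tau>}" by auto
  then show ?thesis by (simp add: convex_Int convex_halfspace_Im_lt convex_halfspace_Im_gt)
qed

lemma decays_mult_bounded:
  assumes "decays \<tau> e K a \<phi>" "0 < \<tau>" "\<tau> \<le> pi" and f: "f holomorphic_on sector \<tau>"
    and le: "\<And>z. z \<in> sector \<tau> \<Longrightarrow> cmod (f z) \<le> L"
  shows "decays \<tau> e (L * K) a (\<lambda>z. f z * \<phi> z)"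
  unfolding decays_def
proof (intro conjI allI impI)
  show "(\<lambda>z. f z * \<phi> z) holomorphic_on sector \<tau>"
    by (intro holomorphic_intros f decaysD(1)[OF assms(1)])
  fix w assume w: "\<bar>Im w\<bar> < \<tau>"
  then have "cmod (f (exp w)) * cmod (\<phi> (exp w)) \<le> L * (K * exp (- e * \<bar>Re w + a\<bar>))"
    using assms(2,3) by (intro mult_mono le exp_in_sector decaysD(2)[OF assms(1)])
       (auto intro: order_trans[OF norm_ge_zero le[OF exp_in_sector[OF assms(2,3) w]]])
  then show "cmod (f (exp w) * \<phi> (exp w)) \<le> L * K * exp (- e * \<bar>Re w + a\<bar>)"
    by (simp add: norm_mult mult.assoc)
qed

section \<open>Scalar Cauchy theorem and Cauchy formula on strips\<close>

lemma contour_integral_linepath_horizontal: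
  fixes f :: "complex \<Rightarrow> complex"
  assumes "a < b" and f: "continuous_on {w. Im w = y \<and> Re w \<in> {a..b}} f"
  shows "contour_integral (linepath (Complex a y) (Complex b y)) f = integral {a..b} (\<lambda>x. f (Complex x y))"
proof -
  have "((\<lambda>t. f (linepath (Complex a y) (Complex b y) t) * (Complex b y - Complex a y)) has_integral
      integral {a..b} (\<lambda>x. f (Complex x y))) {0..1}"
  proof -
    have "((\<lambda>x. f (Complex x y)) has_integral integral {a..b} (\<lambda>x. f (Complex x y))) (cbox a b)"
      unfolding box_real
      by (intro integrable_integral integrable_continuous_interval continuous_on_compose2[OF f])
         (auto intro!: continuous_intros simp: Complex_eq)
    from has_integral_affinity'[OF this, of "b - a" a] assms(1)
    have "((\<lambda>t. f (Complex ((b - a) * t + a) y)) has_integral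
        integral {a..b} (\<lambda>x. f (Complex x y)) /\<^sub>R (b - a)) {0..1}"
      by simp
    from has_integral_mult_left[OF this, of "of_real (b - a)"] assms(1)
    have "((\<lambda>t. f (Complex ((b - a) * t + a) y) * of_real (b - a)) has_integral
        integral {a..b} (\<lambda>x. f (Complex x y))) {0..1}"
      by (simp only: scaleR_conv_of_real) (simp add: field_simps del: of_real_diff)
    moreover have "linepath (Complex a y) (Complex b y) t = Complex ((b - a) * t + a) y" for t
      by (simp add: linepath_def complex_eq_iff algebra_simps)
    moreover have "Complex b y - Complex a y = of_real (b - a)" by (simp add: complex_eq_iff)
    ultimately show ?thesis by simp
  qed
  then show ?thesis
    by (intro contour_integral_unique) (simp add: has_contour_integral_linepath)
qed

lemma continuous_on_exp_quotient:
  assumes "decays \<tau> e K a \<phi>" "0 < \<tau>" "\<tau> \<le> pi" "S \<subseteq> {w. \<bar>Im w\<bar> < \<tau>}" "\<And>w. w \<in> S \<Longrightarrow> exp w \<noteq> \<mu>"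
  shows "continuous_on S (\<lambda>w. \<phi> (exp w) * (exp w / (exp w - \<mu>)))"
  using assms(4,5)
  by (intro continuous_intros continuous_on_subset[OF holomorphic_on_imp_continuous_on[OF decays_exp[OF assms(1-3)]]]) auto

text \<open>\<open>exp v / (exp v - exp w)\<close> is the Cauchy kernel d lambda / (lambda - mu) in
  logarithmic coordinates: bounded along horizontal lines, with the decay left to the
  symbol.\<close>

lemma exp_quotient_le:
  assumes "0 < \<delta>" "\<delta> \<le> pi" "\<delta> \<le> \<bar>Im v - Im w\<bar>" "\<bar>Im v - Im w\<bar> \<le> 2 * pi - \<delta>"
  shows "exp v \<noteq> exp w" "cmod (exp v / (exp v - exp w)) \<le> 1 / sin (\<delta> / 2)"
proof -
  have s: "sin (\<delta> / 2) > 0" using assms(1,2) by (intro sin_gt_zero) auto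
  have le: "sin (\<delta> / 2) * exp (Re v) \<le> cmod (exp v - exp w)"
    by (rule exp_diff_lower_bound[OF assms])
  have "0 < sin (\<delta> / 2) * exp (Re v)" using s by simp
  with le show "exp v \<noteq> exp w" by auto
  with le s show "cmod (exp v / (exp v - exp w)) \<le> 1 / sin (\<delta> / 2)"
    by (simp add: norm_divide field_simps)
qed

text \<open>A rectangle with horizontal sides at heights \<open>- \<nu>\<close> and
  \<open>\<nu>\<close> grows to the strip, and its vertical sides vanish in the limit. Lower line
  minus upper line is the positive orientation.\<close>

lemma Cauchy_integral_formula_strip:
  assumes \<phi>: "decays \<tau> e K 0 \<phi>" and \<tau>: "\<tau> \<le> pi" and e: "e > 0"
    and w0: "\<bar>Im w0\<bar> < \<nu>" and \<nu>: "\<nu> < \<tau>"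
  shows "integral UNIV (\<lambda>u. \<phi> (exp (Complex u (-\<nu>))) * (exp (Complex u (-\<nu>)) / (exp (Complex u (-\<nu>)) - exp w0)))
       - integral UNIV (\<lambda>u. \<phi> (exp (Complex u \<nu>)) * (exp (Complex u \<nu>) / (exp (Complex u \<nu>) - exp w0)))
       = 2 * pi * \<i> * \<phi> (exp w0)"
proof -
  have \<tau>0: "0 < \<tau>" using w0 \<nu> by linarith
  note K = decays_nonneg[OF \<phi> \<tau>0]
  let ?T = "{w. \<bar>Im w\<bar> < \<tau>}"
  define g where "g w = \<phi> (exp w) * (exp w / (exp w - exp w0))" for w
  \<comment> \<open>\<open>E\<close> is the difference quotient of exp at \<open>w0\<close>,
    completed by the derivative: entire, and zero-free on the strip because imaginary parts there
    differ from Im w0 by less than 2 pi. It turns \<open>g\<close> into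
    \<open>f w / (w - w0)\<close> with \<open>f\<close> holomorphic, the shape required by the
    Cauchy formula.\<close>
  define E where "E w = (if w = w0 then deriv exp w0 else (exp w - exp w0) / (w - w0))" for w
  define f where "f w = \<phi> (exp w) * (exp w / E w)" for w
  have inj: "exp w \<noteq> exp w0" if "w \<in> ?T" "w \<noteq> w0" for w
  proof -
    have "\<bar>Im w - Im w0\<bar> < 2 * pi" using that w0 \<nu> \<tau> by auto
    with that show ?thesis using exp_complex_eqI by blast
  qed
  have deriv_exp: "deriv exp w = exp w" for w :: complex by (rule DERIV_imp_deriv[OF DERIV_exp])
  have "E holomorphic_on UNIV"
    unfolding E_def by (rule pole_lemma_open) (auto intro: holomorphic_intros)
  moreover have "E w \<noteq> 0" if "w \<in> ?T" for w
    using inj[OF that] by (auto simp: E_def deriv_exp)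
  ultimately have fh: "f holomorphic_on ?T"
    unfolding f_def using decays_exp[OF \<phi> \<tau>0 \<tau>]
    by (intro holomorphic_intros) (auto intro: holomorphic_on_subset)
  have fw0: "f w0 = \<phi> (exp w0)" by (simp add: f_def E_def deriv_exp)
  have fg: "f w / (w - w0) = g w" if "w \<noteq> w0" for w
    using that by (simp add: f_def g_def E_def)
  have gc: "continuous_on S g" if "S \<subseteq> ?T - {w0}" for S
    unfolding g_def using that inj by (intro continuous_on_exp_quotient[OF \<phi> \<tau>0 \<tau>]) auto
  define \<delta> where "\<delta> = \<nu> - \<bar>Im w0\<bar>"
  have \<delta>: "0 < \<delta>" "\<delta> \<le> pi" using w0 \<nu> \<tau> by (auto simp: \<delta>_def)
  have s: "sin (\<delta> / 2) > 0" using \<delta> by (intro sin_gt_zero) auto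
  have g_le: "cmod (g (Complex u y)) \<le> K / sin (\<delta> / 2) * exp (- e * \<bar>u\<bar>)" if "y = \<nu> \<or> y = - \<nu>" for u y
  proof -
    have "cmod (\<phi> (exp (Complex u y))) * cmod (exp (Complex u y) / (exp (Complex u y) - exp w0))
        \<le> (K * exp (- e * \<bar>u + 0\<bar>)) * (1 / sin (\<delta> / 2))"
      using that w0 \<nu> \<tau> \<delta>_def K decaysD(2)[OF \<phi>, of "Complex u y"]
      by (intro mult_mono exp_quotient_le(2)[OF \<delta>]) auto
    then show ?thesis by (simp add: g_def norm_mult norm_divide)
  qed
  have gcu: "continuous_on S (\<lambda>u. g (Complex u y))" if "y = \<nu> \<or> y = - \<nu>" for y S
    by (rule continuous_on_compose2[OF gc[of "{w. Im w = y}"]])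
       (use that w0 \<nu> in \<open>auto intro!: continuous_intros simp: Complex_eq\<close>)
  have lim: "(\<lambda>n. integral {- real n..real n} (\<lambda>u. g (Complex u y))) \<longlonglongrightarrow> integral UNIV (\<lambda>u. g (Complex u y))"
    if "y = \<nu> \<or> y = - \<nu>" for y
    by (rule exp_decay_integral_tendsto[OF gcu[OF that] e g_le[OF that]])
  define V where "V n = contour_integral (linepath (Complex (real n) (-\<nu>)) (Complex (real n) \<nu>)) g
      - contour_integral (linepath (Complex (- real n) (-\<nu>)) (Complex (- real n) \<nu>)) g" for n
  have V_le: "cmod (contour_integral (linepath (Complex x (-\<nu>)) (Complex x \<nu>)) g) \<le> 2 * K * exp (- e * \<bar>x\<bar>) * (2 * \<nu>)"
    if x: "\<bar>x\<bar> > \<bar>Re w0\<bar> + 1" for x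
  proof -
    have seg: "closed_segment (Complex x (-\<nu>)) (Complex x \<nu>) \<subseteq> {w. Re w = x \<and> \<bar>Im w\<bar> \<le> \<nu>}"
      by (subst closed_segment_same_Re) (use w0 in \<open>auto simp: closed_segment_eq_real_ivl split: if_splits\<close>)
    have b: "cmod (g w) \<le> 2 * K * exp (- e * \<bar>x\<bar>)" if w: "Re w = x" "\<bar>Im w\<bar> \<le> \<nu>" for w
    proof -
      \<comment> \<open>As |x| exceeds |Re w0| by more than 1 and 2 <= exp 1, one of the moduli exp
        (Re w), exp (Re w0) is at least twice the other. Then the kernel is bounded by 2 on the
        vertical side.\<close>
      have ab: "a \<le> 2 * \<bar>a - b\<bar>" if "0 < a" "0 < b" "2 * b \<le> a \<or> 2 * a \<le> b" for a b :: real
        using that by (auto simp: abs_if)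
      have "exp (Re w) \<le> 2 * \<bar>exp (Re w) - exp (Re w0)\<bar>"
      proof (cases "x \<ge> 0")
        case True
        have "2 * exp (Re w0) \<le> exp 1 * exp (Re w0)" using exp_ge_add_one_self[of 1] by (intro mult_right_mono) auto
        also have "\<dots> \<le> exp (Re w)" unfolding exp_add[symmetric] using x w True by simp
        finally show ?thesis by (intro ab) auto
      next
        case False
        have "2 * exp (Re w) \<le> exp 1 * exp (Re w)" using exp_ge_add_one_self[of 1] by (intro mult_right_mono) auto
        also have "\<dots> \<le> exp (Re w0)" unfolding exp_add[symmetric] using x w False by simp
        finally show ?thesis by (intro ab) auto
      qed
      also have "\<dots> \<le> 2 * cmod (exp w - exp w0)"
        using norm_triangle_ineq3[of "exp w" "exp w0"] by simp
      finally have "cmod (exp w / (exp w - exp w0)) \<le> 2"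
        by (auto simp: norm_divide divide_le_eq)
      then have "cmod (\<phi> (exp w)) * cmod (exp w / (exp w - exp w0)) \<le> (K * exp (- e * \<bar>x + 0\<bar>)) * 2"
        using w \<nu> K decaysD(2)[OF \<phi>, of w] by (intro mult_mono) auto
      then show ?thesis by (simp add: g_def norm_mult norm_divide mult_ac)
    qed
    have "g contour_integrable_on linepath (Complex x (-\<nu>)) (Complex x \<nu>)"
      by (intro contour_integrable_continuous_linepath gc) (use seg x \<nu> in auto)
    then have "(g has_contour_integral contour_integral (linepath (Complex x (-\<nu>)) (Complex x \<nu>)) g) (linepath (Complex x (-\<nu>)) (Complex x \<nu>))"
      by (rule has_contour_integral_integral)
    then have "cmod (contour_integral (linepath (Complex x (-\<nu>)) (Complex x \<nu>)) g)
        \<le> 2 * K * exp (- e * \<bar>x\<bar>) * cmod (Complex x \<nu> - Complex x (-\<nu>))"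
      by (rule has_contour_integral_bound_linepath) (use seg b K in auto)
    also have "cmod (Complex x \<nu> - Complex x (-\<nu>)) = 2 * \<nu>"
      using w0 by (simp add: cmod_def real_sqrt_mult)
    finally show ?thesis .
  qed
  obtain N :: nat where N: "real N > \<bar>Re w0\<bar> + 1" using reals_Archimedean2 by blast
  have "V \<longlonglongrightarrow> 0"
  proof (rule Lim_null_comparison)
    show "(\<lambda>n. 8 * K * exp (- e * real n) * \<nu>) \<longlonglongrightarrow> 0" using e by real_asymp
    show "\<forall>\<^sub>F n in sequentially. norm (V n) \<le> 8 * K * exp (- e * real n) * \<nu>"
      using eventually_ge_at_top[of N]
    proof eventually_elim
      case (elim n)
      then have n: "real n > \<bar>Re w0\<bar> + 1" using N by linarith
      show ?case unfolding V_def
        using norm_triangle_ineq4 V_le[of "real n"] V_le[of "- real n"] n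
        by (intro order_trans[OF norm_triangle_ineq4]) auto
    qed
  qed
  moreover have "\<forall>\<^sub>F n in sequentially. V n = 2 * pi * \<i> * \<phi> (exp w0)
      - (integral {- real n..real n} (\<lambda>u. g (Complex u (-\<nu>))) - integral {- real n..real n} (\<lambda>u. g (Complex u \<nu>)))"
    using eventually_ge_at_top[of N]
  proof eventually_elim
    case (elim n)
    then have n: "real n > \<bar>Re w0\<bar> + 1" using N by linarith
    let ?a = "Complex (- real n) (-\<nu>)" and ?b = "Complex (real n) (-\<nu>)"
      and ?c = "Complex (real n) \<nu>" and ?d = "Complex (- real n) \<nu>"
    have img: "path_image (rectpath ?a ?c) \<subseteq> ?T - {w0}"
      using n w0 \<nu> by (subst path_image_rectpath) auto
    have "((\<lambda>w. f w / (w - w0)) has_contour_integral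
        (2 * pi * \<i> * winding_number (rectpath ?a ?c) w0 * f w0)) (rectpath ?a ?c)"
      by (rule Cauchy_integral_formula_convex_simple[OF convex_strip fh])
         (use img w0 \<nu> interior_open[OF open_strip] in auto)
    moreover have "winding_number (rectpath ?a ?c) w0 = 1"
      by (rule winding_number_rectpath) (use n w0 in \<open>auto simp: in_box_complex_iff\<close>)
    ultimately have "((\<lambda>w. f w / (w - w0)) has_contour_integral (2 * pi * \<i> * \<phi> (exp w0))) (rectpath ?a ?c)"
      by (simp add: fw0)
    then have "(g has_contour_integral (2 * pi * \<i> * \<phi> (exp w0))) (rectpath ?a ?c)"
      by (rule has_contour_integral_eq) (use img fg in auto)
    then have "contour_integral (rectpath ?a ?c) g = 2 * pi * \<i> * \<phi> (exp w0)"
      by (rule contour_integral_unique)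
    moreover have segs: "continuous_on (closed_segment ?a ?b) g" "continuous_on (closed_segment ?b ?c) g"
       "continuous_on (closed_segment ?c ?d) g" "continuous_on (closed_segment ?d ?a) g"
      using img by (auto intro!: gc simp: rectpath_def Let_def path_image_join)
    ultimately have "contour_integral (linepath ?a ?b) g + contour_integral (linepath ?b ?c) g
       + contour_integral (linepath ?c ?d) g + contour_integral (linepath ?d ?a) g = 2 * pi * \<i> * \<phi> (exp w0)"
      by (simp add: rectpath_def Let_def contour_integrable_continuous_linepath add.assoc)
    moreover have "contour_integral (linepath ?c ?d) g = - contour_integral (linepath ?d ?c) g"
      using contour_integral_reverse_linepath[OF segs(3)] .
    moreover have "contour_integral (linepath ?d ?a) g = - contour_integral (linepath ?a ?d) g"
      using contour_integral_reverse_linepath[OF segs(4)] .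
    moreover have "contour_integral (linepath (Complex (- real n) y) (Complex (real n) y)) g
        = integral {- real n..real n} (\<lambda>u. g (Complex u y))" if "y = \<nu> \<or> y = - \<nu>" for y
      by (rule contour_integral_linepath_horizontal) (use n that w0 \<nu> in \<open>auto intro!: gc\<close>)
    ultimately show ?case by (simp add: V_def algebra_simps)
  qed
  ultimately have "(\<lambda>n. 2 * pi * \<i> * \<phi> (exp w0)
      - (integral {- real n..real n} (\<lambda>u. g (Complex u (-\<nu>))) - integral {- real n..real n} (\<lambda>u. g (Complex u \<nu>)))) \<longlonglongrightarrow> 0"
    by (rule Lim_transform_eventually)
  moreover have "(\<lambda>n. 2 * pi * \<i> * \<phi> (exp w0)
      - (integral {- real n..real n} (\<lambda>u. g (Complex u (-\<nu>))) - integral {- real n..real n} (\<lambda>u. g (Complex u \<nu>)))) \<longlonglongrightarrow>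
      2 * pi * \<i> * \<phi> (exp w0) - (integral UNIV (\<lambda>u. g (Complex u (-\<nu>))) - integral UNIV (\<lambda>u. g (Complex u \<nu>)))"
    by (intro tendsto_intros lim) auto
  ultimately show ?thesis using LIMSEQ_unique unfolding g_def by fastforce
qed

lemma integral_strip_shift_scalar:
  fixes F :: "complex \<Rightarrow> complex"
  assumes e: "e > 0" "a \<le> b" and F: "F holomorphic_on T" and T: "open T" "{w. Im w \<in> {a..b}} \<subseteq> T"
    and le: "\<And>w. Im w \<in> {a..b} \<Longrightarrow> norm (F w) \<le> K * exp (- e * \<bar>Re w\<bar>)"
  shows "integral UNIV (\<lambda>u. F (Complex u a)) = integral UNIV (\<lambda>u. F (Complex u b))"
proof (rule integral_strip_shift_holomorphic[OF e _ _ le])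
  show "(F has_derivative (\<lambda>h. h *\<^sub>C deriv F w)) (at w)" if "Im w \<in> {a..b}" for w
    using holomorphic_derivI[OF F T(1), of w] that T(2)
    by (auto simp: has_field_derivative_def scaleC_complex_def mult.commute[of _ "deriv F w"])
  show "continuous_on {w. Im w \<in> {a..b}} (deriv F)"
    using continuous_on_subset[OF holomorphic_on_imp_continuous_on[OF holomorphic_deriv[OF F T(1)]] T(2)] .
qed

text \<open>The condition \<open>cos (Im w) < cos \<omega>\<close> says that \<open>exp w\<close> lies outside the closed sector of angle \<open>\<omega>\<close>,
  whichever logarithm \<open>w\<close> is taken.\<close>

locale sectorial_resolvent =
  fixes A :: "'a::complex_banach \<rightharpoonup> 'a" and \<omega> M :: real
  assumes \<omega>: "0 \<le> \<omega>" and M: "0 \<le> M"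
    and linear: "linear_op A"
    and bij_shifted: "cos (Im w) < cos \<omega> \<Longrightarrow> bij_betw (shifted A (exp w)) (dom A) UNIV"
    and bounded_linear_resolvent: "cos (Im w) < cos \<omega> \<Longrightarrow> bounded_linear (resolvent A (exp w))"
    and norm_resolvent_le:
      "cos (Im w) < cos \<omega> \<Longrightarrow> norm (exp w *\<^sub>C resolvent A (exp w) x) \<le> M * norm x"
begin

section \<open>The function z R(z, A) in logarithmic coordinates\<close>

definition zR :: "complex \<Rightarrow> 'a \<Rightarrow> 'a" where
  "zR w x = exp w *\<^sub>C resolvent A (exp w) x"

text \<open>\<open>H0_calc\<close> with the angle as an argument: the factor lambda of d lambda =
  lambda du sits in \<open>zR\<close>. Unlike the fixed choice in \<open>H0_calc\<close>, this
  contour can be moved.\<close>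

definition calc :: "real \<Rightarrow> (complex \<Rightarrow> complex) \<Rightarrow> 'a \<Rightarrow> 'a" where
  "calc \<nu> \<phi> x = (1 / (2 * pi * \<i>)) *\<^sub>C
     (integral UNIV (\<lambda>u. \<phi> (exp (Complex u (- \<nu>))) *\<^sub>C zR (Complex u (- \<nu>)) x) -
      integral UNIV (\<lambda>u. \<phi> (exp (Complex u \<nu>)) *\<^sub>C zR (Complex u \<nu>) x))"

lemma cos_less_cos_\<omega>: "\<omega> < \<bar>y\<bar> \<Longrightarrow> \<bar>y\<bar> \<le> pi \<Longrightarrow> cos y < cos \<omega>"
  using cos_monotone_0_pi[of \<omega> "\<bar>y\<bar>"] \<omega> by simp

lemma dom_comb: "x \<in> dom A \<Longrightarrow> y \<in> dom A \<Longrightarrow> a *\<^sub>C x + b *\<^sub>C y \<in> dom A"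
  and op_comb: "x \<in> dom A \<Longrightarrow> y \<in> dom A \<Longrightarrow>
    the (A (a *\<^sub>C x + b *\<^sub>C y)) = a *\<^sub>C the (A x) + b *\<^sub>C the (A y)"
  using linear unfolding linear_op_def by (auto simp: dom_def)

context
  fixes w assumes w: "cos (Im w) < cos \<omega>"
begin

lemma resolvent_in_dom: "resolvent A (exp w) x \<in> dom A"
  and shifted_resolvent: "shifted A (exp w) (resolvent A (exp w) x) = x"
  and resolvent_shifted: "y \<in> dom A \<Longrightarrow> resolvent A (exp w) (shifted A (exp w) y) = y"
  using bij_shifted[OF w] unfolding resolvent_def bij_betw_def
  by (metis UNIV_I inv_into_into, metis UNIV_I f_inv_into_f, metis inv_into_f_f)

text \<open>\<open>bounded_linear\<close> is linearity over the reals only; complex homogeneity of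
  the resolvent is recovered from that of \<open>A\<close>.\<close>

lemma resolvent_scaleC: "resolvent A (exp w) (a *\<^sub>C x) = a *\<^sub>C resolvent A (exp w) x"
proof -
  have "shifted A (exp w) (a *\<^sub>C y + 0 *\<^sub>C y) = a *\<^sub>C shifted A (exp w) y" if "y \<in> dom A" for y
    using op_comb[OF that that, of a 0] that
    by (simp add: shifted_def scaleC.diff_right scaleC_scaleC mult.commute)
  from this[OF resolvent_in_dom] show ?thesis
    using resolvent_shifted[OF dom_comb[OF resolvent_in_dom resolvent_in_dom], of a x 0 x]
    by (simp add: shifted_resolvent)
qed

lemma bounded_linear_zR: "bounded_linear (zR w)"
  unfolding zR_def[abs_def]
  by (rule bounded_linear_compose[OF scaleC.bounded_linear_right bounded_linear_resolvent[OF w]])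

lemma zR_scaleC: "zR w (a *\<^sub>C x) = a *\<^sub>C zR w x"
  by (simp add: zR_def resolvent_scaleC scaleC_scaleC mult.commute)

lemma norm_zR_le: "norm (zR w x) \<le> M * norm x"
  unfolding zR_def by (rule norm_resolvent_le[OF w])

lemma op_resolvent: "the (A (resolvent A (exp w) x)) = zR w x - x"
  using shifted_resolvent[of x] by (simp add: shifted_def zR_def algebra_simps)

end

text \<open>The resolvent identity multiplied by exp v exp w, in a form free of division.\<close>

lemma zR_zR:
  assumes v: "cos (Im v) < cos \<omega>" and w: "cos (Im w) < cos \<omega>"
  shows "(exp v - exp w) *\<^sub>C zR v (zR w x) = exp v *\<^sub>C zR w x - exp w *\<^sub>C zR v x"
proof -
  interpret R: bounded_linear "resolvent A (exp v)" by (rule bounded_linear_resolvent[OF v])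
  let ?r = "resolvent A (exp w) x"
  let ?s = "resolvent A (exp v) x"
  have "shifted A (exp v) (1 *\<^sub>C ?s + (- 1) *\<^sub>C ?r) = x - (exp v *\<^sub>C ?r - the (A ?r))"
    using op_comb[OF resolvent_in_dom[OF v, of x] resolvent_in_dom[OF w, of x], of 1 "-1"] shifted_resolvent[OF v, of x]
    by (simp add: shifted_def scaleC.diff_right algebra_simps)
  also have "\<dots> = (exp w - exp v) *\<^sub>C ?r"
    by (simp add: op_resolvent[OF w] zR_def scaleC.diff_left)
  finally have "resolvent A (exp v) ((exp w - exp v) *\<^sub>C ?r) = ?s - ?r"
    using resolvent_shifted[OF v dom_comb[OF resolvent_in_dom[OF v] resolvent_in_dom[OF w]], of 1 x "-1" x] by simp
  then have "(exp w - exp v) *\<^sub>C resolvent A (exp v) ?r = ?s - ?r"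
    by (simp add: resolvent_scaleC[OF v])
  then have "(exp v * exp w) *\<^sub>C (exp w - exp v) *\<^sub>C resolvent A (exp v) ?r = (exp v * exp w) *\<^sub>C (?s - ?r)"
    by simp
  then show ?thesis
    by (simp add: zR_def resolvent_scaleC[OF v] scaleC_scaleC scaleC.diff_left scaleC.diff_right algebra_simps)
qed

text \<open>The resolvent identity rearranged so that the increment carries the small factor exp (v
  - w) - 1; the vector behind it is bounded through \<open>M\<close> even though it involves the
  moving point \<open>v\<close>.\<close>

lemma zR_diff:
  assumes v: "cos (Im v) < cos \<omega>" and w: "cos (Im w) < cos \<omega>"
  shows "zR v x - zR w x = (exp (v - w) - 1) *\<^sub>C (zR w x - zR v (zR w x))"
proof -
  have "exp (- w) *\<^sub>C (exp v - exp w) *\<^sub>C zR v (zR w x) = exp (- w) *\<^sub>C (exp v *\<^sub>C zR w x - exp w *\<^sub>C zR v x)"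
    by (simp add: zR_zR[OF v w])
  then have "(exp (v - w) - 1) *\<^sub>C zR v (zR w x) = exp (v - w) *\<^sub>C zR w x - zR v x"
    by (simp add: scaleC_scaleC scaleC.diff_right right_diff_distrib exp_diff exp_minus field_simps)
  then show ?thesis by (simp add: scaleC.diff_left scaleC.diff_right)
qed

lemma open_resolvent_region: "open {w. cos (Im w) < cos \<omega>}"
  by (intro open_Collect_less continuous_intros)

lemma eventually_resolvent_region:
  assumes "cos (Im w) < cos \<omega>" shows "\<forall>\<^sub>F v in at w. cos (Im v) < cos \<omega>"
  using eventually_at_in_open'[OF open_resolvent_region, of w] assms by simp

lemma isCont_zR:
  assumes w: "cos (Im w) < cos \<omega>" shows "isCont (\<lambda>v. zR v x) w"
proof -
  have "((\<lambda>v. zR v x - zR w x) \<longlongrightarrow> 0) (at w)"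
  proof (rule Lim_null_comparison)
    show "\<forall>\<^sub>F v in at w. norm (zR v x - zR w x) \<le> cmod (exp (v - w) - 1) * (norm (zR w x) + M * norm (zR w x))"
      using eventually_resolvent_region[OF w]
    proof eventually_elim
      case (elim v)
      show ?case unfolding zR_diff[OF elim w] norm_scaleC
        by (intro mult_left_mono norm_triangle_le_diff add_left_mono norm_zR_le elim) auto
    qed
    have "((\<lambda>v. cmod (exp (v - w) - 1) * (norm (zR w x) + M * norm (zR w x))) \<longlongrightarrow>
        cmod (exp (w - w) - 1) * (norm (zR w x) + M * norm (zR w x))) (at w)"
      by (intro tendsto_intros)
    then show "((\<lambda>v. cmod (exp (v - w) - 1) * (norm (zR w x) + M * norm (zR w x))) \<longlongrightarrow> 0) (at w)"
      by simp
  qed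
  then show ?thesis unfolding isCont_def by (rule LIM_zero_cancel)
qed

text \<open>Strong continuity together with the uniform bound \<open>M\<close> gives joint
  continuity. The derivative of \<open>zR\<close> contains \<open>zR w (zR w x)\<close>, where point
  and argument move together.\<close>

lemma isCont_zR_compose:
  assumes w: "cos (Im w) < cos \<omega>" and g: "isCont g w"
  shows "isCont (\<lambda>v. zR v (g v)) w"
proof -
  have "((\<lambda>v. zR v (g v - g w)) \<longlongrightarrow> 0) (at w)"
  proof (rule Lim_null_comparison)
    show "\<forall>\<^sub>F v in at w. norm (zR v (g v - g w)) \<le> M * norm (g v - g w)"
      using eventually_resolvent_region[OF w] by eventually_elim (rule norm_zR_le)
    have "((\<lambda>v. M * norm (g v - g w)) \<longlongrightarrow> M * norm (g w - g w)) (at w)"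
      using g unfolding isCont_def by (intro tendsto_intros)
    then show "((\<lambda>v. M * norm (g v - g w)) \<longlongrightarrow> 0) (at w)" by simp
  qed
  then have "((\<lambda>v. zR v (g v - g w) + zR v (g w)) \<longlongrightarrow> 0 + zR w (g w)) (at w)"
    using isCont_zR[OF w, of "g w"] unfolding isCont_def by (intro tendsto_add)
  moreover have "\<forall>\<^sub>F v in at w. zR v (g v - g w) + zR v (g w) = zR v (g v)"
    using eventually_resolvent_region[OF w]
  proof eventually_elim
    case (elim v)
    interpret bounded_linear "zR v" by (rule bounded_linear_zR[OF elim])
    show ?case by (simp add: diff)
  qed
  ultimately show ?thesis unfolding isCont_def by (simp add: tendsto_cong)
qed

lemma continuous_on_zR:
  "S \<subseteq> {w. cos (Im w) < cos \<omega>} \<Longrightarrow> continuous_on S (\<lambda>w. zR w x)"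
  by (intro continuous_at_imp_continuous_on ballI isCont_zR) auto

text \<open>In \<open>zR_diff\<close> the factor exp (v - w) - 1 is (v - w) times a function
  continuous at w with value 1, so Caratheodory's criterion applies. The result is the rule z (d/dz)
  (z R) = z R - (z R)^2.\<close>

lemma has_derivative_zR:
  assumes w: "cos (Im w) < cos \<omega>"
  shows "((\<lambda>v. zR v x) has_derivative (\<lambda>h. h *\<^sub>C (zR w x - zR w (zR w x)))) (at w)"
proof -
  have "((\<lambda>v. exp (v - w)) has_field_derivative 1) (at w)"
    by (auto intro!: derivative_eq_intros)
  then obtain g where g: "\<And>v. exp (v - w) - 1 = g v * (v - w)" "isCont g w" "g w = 1"
    unfolding CARAT_DERIV by auto
  have "((\<lambda>v. zR v x) has_derivative (\<lambda>h. h *\<^sub>C (g w *\<^sub>C (zR w x - zR w (zR w x))))) (at w)"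
  proof (rule has_derivative_scaleC_caratheodory[where G="\<lambda>v. g v *\<^sub>C (zR w x - zR v (zR w x))", OF open_resolvent_region])
    show "isCont (\<lambda>v. g v *\<^sub>C (zR w x - zR v (zR w x))) w"
      by (intro scaleC.isCont g(2) continuous_intros isCont_zR w)
    show "zR v x - zR w x = (v - w) *\<^sub>C g v *\<^sub>C (zR w x - zR v (zR w x))"
      if "v \<in> {w. cos (Im w) < cos \<omega>}" for v
      using that by (simp add: zR_diff[OF _ w] g(1) scaleC_scaleC mult.commute)
  qed (use w in simp)
  then show ?thesis by (simp add: g(3))
qed

text \<open>The counterterm \<open>f w *\<^sub>C y\<close> serves \<open>calc_rho\<close>, where
  \<open>zR\<close> decays only after subtraction of a scalar function times a vector. The scalar
  function may have poles of its own, hence the second domain \<open>T'\<close>.\<close>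

lemma strip_shift_zR:
  assumes "e > 0" "a \<le> b" and \<Phi>: "\<Phi> holomorphic_on T" and T: "open T" "{w. Im w \<in> {a..b}} \<subseteq> T"
    and reg: "\<And>y. y \<in> {a..b} \<Longrightarrow> cos y < cos \<omega>"
    and f: "f holomorphic_on T'" and T': "open T'" "{w. Im w \<in> {a..b}} \<subseteq> T'"
    and le: "\<And>w. Im w \<in> {a..b} \<Longrightarrow> norm (\<Phi> w *\<^sub>C zR w x - f w *\<^sub>C y) \<le> K * exp (- e * \<bar>Re w\<bar>)"
  shows "integral UNIV (\<lambda>u. \<Phi> (Complex u a) *\<^sub>C zR (Complex u a) x - f (Complex u a) *\<^sub>C y) =
    integral UNIV (\<lambda>u. \<Phi> (Complex u b) *\<^sub>C zR (Complex u b) x - f (Complex u b) *\<^sub>C y)"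
proof (rule integral_strip_shift_holomorphic[OF assms(1,2) _ _ le])
  let ?D = "\<lambda>w. \<Phi> w *\<^sub>C (zR w x - zR w (zR w x)) + deriv \<Phi> w *\<^sub>C zR w x - deriv f w *\<^sub>C y"
  have sC: "(\<psi> has_derivative (\<lambda>h. h *\<^sub>C deriv \<psi> w)) (at w)"
    if "\<psi> holomorphic_on S" "open S" "w \<in> S" for \<psi> S w
    using holomorphic_derivI[OF that]
    by (simp add: has_field_derivative_def scaleC_complex_def mult.commute[of _ "deriv \<psi> w"])
  show "((\<lambda>w. \<Phi> w *\<^sub>C zR w x - f w *\<^sub>C y) has_derivative (\<lambda>h. h *\<^sub>C ?D w)) (at w)" if "Im w \<in> {a..b}" for w
  proof -
    have w: "w \<in> T" "w \<in> T'" "cos (Im w) < cos \<omega>" using that T(2) T'(2) reg by auto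
    have "((\<lambda>w. \<Phi> w *\<^sub>C zR w x - f w *\<^sub>C y) has_derivative
        (\<lambda>h. (\<Phi> w *\<^sub>C h *\<^sub>C (zR w x - zR w (zR w x)) + (h *\<^sub>C deriv \<Phi> w) *\<^sub>C zR w x)
           - (h *\<^sub>C deriv f w) *\<^sub>C y)) (at w)"
      by (intro has_derivative_diff scaleC.FDERIV sC[OF \<Phi> T(1)] sC[OF f T'(1)] has_derivative_zR w
          bounded_linear.has_derivative[OF scaleC.bounded_linear_left])
    then show ?thesis
      by (rule has_derivative_eq_rhs)
         (simp add: fun_eq_iff scaleC_add_right scaleC.diff_right scaleC_scaleC scaleC_complex_def mult.commute)
  qed
  have "isCont ?D w" if "Im w \<in> {a..b}" for w
  proof -
    have w: "w \<in> T" "w \<in> T'" "cos (Im w) < cos \<omega>" using that T(2) T'(2) reg by auto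
    have c: "isCont \<psi> w" if "\<psi> holomorphic_on S" "open S" "w \<in> S" for \<psi> S
      using that holomorphic_on_imp_continuous_on continuous_on_eq_continuous_at by blast
    show ?thesis
      by (intro continuous_intros scaleC.isCont isCont_zR_compose isCont_zR w c[OF \<Phi> T(1)]
          c[OF holomorphic_deriv[OF \<Phi> T(1)] T(1)] c[OF holomorphic_deriv[OF f T'(1)] T'(1)])
  qed
  then show "continuous_on {w. Im w \<in> {a..b}} ?D"
    by (intro continuous_at_imp_continuous_on) blast
qed

section \<open>The functional calculus\<close>

text \<open>All that \<open>calc \<nu>\<close> sees of its symbol. It also covers symbols that are
  not known to decay on a full sector, such as a product with a Cauchy kernel whose pole lies beyond
  the contour.\<close>

definition line_decays :: "real \<Rightarrow> real \<Rightarrow> real \<Rightarrow> real \<Rightarrow> (complex \<Rightarrow> complex) \<Rightarrow> bool" where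
  "line_decays \<nu> e K a \<phi> \<longleftrightarrow> (\<forall>y\<in>{\<nu>, -\<nu>}. continuous_on UNIV (\<lambda>u. \<phi> (exp (Complex u y))) \<and>
     (\<forall>u. cmod (\<phi> (exp (Complex u y))) \<le> K * exp (- e * \<bar>u + a\<bar>)))"

lemma continuous_on_Complex_left [continuous_intros]:
  "continuous_on S f \<Longrightarrow> continuous_on S (\<lambda>x. Complex (f x) y)" for f :: "'b::topological_space \<Rightarrow> real"
  by (simp add: Complex_eq continuous_intros)

lemma decays_imp_line_decays:
  assumes "decays \<tau> e K a \<phi>" "0 < \<nu>" "\<nu> < \<tau>" "\<tau> \<le> pi"
  shows "line_decays \<nu> e K a \<phi>"
  unfolding line_decays_def
proof (intro ballI conjI allI)
  fix y assume y: "y \<in> {\<nu>, - \<nu>}"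
  show "continuous_on UNIV (\<lambda>u. \<phi> (exp (Complex u y)))"
    by (rule continuous_on_compose2[OF holomorphic_on_imp_continuous_on[OF decays_exp[OF assms(1)]]])
       (use assms y in \<open>auto intro!: continuous_intros\<close>)
  show "cmod (\<phi> (exp (Complex u y))) \<le> K * exp (- e * \<bar>u + a\<bar>)" for u
    using decaysD(2)[OF assms(1), of "Complex u y"] assms y by auto
qed

context
  fixes \<nu> :: real assumes \<nu>: "\<omega> < \<nu>" "\<nu> \<le> pi"
begin

lemma \<nu>_region: "y \<in> {\<nu>, -\<nu>} \<Longrightarrow> cos y < cos \<omega>"
  using \<nu> \<omega> by (intro cos_less_cos_\<omega>) auto

lemma calc_integrand:
  assumes "line_decays \<nu> e K a \<phi>" "y \<in> {\<nu>, -\<nu>}"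
  shows "continuous_on UNIV (\<lambda>u. \<phi> (exp (Complex u y)) *\<^sub>C zR (Complex u y) x)"
    and "norm (\<phi> (exp (Complex u y)) *\<^sub>C zR (Complex u y) x) \<le> K * (M * norm x) * exp (- e * \<bar>u + a\<bar>)"
proof -
  have "continuous_on UNIV (\<lambda>u. zR (Complex u y) x)"
    by (rule continuous_on_compose2[OF continuous_on_zR[OF order_refl]])
       (use \<nu>_region[OF assms(2)] in \<open>auto intro!: continuous_intros\<close>)
  then show "continuous_on UNIV (\<lambda>u. \<phi> (exp (Complex u y)) *\<^sub>C zR (Complex u y) x)"
    using assms by (auto simp: line_decays_def intro!: continuous_intros)
  have 1: "cmod (\<phi> (exp (Complex u y))) \<le> K * exp (- e * \<bar>u + a\<bar>)" using assms by (auto simp: line_decays_def)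
  have 2: "norm (zR (Complex u y) x) \<le> M * norm x"
    by (rule norm_zR_le) (use \<nu>_region[OF assms(2)] in simp)
  have "norm (\<phi> (exp (Complex u y)) *\<^sub>C zR (Complex u y) x) \<le> (K * exp (- e * \<bar>u + a\<bar>)) * (M * norm x)"
    unfolding norm_scaleC by (rule mult_mono[OF 1 2]) (use order_trans[OF norm_ge_zero 1] in auto)
  then show "norm (\<phi> (exp (Complex u y)) *\<^sub>C zR (Complex u y) x) \<le> K * (M * norm x) * exp (- e * \<bar>u + a\<bar>)"
    by (simp add: mult_ac)
qed

lemma calc_integrable:
  assumes "line_decays \<nu> e K a \<phi>" "e > 0" "y \<in> {\<nu>, -\<nu>}"
  shows "(\<lambda>u. \<phi> (exp (Complex u y)) *\<^sub>C zR (Complex u y) x) integrable_on UNIV"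
  by (rule exp_decay_integrable[OF calc_integrand(1)[OF assms(1,3)] assms(2) calc_integrand(2)[OF assms(1,3)]])

text \<open>Each of the two lines contributes 2 K M / e, against the factor 1 / (2 pi). The centre
  \<open>a\<close> is absent from the bound, so all dilates of a symbol share it.\<close>

lemma norm_calc_le:
  assumes "line_decays \<nu> e K a \<phi>" "e > 0"
  shows "norm (calc \<nu> \<phi> x) \<le> 2 * K * M / (pi * e) * norm x"
proof -
  have I: "norm (integral UNIV (\<lambda>u. \<phi> (exp (Complex u y)) *\<^sub>C zR (Complex u y) x)) \<le> 2 * (K * (M * norm x)) / e"
    if "y \<in> {\<nu>, -\<nu>}" for y
    by (rule exp_decay_norm_integral_le[OF calc_integrand(1)[OF assms(1) that] assms(2) calc_integrand(2)[OF assms(1) that]])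
  have "norm (calc \<nu> \<phi> x) \<le> 1 / (2 * pi) * (2 * (K * (M * norm x)) / e + 2 * (K * (M * norm x)) / e)"
    unfolding calc_def norm_scaleC
    by (intro mult_mono order_trans[OF norm_triangle_ineq4] add_mono I) (auto simp: norm_divide norm_mult)
  also have "\<dots> = 2 * K * M / (pi * e) * norm x" using assms(2) by (simp add: field_simps)
  finally show ?thesis .
qed

lemma calc_add:
  assumes "line_decays \<nu> e K a \<phi>" "e > 0" "line_decays \<nu> e' K' a' \<psi>" "e' > 0"
  shows "calc \<nu> (\<lambda>z. \<phi> z + \<psi> z) x = calc \<nu> \<phi> x + calc \<nu> \<psi> x"
  unfolding calc_def scaleC_add_left
  by (simp add: integral_add calc_integrable[OF assms(1,2)] calc_integrable[OF assms(3,4)] scaleC_add_right scaleC.diff_right)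

lemma calc_cmult:
  assumes "line_decays \<nu> e K a \<phi>" "e > 0"
  shows "calc \<nu> (\<lambda>z. c * \<phi> z) x = c *\<^sub>C calc \<nu> \<phi> x"
proof -
  have "integral UNIV (\<lambda>u. (c * \<phi> (exp (Complex u y))) *\<^sub>C zR (Complex u y) x)
      = c *\<^sub>C integral UNIV (\<lambda>u. \<phi> (exp (Complex u y)) *\<^sub>C zR (Complex u y) x)" if "y \<in> {\<nu>, -\<nu>}" for y
    using integral_linear[OF calc_integrable[OF assms that] scaleC.bounded_linear_right[of c]]
    by (simp add: o_def scaleC_scaleC)
  then show ?thesis
    unfolding calc_def by (simp add: scaleC.diff_right[symmetric] scaleC_scaleC mult.commute)
qed

end

section \<open>Independence of the angle and multiplicativity\<close>

lemma calc_angle_independent: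
  assumes \<phi>: "decays \<tau> e K a \<phi>" and e: "e > 0" and \<tau>: "\<tau> \<le> pi"
    and \<nu>: "\<omega> < \<nu>" "\<nu> < \<tau>" and \<nu>': "\<omega> < \<nu>'" "\<nu>' < \<tau>"
  shows "calc \<nu> \<phi> x = calc \<nu>' \<phi> x"
proof -
  have \<tau>0: "0 < \<tau>" using \<nu> \<omega> by linarith
  note \<phi>0 = decays_shift[OF \<phi> \<tau>0, of 0]
  \<comment> \<open>The strips between the two upper lines and between the two lower lines avoid the
    closed sector of angle omega; there \<open>zR\<close> is bounded and the integrand inherits the
    decay of the symbol.\<close>
  have shift: "integral UNIV (\<lambda>u. \<phi> (exp (Complex u y)) *\<^sub>C zR (Complex u y) x) =
    integral UNIV (\<lambda>u. \<phi> (exp (Complex u y')) *\<^sub>C zR (Complex u y') x)"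
    if "y \<le> y'" and yy: "\<And>t. t \<in> {y..y'} \<Longrightarrow> \<omega> < \<bar>t\<bar> \<and> \<bar>t\<bar> < \<tau>" for y y'
  proof -
    have "integral UNIV (\<lambda>u. \<phi> (exp (Complex u y)) *\<^sub>C zR (Complex u y) x - 0 *\<^sub>C x) =
      integral UNIV (\<lambda>u. \<phi> (exp (Complex u y')) *\<^sub>C zR (Complex u y') x - 0 *\<^sub>C x)"
    proof (rule strip_shift_zR[OF e \<open>y \<le> y'\<close> decays_exp[OF \<phi> \<tau>0 \<tau>] open_strip, where T'=UNIV])
      show "norm (\<phi> (exp w) *\<^sub>C zR w x - 0 *\<^sub>C x) \<le> K * exp (e * \<bar>a - 0\<bar>) * (M * norm x) * exp (- e * \<bar>Re w\<bar>)"
        if "Im w \<in> {y..y'}" for w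
      proof -
        have 1: "cmod (\<phi> (exp w)) \<le> K * exp (e * \<bar>a - 0\<bar>) * exp (- e * \<bar>Re w + 0\<bar>)"
          using decaysD(2)[OF \<phi>0] yy[OF that] e by simp
        have 2: "norm (zR w x) \<le> M * norm x"
          using norm_zR_le[OF cos_less_cos_\<omega>] yy[OF that] \<tau> by simp
        have "cmod (\<phi> (exp w)) * norm (zR w x) \<le> (K * exp (e * \<bar>a - 0\<bar>) * exp (- e * \<bar>Re w + 0\<bar>)) * (M * norm x)"
          by (rule mult_mono[OF 1 2]) (use order_trans[OF norm_ge_zero 1] in auto)
        then show ?thesis by (simp add: norm_scaleC mult_ac)
      qed
      show "cos t < cos \<omega>" if "t \<in> {y..y'}" for t
        using yy[OF that] \<tau> by (intro cos_less_cos_\<omega>) auto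
    qed (use yy in auto)
    then show ?thesis by simp
  qed
  have "calc \<nu> \<phi> x = calc \<nu>' \<phi> x" if "\<nu> \<le> \<nu>'" "\<omega> < \<nu>" "\<nu>' < \<tau>" for \<nu> \<nu>'
    \<comment> \<open>Shifts go upwards: the upper line moves from \<open>\<nu>\<close> to
      \<open>\<nu>'\<close>, the lower one is compared from \<open>- \<nu>'\<close> to
      \<open>- \<nu>\<close>.\<close>
    unfolding calc_def using that \<omega> by (subst shift[of \<nu> \<nu>'], simp, force, subst shift[of "-\<nu>'" "-\<nu>"], simp, force, simp)
  then show ?thesis using \<nu> \<nu>' by (cases "\<nu> \<le> \<nu>'") (auto intro: sym)
qed

end

lemma decays_weaken:
  assumes "decays \<tau> e K a \<phi>" "0 < \<tau>" "e' \<le> e" "\<tau>' \<le> \<tau>" "0 < \<tau>'"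
  shows "decays \<tau>' e' K a \<phi>"
  unfolding decays_def
proof (intro conjI allI impI)
  show "\<phi> holomorphic_on sector \<tau>'"
    using decaysD(1)[OF assms(1)] sector_mono[OF assms(5,4)] by (rule holomorphic_on_subset)
  fix w assume "\<bar>Im w\<bar> < \<tau>'"
  then have "cmod (\<phi> (exp w)) \<le> K * exp (- e * \<bar>Re w + a\<bar>)"
    using assms(4) by (intro decaysD(2)[OF assms(1)]) auto
  also have "\<dots> \<le> K * exp (- e' * \<bar>Re w + a\<bar>)"
    using assms(3) by (intro mult_left_mono decays_nonneg[OF assms(1,2)]) (auto intro: mult_right_mono)
  finally show "cmod (\<phi> (exp w)) \<le> K * exp (- e' * \<bar>Re w + a\<bar>)" .
qed

context sectorial_resolvent
begin

text \<open>Under the integral the resolvent identity splits the integrand into the symbol with a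
  Cauchy kernel and a scalar function times \<open>zR v x\<close>. As \<open>v\<close> lies outside
  the contour, the scalar function is holomorphic between the lines and its two integrals cancel.
  The case |Im v| = pi, the negative half-line, is included for the factors 1 / (1 + r z).\<close>

lemma calc_resolvent:
  assumes \<phi>: "decays \<tau> e K 0 \<phi>" and e: "e > 0" and \<tau>: "\<tau> \<le> pi"
    and \<nu>: "\<omega> < \<nu>" "\<nu> < \<tau>" and v: "\<nu> < \<bar>Im v\<bar>" "\<bar>Im v\<bar> \<le> pi"
  shows "zR v (calc \<nu> \<phi> x) = calc \<nu> (\<lambda>z. \<phi> z * (exp v / (exp v - z))) x"
proof -
  have \<nu>0: "0 < \<nu>" "\<nu> \<le> pi" and \<tau>0: "0 < \<tau>" using \<nu> \<omega> \<tau> by auto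
  note K = decays_nonneg[OF \<phi> \<tau>0]
  have vr: "cos (Im v) < cos \<omega>" using v \<nu> by (intro cos_less_cos_\<omega>) auto
  interpret L: bounded_linear "zR v" by (rule bounded_linear_zR[OF vr])
  define \<delta> where "\<delta> = \<bar>Im v\<bar> - \<nu>"
  have \<delta>: "0 < \<delta>" "\<delta> \<le> pi" using v \<nu>0 by (auto simp: \<delta>_def)
  have s: "sin (\<delta> / 2) > 0" using \<delta> by (intro sin_gt_zero) auto
  have gap: "\<delta> \<le> \<bar>Im w - Im v\<bar> \<and> \<bar>Im w - Im v\<bar> \<le> 2 * pi - \<delta>" if "\<bar>Im w\<bar> \<le> \<nu>" for w
    using that v by (auto simp: \<delta>_def)
  have ne: "exp w \<noteq> exp v" if "\<bar>Im w\<bar> \<le> \<nu>" for w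
    using exp_quotient_le(1)[OF \<delta>] gap[OF that] by blast
  have neC: "exp v \<noteq> exp (Complex u y)" if "y \<in> {\<nu>, - \<nu>}" for u y
    using ne[of "Complex u y"] that \<nu>0 by auto
  have qv: "cmod (exp v / (exp v - exp w)) \<le> 1 / sin (\<delta> / 2)" if "\<bar>Im w\<bar> \<le> \<nu>" for w
    using exp_quotient_le(2)[OF \<delta>, of v w] gap[OF that] by (simp add: abs_minus_commute)
  have qw: "cmod (exp w / (exp v - exp w)) \<le> 1 / sin (\<delta> / 2)" if "\<bar>Im w\<bar> \<le> \<nu>" for w
    using exp_quotient_le(2)[OF \<delta>, of w v] gap[OF that] by (simp add: norm_divide norm_minus_commute)
  let ?h = "\<lambda>z. \<phi> z * (exp v / (exp v - z))"
  let ?g = "\<lambda>w. \<phi> (exp w) * (exp w / (exp v - exp w))"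
  have ld: "line_decays \<nu> e K 0 \<phi>" by (rule decays_imp_line_decays[OF \<phi> \<nu>0(1) \<nu>(2) \<tau>])
  have bound: "cmod (\<phi> (exp w) * q) \<le> K / sin (\<delta> / 2) * exp (- e * \<bar>Re w\<bar>)"
    if "\<bar>Im w\<bar> \<le> \<nu>" "cmod q \<le> 1 / sin (\<delta> / 2)" for w q
  proof -
    have "cmod (\<phi> (exp w)) * cmod q \<le> (K * exp (- e * \<bar>Re w + 0\<bar>)) * (1 / sin (\<delta> / 2))"
      using that \<nu> K by (intro mult_mono decaysD(2)[OF \<phi>]) auto
    then show ?thesis by (simp add: norm_mult)
  qed
  have ldh: "line_decays \<nu> e (K / sin (\<delta> / 2)) 0 ?h"
    unfolding line_decays_def
  proof (intro ballI conjI allI)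
    fix y assume y: "y \<in> {\<nu>, - \<nu>}"
    show "continuous_on UNIV (\<lambda>u. ?h (exp (Complex u y)))"
      using neC[OF y] bspec[OF ld[unfolded line_decays_def] y] by (intro continuous_intros) auto
    show "cmod (?h (exp (Complex u y))) \<le> K / sin (\<delta> / 2) * exp (- e * \<bar>u + 0\<bar>)" for u
      using bound[of "Complex u y", OF _ qv[of "Complex u y"]] y \<nu>0 by auto
  qed
  have g_int: "(\<lambda>u. ?g (Complex u y)) integrable_on UNIV" if y: "y \<in> {\<nu>, - \<nu>}" for y
  proof (rule exp_decay_integrable[OF _ e])
    show "continuous_on UNIV (\<lambda>u. ?g (Complex u y))"
      using neC[OF y] bspec[OF ld[unfolded line_decays_def] y] by (intro continuous_intros) auto
    show "norm (?g (Complex u y)) \<le> K / sin (\<delta> / 2) * exp (- e * \<bar>u + 0\<bar>)" for u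
      using bound[of "Complex u y", OF _ qw[of "Complex u y"]] y \<nu>0 by auto
  qed
  have g_shift: "integral UNIV (\<lambda>u. ?g (Complex u (-\<nu>))) = integral UNIV (\<lambda>u. ?g (Complex u \<nu>))"
  proof (rule integral_strip_shift_scalar[OF e])
    let ?T = "{w. \<bar>Im w\<bar> < \<tau>} \<inter> {w. exp v - exp w \<noteq> 0}"
    show "?g holomorphic_on ?T"
      by (intro holomorphic_intros holomorphic_on_subset[OF decays_exp[OF \<phi> \<tau>0 \<tau>]]) auto
    show "open ?T" by (intro open_Int open_strip open_Collect_neq continuous_intros)
    show "{w. Im w \<in> {- \<nu>..\<nu>}} \<subseteq> ?T"
    proof safe
      fix w assume "Im w \<in> {- \<nu>..\<nu>}"
      then have w: "\<bar>Im w\<bar> \<le> \<nu>" by auto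
      then show "\<bar>Im w\<bar> < \<tau>" using \<nu> by linarith
      assume "exp v - exp w = 0" then show False using ne[OF w] by simp
    qed
    show "norm (?g w) \<le> K / sin (\<delta> / 2) * exp (- e * \<bar>Re w\<bar>)" if "Im w \<in> {- \<nu>..\<nu>}" for w
    proof -
      have w: "\<bar>Im w\<bar> \<le> \<nu>" using that by auto
      show ?thesis by (rule bound[OF w qw[OF w]])
    qed
  qed (use \<nu>0 in auto)
  have main: "zR v (integral UNIV (\<lambda>u. \<phi> (exp (Complex u y)) *\<^sub>C zR (Complex u y) x)) =
      integral UNIV (\<lambda>u. ?h (exp (Complex u y)) *\<^sub>C zR (Complex u y) x) -
      integral UNIV (\<lambda>u. ?g (Complex u y)) *\<^sub>C zR v x" if y: "y \<in> {\<nu>, - \<nu>}" for y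
  proof -
    have "zR v (integral UNIV (\<lambda>u. \<phi> (exp (Complex u y)) *\<^sub>C zR (Complex u y) x)) =
      integral UNIV (\<lambda>u. zR v (\<phi> (exp (Complex u y)) *\<^sub>C zR (Complex u y) x))"
      using integral_linear[OF calc_integrable[OF \<nu>(1) \<nu>0(2) ld e y] L.bounded_linear_axioms] by (simp add: o_def)
    also have "\<dots> = integral UNIV (\<lambda>u. ?h (exp (Complex u y)) *\<^sub>C zR (Complex u y) x - ?g (Complex u y) *\<^sub>C zR v x)"
    proof (rule integral_cong)
      fix u
      let ?w = "Complex u y"
      have w: "\<bar>Im ?w\<bar> \<le> \<nu>" and wr: "cos (Im ?w) < cos \<omega>"
        using y \<nu>0 \<nu>_region[OF \<nu>(1) \<nu>0(2) y] by auto
      have d: "exp v - exp ?w \<noteq> 0" using ne[OF w] by simp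
      have "(1 / (exp v - exp ?w)) *\<^sub>C (exp v - exp ?w) *\<^sub>C zR v (zR ?w x)
          = (1 / (exp v - exp ?w)) *\<^sub>C (exp v *\<^sub>C zR ?w x - exp ?w *\<^sub>C zR v x)"
        by (simp add: zR_zR[OF vr wr])
      then have "zR v (zR ?w x) = (exp v / (exp v - exp ?w)) *\<^sub>C zR ?w x - (exp ?w / (exp v - exp ?w)) *\<^sub>C zR v x"
        using d by (simp add: scaleC_scaleC scaleC.diff_right)
      then show "zR v (\<phi> (exp ?w) *\<^sub>C zR ?w x) = ?h (exp ?w) *\<^sub>C zR ?w x - ?g ?w *\<^sub>C zR v x"
        by (simp add: zR_scaleC[OF vr] scaleC.diff_right scaleC_scaleC)
    qed
    also have "\<dots> = integral UNIV (\<lambda>u. ?h (exp (Complex u y)) *\<^sub>C zR (Complex u y) x) -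
       integral UNIV (\<lambda>u. ?g (Complex u y) *\<^sub>C zR v x)"
      by (intro integral_diff calc_integrable[OF \<nu>(1) \<nu>0(2) ldh e y]
          integrable_linear[OF g_int[OF y] scaleC.bounded_linear_left, unfolded o_def])
    also have "integral UNIV (\<lambda>u. ?g (Complex u y) *\<^sub>C zR v x) = integral UNIV (\<lambda>u. ?g (Complex u y)) *\<^sub>C zR v x"
      using integral_linear[OF g_int[OF y] scaleC.bounded_linear_left[of "zR v x"]] by (simp add: o_def)
    finally show ?thesis .
  qed
  show ?thesis
    unfolding calc_def by (simp add: zR_scaleC[OF vr] L.diff main g_shift del: times_divide_eq_right times_divide_eq_left)
qed

text \<open>Nested contours: points of the outer one lie outside the inner sector, so
  \<open>calc_resolvent\<close> inserts a kernel there; points of the inner one lie inside the outer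
  sector, so after the swap the Cauchy formula turns the kernel into psi.\<close>

lemma calc_mult:
  assumes \<phi>: "decays \<tau> e K 0 \<phi>" and \<psi>: "decays \<tau> e K' 0 \<psi>" and e: "e > 0" and \<tau>: "\<tau> \<le> pi"
    and \<nu>: "\<omega> < \<nu>" "\<nu> < \<nu>'" "\<nu>' < \<tau>"
  shows "calc \<nu>' \<psi> (calc \<nu> \<phi> x) = calc \<nu> (\<lambda>z. \<psi> z * \<phi> z) x"
proof -
  have \<nu>0: "0 < \<nu>" "\<nu> \<le> pi" "0 < \<nu>'" "\<nu>' \<le> pi" "\<omega> < \<nu>'" "\<nu> < \<tau>" and \<tau>0: "0 < \<tau>" using \<nu> \<omega> \<tau> by auto
  note K = decays_nonneg[OF \<phi> \<tau>0] and K' = decays_nonneg[OF \<psi> \<tau>0]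
  define \<delta> where "\<delta> = \<nu>' - \<nu>"
  have \<delta>: "0 < \<delta>" "\<delta> \<le> pi" using \<nu> \<nu>0 by (auto simp: \<delta>_def)
  have s: "sin (\<delta> / 2) > 0" using \<delta> by (intro sin_gt_zero) auto
  have ld: "line_decays \<nu> e K 0 \<phi>" by (rule decays_imp_line_decays[OF \<phi> \<nu>0(1,6) \<tau>])
  have ld': "line_decays \<nu>' e K' 0 \<psi>" by (rule decays_imp_line_decays[OF \<psi> \<nu>0(3) \<nu>(3) \<tau>])
  define k where "k v w = \<psi> (exp v) * (exp v / (exp v - exp w))" for v w
  define q where "q w = \<phi> (exp w) *\<^sub>C zR w x" for w
  have gap: "exp v \<noteq> exp w" "cmod (exp v / (exp v - exp w)) \<le> 1 / sin (\<delta> / 2)"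
    if "Im v \<in> {\<nu>', - \<nu>'}" "Im w \<in> {\<nu>, - \<nu>}" for v w
    using that \<nu>0 \<nu> \<tau> exp_quotient_le[OF \<delta>, of v w] by (auto simp: \<delta>_def)
  have k_le: "cmod (k v w) \<le> K' / sin (\<delta> / 2) * exp (- e * \<bar>Re v\<bar>)"
    if "Im v \<in> {\<nu>', - \<nu>'}" "Im w \<in> {\<nu>, - \<nu>}" for v w
  proof -
    have "cmod (\<psi> (exp v)) * cmod (exp v / (exp v - exp w)) \<le> (K' * exp (- e * \<bar>Re v + 0\<bar>)) * (1 / sin (\<delta> / 2))"
      using that \<nu> \<nu>0 K' gap(2)[OF that] by (intro mult_mono decaysD(2)[OF \<psi>]) auto
    then show ?thesis by (simp add: k_def norm_mult norm_divide)
  qed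
  have q_le: "norm (q (Complex u y)) \<le> K * (M * norm x) * exp (- e * \<bar>u\<bar>)" if "y \<in> {\<nu>, - \<nu>}" for u y
    using calc_integrand(2)[OF \<nu>(1) \<nu>0(2) ld that] by (simp add: q_def)
  have q_cont: "continuous_on UNIV (\<lambda>u. q (Complex u y))" if "y \<in> {\<nu>, - \<nu>}" for y
    using calc_integrand(1)[OF \<nu>(1) \<nu>0(2) ld that] by (simp add: q_def)
  define F where "F y' y v u = k (Complex v y') (Complex u y) *\<^sub>C q (Complex u y)" for y' y v u
  define B where "B = K' / sin (\<delta> / 2) * (K * (M * norm x))"
  have F_cont: "continuous_on UNIV (\<lambda>p. F y' y (fst p) (snd p))"
    if "y' \<in> {\<nu>', - \<nu>'}" "y \<in> {\<nu>, - \<nu>}" for y y'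
  proof -
    have "continuous_on UNIV (\<lambda>u. \<psi> (exp (Complex u y')))"
      using bspec[OF ld'[unfolded line_decays_def] that(1)] by simp
    then have "continuous_on UNIV (\<lambda>p :: real \<times> real. \<psi> (exp (Complex (fst p) y')))"
      by (rule continuous_on_compose2) (auto intro!: continuous_intros)
    moreover have "continuous_on UNIV (\<lambda>p :: real \<times> real. q (Complex (snd p) y))"
      by (rule continuous_on_compose2[OF q_cont[OF that(2)]]) (auto intro!: continuous_intros)
    ultimately show ?thesis
      unfolding F_def k_def using gap(1) that by (intro continuous_intros) auto
  qed
  have F_le: "norm (F y' y v u) \<le> B * (exp (- e * \<bar>v\<bar>) * exp (- e * \<bar>u\<bar>))"
    if y: "y' \<in> {\<nu>', - \<nu>'}" "y \<in> {\<nu>, - \<nu>}" for y y' u v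
  proof -
    have k: "cmod (k (Complex v y') (Complex u y)) \<le> K' / sin (\<delta> / 2) * exp (- e * \<bar>v\<bar>)"
      using k_le[of "Complex v y'" "Complex u y"] y by simp
    have "cmod (k (Complex v y') (Complex u y)) * norm (q (Complex u y)) \<le>
        (K' / sin (\<delta> / 2) * exp (- e * \<bar>v\<bar>)) * (K * (M * norm x) * exp (- e * \<bar>u\<bar>))"
      by (rule mult_mono[OF k q_le[OF y(2)]]) (use order_trans[OF norm_ge_zero k] in auto)
    then show ?thesis by (simp add: F_def B_def norm_scaleC mult_ac)
  qed
  have F_int_u: "F y' y v integrable_on UNIV"
    if y: "y' \<in> {\<nu>', - \<nu>'}" "y \<in> {\<nu>, - \<nu>}" for y y' v
  proof (rule exp_decay_integrable[OF _ e])
    show "continuous_on UNIV (F y' y v)"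
      using continuous_on_compose2[OF F_cont[OF y], of UNIV "\<lambda>u. (v, u)"] by (simp add: continuous_on_Pair)
    show "norm (F y' y v u) \<le> B * exp (- e * \<bar>v\<bar>) * exp (- e * \<bar>u + 0\<bar>)" for u
      using F_le[OF y, of v u] by (simp add: mult_ac)
  qed
  have k_int: "(\<lambda>v. k (Complex v y') (Complex u y)) integrable_on UNIV"
    if y: "y' \<in> {\<nu>', - \<nu>'}" "y \<in> {\<nu>, - \<nu>}" for y y' u
  proof (rule exp_decay_integrable[OF _ e])
    have "continuous_on UNIV (\<lambda>u. \<psi> (exp (Complex u y')))"
      using bspec[OF ld'[unfolded line_decays_def] y(1)] by simp
    then show "continuous_on UNIV (\<lambda>v. k (Complex v y') (Complex u y))"
      unfolding k_def using gap(1) that by (intro continuous_intros) auto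
    show "norm (k (Complex v y') (Complex u y)) \<le> K' / sin (\<delta> / 2) * exp (- e * \<bar>v + 0\<bar>)" for v
      using k_le[of "Complex v y'" "Complex u y"] y by simp
  qed
  have h_int: "(\<lambda>u. (\<phi> (exp (Complex u y)) * (exp v / (exp v - exp (Complex u y)))) *\<^sub>C zR (Complex u y) x) integrable_on UNIV"
    if y: "Im v \<in> {\<nu>', - \<nu>'}" "y \<in> {\<nu>, - \<nu>}" for y v
  proof (rule exp_decay_integrable[OF _ e])
    show "continuous_on UNIV (\<lambda>u. (\<phi> (exp (Complex u y)) * (exp v / (exp v - exp (Complex u y)))) *\<^sub>C zR (Complex u y) x)"
    proof -
      have "continuous_on UNIV (\<lambda>u. (exp v / (exp v - exp (Complex u y))) *\<^sub>C q (Complex u y))"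
        using gap(1) that by (intro continuous_intros q_cont) auto
      then show ?thesis by (simp add: q_def scaleC_scaleC mult.commute)
    qed
    show "norm ((\<phi> (exp (Complex u y)) * (exp v / (exp v - exp (Complex u y)))) *\<^sub>C zR (Complex u y) x)
        \<le> 1 / sin (\<delta> / 2) * (K * (M * norm x)) * exp (- e * \<bar>u + 0\<bar>)" for u
    proof -
      have "cmod (exp v / (exp v - exp (Complex u y))) * norm (q (Complex u y))
          \<le> (1 / sin (\<delta> / 2)) * (K * (M * norm x) * exp (- e * \<bar>u\<bar>))"
        by (rule mult_mono[OF gap(2) q_le[OF y(2)]]) (use y s in auto)
      then show ?thesis by (simp add: q_def norm_scaleC norm_mult norm_divide mult_ac)
    qed
  qed
  \<comment> \<open>The outer difference of two lines times the inner difference of two lines: four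
    terms, kept together so that one swap suffices.\<close>
  let ?f = "\<lambda>v u. (F (-\<nu>') (-\<nu>) v u - F (-\<nu>') \<nu> v u) - (F \<nu>' (-\<nu>) v u - F \<nu>' \<nu> v u)"
  let ?c = "2 * complex_of_real pi * \<i>"
  let ?I = "\<lambda>y. integral UNIV (\<lambda>u. (\<psi> (exp (Complex u y)) * \<phi> (exp (Complex u y))) *\<^sub>C zR (Complex u y) x)"
  have swap: "integral UNIV (\<lambda>v. integral UNIV (?f v)) = integral UNIV (\<lambda>u. integral UNIV (\<lambda>v. ?f v u))"
  proof (rule integral_swap_exp_decay[OF _ e])
    show "continuous_on UNIV (\<lambda>(v, u). ?f v u)"
      unfolding split_beta by (intro continuous_intros F_cont) auto
    show "norm (?f v u) \<le> (4 * B) * (exp (- e * \<bar>v\<bar>) * exp (- e * \<bar>u\<bar>))" for u v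
    proof -
      let ?b = "B * (exp (- e * \<bar>v\<bar>) * exp (- e * \<bar>u\<bar>))"
      have "norm (?f v u) \<le> (?b + ?b) + (?b + ?b)"
        by (intro norm_triangle_le_diff add_mono F_le) auto
      then show ?thesis by (simp add: mult_ac)
    qed
  qed
  \<comment> \<open>Inner contour first: the kernel becomes the resolvent acting on
    \<open>calc \<nu> \<phi> x\<close>.\<close>
  have inner_u: "integral UNIV (?f v) = ?c *\<^sub>C (\<psi> (exp (Complex v (-\<nu>'))) *\<^sub>C zR (Complex v (-\<nu>')) (calc \<nu> \<phi> x) -
      \<psi> (exp (Complex v \<nu>')) *\<^sub>C zR (Complex v \<nu>') (calc \<nu> \<phi> x))" for v
  proof -
    have *: "?c *\<^sub>C \<psi> (exp (Complex v y')) *\<^sub>C zR (Complex v y') (calc \<nu> \<phi> x) =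
        integral UNIV (F y' (-\<nu>) v) - integral UNIV (F y' \<nu> v)" if y': "y' \<in> {\<nu>', - \<nu>'}" for y'
    proof -
      let ?h = "\<lambda>u y. (\<phi> (exp (Complex u y)) * (exp (Complex v y') / (exp (Complex v y') - exp (Complex u y)))) *\<^sub>C zR (Complex u y) x"
      have "F y' y v = (\<lambda>u. \<psi> (exp (Complex v y')) *\<^sub>C ?h u y)" for y
        by (rule ext) (simp add: F_def k_def q_def scaleC_scaleC mult_ac)
      then have "integral UNIV (F y' y v) = \<psi> (exp (Complex v y')) *\<^sub>C integral UNIV (\<lambda>u. ?h u y)"
        if "y \<in> {\<nu>, -\<nu>}" for y
        using integral_linear[OF h_int[of "Complex v y'" y] scaleC.bounded_linear_right] that y' by (simp add: o_def)
      moreover have "zR (Complex v y') (calc \<nu> \<phi> x) = calc \<nu> (\<lambda>z. \<phi> z * (exp (Complex v y') / (exp (Complex v y') - z))) x"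
        by (rule calc_resolvent[OF \<phi> e \<tau> \<nu>(1) \<nu>0(6)]) (use y' \<nu> \<nu>0 in auto)
      ultimately show ?thesis
        by (simp add: calc_def scaleC_scaleC scaleC.diff_right mult_ac)
    qed
    have "integral UNIV (?f v) = (integral UNIV (F (-\<nu>') (-\<nu>) v) - integral UNIV (F (-\<nu>') \<nu> v)) -
        (integral UNIV (F \<nu>' (-\<nu>) v) - integral UNIV (F \<nu>' \<nu> v))"
      by (simp add: integral_diff integrable_diff F_int_u)
    then show ?thesis by (simp add: *[symmetric] scaleC.diff_right)
  qed
  \<comment> \<open>Outer contour first: the four terms regroup by the inner line, and each pair of
    outer lines is one Cauchy integral.\<close>
  have inner_v: "integral UNIV (\<lambda>v. ?f v u) =
      ?c *\<^sub>C ((\<psi> (exp (Complex u (-\<nu>))) * \<phi> (exp (Complex u (-\<nu>)))) *\<^sub>C zR (Complex u (-\<nu>)) x -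
        (\<psi> (exp (Complex u \<nu>)) * \<phi> (exp (Complex u \<nu>))) *\<^sub>C zR (Complex u \<nu>) x)" for u
  proof -
    have F_int_v: "((\<lambda>v. F y' y v u) has_integral integral UNIV (\<lambda>v. k (Complex v y') (Complex u y)) *\<^sub>C q (Complex u y)) UNIV"
      if y: "y' \<in> {\<nu>', - \<nu>'}" "y \<in> {\<nu>, - \<nu>}" for y' y
      using has_integral_linear[OF integrable_integral[OF k_int[OF y]] scaleC.bounded_linear_left]
      by (simp add: F_def o_def)
    have Cauchy: "integral UNIV (\<lambda>v. k (Complex v (-\<nu>')) w) - integral UNIV (\<lambda>v. k (Complex v \<nu>') w) = ?c * \<psi> (exp w)"
      if "Im w \<in> {\<nu>, - \<nu>}" for w
      using Cauchy_integral_formula_strip[OF \<psi> \<tau> e, of w \<nu>'] that \<nu> \<nu>0 by (auto simp: k_def)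
    let ?k = "\<lambda>y' y. integral UNIV (\<lambda>v. k (Complex v y') (Complex u y)) *\<^sub>C q (Complex u y)"
    have "integral UNIV (\<lambda>v. ?f v u) = (?k (-\<nu>') (-\<nu>) - ?k (-\<nu>') \<nu>) - (?k \<nu>' (-\<nu>) - ?k \<nu>' \<nu>)"
      by (intro integral_unique has_integral_diff F_int_v) auto
    also have "\<dots> = (?k (-\<nu>') (-\<nu>) - ?k \<nu>' (-\<nu>)) - (?k (-\<nu>') \<nu> - ?k \<nu>' \<nu>)" by simp
    also have "\<dots> = (?c * \<psi> (exp (Complex u (-\<nu>)))) *\<^sub>C q (Complex u (-\<nu>)) - (?c * \<psi> (exp (Complex u \<nu>))) *\<^sub>C q (Complex u \<nu>)"
      by (simp add: scaleC.diff_left[symmetric] Cauchy)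
    finally show ?thesis by (simp add: q_def scaleC_scaleC scaleC.diff_right mult_ac)
  qed
  have prod: "line_decays \<nu> e (K' * K) 0 (\<lambda>z. \<psi> z * \<phi> z)"
    unfolding line_decays_def
  proof (intro ballI conjI allI)
    fix y assume y: "y \<in> {\<nu>, - \<nu>}"
    have c: "continuous_on UNIV (\<lambda>u. h (exp (Complex u y)))" if "decays \<tau> e L 0 h" for L h
      using decays_imp_line_decays[OF that \<nu>0(1,6) \<tau>] y by (auto simp: line_decays_def)
    show "continuous_on UNIV (\<lambda>u. \<psi> (exp (Complex u y)) * \<phi> (exp (Complex u y)))"
      by (intro continuous_intros c[OF \<phi>] c[OF \<psi>])
    fix u
    have "cmod (\<psi> (exp (Complex u y))) \<le> K' * exp (- e * \<bar>u + 0\<bar>)"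
      using decaysD(2)[OF \<psi>, of "Complex u y"] y \<nu>0 by auto
    also have "\<dots> \<le> K' * 1" using K' e by (intro mult_left_mono) auto
    finally have "cmod (\<psi> (exp (Complex u y))) \<le> K'" by simp
    moreover have "cmod (\<phi> (exp (Complex u y))) \<le> K * exp (- e * \<bar>u + 0\<bar>)"
      using decaysD(2)[OF \<phi>, of "Complex u y"] y \<nu>0 by auto
    ultimately show "cmod (\<psi> (exp (Complex u y)) * \<phi> (exp (Complex u y))) \<le> K' * K * exp (- e * \<bar>u + 0\<bar>)"
      unfolding norm_mult mult.assoc using K' by (intro mult_mono) auto
  qed
  have c_int: "integral UNIV (\<lambda>u. ?c *\<^sub>C (G u - H u)) = ?c *\<^sub>C (integral UNIV G - integral UNIV H)"
    if "G integrable_on UNIV" "H integrable_on UNIV" for G H :: "real \<Rightarrow> 'a"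
    using integral_linear[OF integrable_diff[OF that] scaleC.bounded_linear_right[of ?c]] integral_diff[OF that]
    by (simp add: o_def)
  have "?c *\<^sub>C ?c *\<^sub>C calc \<nu>' \<psi> (calc \<nu> \<phi> x) = integral UNIV (\<lambda>v. integral UNIV (?f v))"
    unfolding inner_u
    by (subst c_int[OF calc_integrable[OF \<nu>0(5,4) ld' e] calc_integrable[OF \<nu>0(5,4) ld' e]])
       (auto simp: calc_def[of \<nu>'] scaleC_scaleC)
  also have "\<dots> = ?c *\<^sub>C ?c *\<^sub>C calc \<nu> (\<lambda>z. \<psi> z * \<phi> z) x"
    unfolding swap inner_v
    by (subst c_int[OF calc_integrable[OF \<nu>(1) \<nu>0(2) prod e] calc_integrable[OF \<nu>(1) \<nu>0(2) prod e]])
       (auto simp: calc_def scaleC_scaleC)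
  finally have "(1 / (?c * ?c)) *\<^sub>C (?c * ?c) *\<^sub>C calc \<nu>' \<psi> (calc \<nu> \<phi> x) =
      (1 / (?c * ?c)) *\<^sub>C (?c * ?c) *\<^sub>C calc \<nu> (\<lambda>z. \<psi> z * \<phi> z) x"
    by (simp only: scaleC_scaleC)
  then show ?thesis by (simp add: scaleC_scaleC)
qed

end

section \<open>The regularizer rho and the injectivity of rho(A)\<close>

lemma decays_rho:
  assumes \<tau>: "0 < \<tau>" "\<tau> < pi"
  shows "decays \<tau> 1 (1 / (sin ((pi - \<tau>) / 2))\<^sup>2) 0 rho"
  unfolding decays_def
proof (intro conjI allI impI)
  let ?s = "sin ((pi - \<tau>) / 2)"
  have s: "?s > 0" using \<tau> by (intro sin_gt_zero) auto
  have e_pi: "exp (Complex 0 pi) = -1" by (simp add: Complex_eq)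
  \<comment> \<open>\<open>Complex 0 pi\<close> is a logarithm of -1, and imaginary parts in the
    strip stay pi - tau away from it. The two orders of the arguments bound |1 + z| below by a
    multiple of |z| and by a constant.\<close>
  have lower: "?s * exp (Re w) \<le> cmod (1 + exp w)" "?s \<le> cmod (1 + exp w)" if "\<bar>Im w\<bar> < \<tau>" for w
    using exp_diff_lower_bound[of "pi - \<tau>" w "Complex 0 pi"] exp_diff_lower_bound[of "pi - \<tau>" "Complex 0 pi" w]
      that \<tau> by (auto simp: e_pi add.commute norm_minus_commute[of "-1"])
  have ne: "1 + z \<noteq> 0" if z: "z \<in> sector \<tau>" for z
  proof -
    obtain w where "z = exp w" "\<bar>Im w\<bar> < \<tau>"
      using z sector_eq_exp_image[of \<tau>] \<tau> by auto
    then show ?thesis using lower(2)[of w] s by auto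
  qed
  then show "rho holomorphic_on sector \<tau>"
    unfolding rho_def[abs_def] by (intro holomorphic_intros) auto
  fix w assume w: "\<bar>Im w\<bar> < \<tau>"
  have c: "cmod (1 + exp w) > 0" using lower(2)[OF w] s by linarith
  have "cmod (rho (exp w)) = exp (Re w) / (cmod (1 + exp w))\<^sup>2"
    by (simp add: rho_def norm_divide norm_power)
  also have "\<dots> \<le> 1 / ?s\<^sup>2 * exp (- 1 * \<bar>Re w + 0\<bar>)"
  proof (cases "Re w \<ge> 0")
    case True
    have "(?s * exp (Re w))\<^sup>2 \<le> (cmod (1 + exp w))\<^sup>2"
      using lower(1)[OF w] s by (intro power_mono) auto
    then have "exp (Re w) / (cmod (1 + exp w))\<^sup>2 \<le> exp (Re w) / (?s * exp (Re w))\<^sup>2"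
      using s c by (intro divide_left_mono mult_pos_pos) auto
    also have "\<dots> = 1 / ?s\<^sup>2 * exp (- Re w)"
      by (simp add: power2_eq_square exp_minus field_simps)
    finally show ?thesis using True by simp
  next
    case False
    have "?s\<^sup>2 \<le> (cmod (1 + exp w))\<^sup>2"
      using lower(2)[OF w] s by (intro power_mono) auto
    then have "exp (Re w) / (cmod (1 + exp w))\<^sup>2 \<le> exp (Re w) / ?s\<^sup>2"
      using s c by (intro divide_left_mono) auto
    then show ?thesis using False by simp
  qed
  finally show "cmod (rho (exp w)) \<le> 1 / ?s\<^sup>2 * exp (- 1 * \<bar>Re w + 0\<bar>)" .
qed

context sectorial_resolvent
begin

lemma calc_diff_arg:
  assumes "\<omega> < \<nu>" "\<nu> \<le> pi" "line_decays \<nu> e K a \<phi>" "e > 0"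
  shows "calc \<nu> \<phi> (x - y) = calc \<nu> \<phi> x - calc \<nu> \<phi> y"
proof -
  have "zR (Complex u t) (x - y) = zR (Complex u t) x - zR (Complex u t) y" if "t \<in> {\<nu>, -\<nu>}" for u t
    using bounded_linear.linear[OF bounded_linear_zR, of "Complex u t"] \<nu>_region[OF assms(1,2) that]
    by (simp add: linear_diff)
  then show ?thesis
    unfolding calc_def
    by (simp add: scaleC.diff_right integral_diff calc_integrable[OF assms])
qed

text \<open>\<open>p\<close> is (1 + A)^(-1), since exp (i pi) = -1, and the right-hand side is A (1
  + A)^(-2) x. The integrand rho(z) z R(z) x is rewritten through z R(z) y with y = p x - p (p x),
  which is tame at both ends because y lies in the domain and in the range of
  \<open>A\<close>.\<close>

lemma calc_rho:
  assumes \<nu>: "\<omega> < \<nu>" "\<nu> < pi"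
  defines "p \<equiv> zR (Complex 0 pi)"
  shows "calc \<nu> rho x = p x - p (p x)"
proof -
  have \<nu>0: "0 < \<nu>" "\<nu> \<le> pi" using \<nu> \<omega> by auto
  define \<tau> where "\<tau> = (\<nu> + pi) / 2"
  have \<tau>: "0 < \<tau>" "\<tau> < pi" "\<nu> < \<tau>" "\<tau> \<le> pi" using \<nu> \<nu>0 by (auto simp: \<tau>_def)
  define K where "K = 1 / (sin ((pi - \<tau>) / 2))\<^sup>2"
  have \<rho>: "decays \<tau> 1 K 0 rho" unfolding K_def by (rule decays_rho[OF \<tau>(1,2)])
  have ld: "line_decays \<nu> 1 K 0 rho" by (rule decays_imp_line_decays[OF \<rho> \<nu>0(1) \<tau>(3,4)])
  have K: "K \<ge> 0" by (simp add: K_def)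
  have e_pi: "exp (Complex 0 pi) = -1" by (simp add: Complex_eq)
  have pr: "cos (Im (Complex 0 pi)) < cos \<omega>" using \<nu> \<omega> by (intro cos_less_cos_\<omega>) auto
  have reg: "cos t < cos \<omega>" if "t \<in> {\<nu>..2 * pi - \<nu>}" for t
  proof (cases "t \<le> pi")
    case True then show ?thesis using that \<nu> \<omega> by (intro cos_less_cos_\<omega>) auto
  next
    case False
    then have "cos (2 * pi - t) < cos \<omega>" using that \<nu> \<omega> by (intro cos_less_cos_\<omega>) auto
    then show ?thesis by (simp add: cos_diff)
  qed
  have zR_p: "(1 + exp w) *\<^sub>C zR w (p z) = exp w *\<^sub>C p z + zR w z" if "cos (Im w) < cos \<omega>" for w z
    using zR_zR[OF that pr, of z] by (simp add: p_def e_pi add.commute)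
  define b c y q where "b = p x" and "c = p b" and "y = b - c" and "q = x - b"
  have yq: "y = p q"
    using bounded_linear.linear[OF bounded_linear_zR[OF pr]] by (simp add: y_def q_def c_def b_def p_def linear_diff)
  \<comment> \<open>The pole of \<open>z / (z - 1)\<close> lies inside the sector: subtracting \<open>\<kappa> w y\<close> from \<open>zR w y\<close> gives
    decay without a singularity outside, so the contour can be rotated through the negative half-line.\<close>
  define \<kappa> where "\<kappa> w = exp w / (exp w - 1)" for w :: complex
  define s where "s = sin (\<nu> / 2)"
  have s: "s > 0" unfolding s_def using \<nu>0 by (intro sin_gt_zero) auto
  define F where "F w = zR w y - \<kappa> w *\<^sub>C y" for w
  have \<kappa>: "exp w \<noteq> 1" "cmod (\<kappa> w) \<le> 1 / s" if "\<nu> \<le> \<bar>Im w\<bar>" "\<bar>Im w\<bar> \<le> 2 * pi - \<nu>" for w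
    using exp_quotient_le[OF \<nu>0, of w 0] that by (auto simp: \<kappa>_def s_def)
  \<comment> \<open>One summand for each of the regions Re w >= 1, Re w <= -1 and |Re w| <= 1; in
    the last one the factor \<open>exp 1\<close> compensates the exponential.\<close>
  define L where "L = 2 * (M * norm q + 2 * norm y) + 2 * (M * norm b + norm c + norm y) + exp 1 * (M * norm y + norm y / s)"
  have L: "2 * (M * norm q + 2 * norm y) \<le> L" "2 * (M * norm b + norm c + norm y) \<le> L" "exp 1 * (M * norm y + norm y / s) \<le> L"
    unfolding L_def using M s by auto
  have F_le: "norm (F w) \<le> L * exp (- 1 * \<bar>Re w\<bar>)"
    if "cos (Im w) < cos \<omega>" "\<nu> \<le> \<bar>Im w\<bar>" "\<bar>Im w\<bar> \<le> 2 * pi - \<nu>" for w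
  proof -
    note zR_y = zR_p[OF that(1)] and n = norm_zR_le[OF that(1)] and \<kappa>w = \<kappa>[OF that(2,3)]
    have lin: "zR w y = zR w b - zR w c"
      using bounded_linear.linear[OF bounded_linear_zR[OF that(1)]] by (simp add: y_def linear_diff)
    consider "Re w \<ge> 1" | "Re w \<le> -1" | "\<bar>Re w\<bar> \<le> 1" by linarith
    then show ?thesis
    proof cases
      case 1
      have "(2::real) \<le> exp 1" using exp_ge_add_one_self[of 1] by simp
      also have "\<dots> \<le> exp (Re w)" using 1 by simp
      finally have big: "2 \<le> cmod (exp w)" by simp
      have h: "cmod (exp w) / 2 \<le> cmod (1 + exp w)" "cmod (exp w) / 2 \<le> cmod (exp w - 1)"
        using norm_triangle_ineq2[of "exp w" "-1"] norm_triangle_ineq2[of "exp w" 1] big by (auto simp: add.commute)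
      \<comment> \<open>Near infinity: y = p q makes \<open>zR w y - y\<close> of order 1 / |exp w|,
        and kappa - 1 is of the same order.\<close>
      have "norm (zR w q - y) \<le> M * norm q + norm y" by (intro norm_triangle_le_diff add_right_mono n)
      moreover have "zR w q - y = (1 + exp w) *\<^sub>C (zR w y - y)"
        using zR_y[of q] by (simp add: yq scaleC.diff_right scaleC_add_left)
      ultimately have "cmod (1 + exp w) * norm (zR w y - y) \<le> M * norm q + norm y" by (simp add: norm_scaleC)
      with h(1) have 11: "cmod (exp w) / 2 * norm (zR w y - y) \<le> M * norm q + norm y"
        by (meson mult_right_mono norm_ge_zero order_trans)
      have "(exp w - 1) *\<^sub>C (\<kappa> w *\<^sub>C y - y) = y"
        using \<kappa>w(1) by (simp add: scaleC.diff_right scaleC.diff_left scaleC_scaleC \<kappa>_def)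
      then have "cmod (exp w - 1) * norm (\<kappa> w *\<^sub>C y - y) = norm y" by (metis norm_scaleC)
      with h(2) have 12: "cmod (exp w) / 2 * norm (\<kappa> w *\<^sub>C y - y) \<le> norm y"
        by (metis mult_right_mono norm_ge_zero)
      have "F w = (zR w y - y) - (\<kappa> w *\<^sub>C y - y)" by (simp add: F_def)
      then have "norm (F w) \<le> norm (zR w y - y) + norm (\<kappa> w *\<^sub>C y - y)" by (metis norm_triangle_ineq4)
      then have "cmod (exp w) / 2 * norm (F w) \<le> cmod (exp w) / 2 * (norm (zR w y - y) + norm (\<kappa> w *\<^sub>C y - y))"
        by (rule mult_left_mono) simp
      also have "\<dots> \<le> (M * norm q + norm y) + norm y" using 11 12 by (simp add: distrib_left)
      finally have "exp (Re w) * norm (F w) \<le> L" using L(1) by simp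
      then show ?thesis using 1 by (simp add: exp_minus field_simps)
    next
      case 2
      have "(2::real) \<le> exp 1" using exp_ge_add_one_self[of 1] by simp
      then have "exp (-1) \<le> (1/2::real)" by (simp add: exp_minus field_simps)
      moreover have "exp (Re w) \<le> exp (-1)" using 2 by simp
      ultimately have "exp (Re w) \<le> 1 / 2" by (rule order_trans[rotated])
      then have small: "cmod (exp w) \<le> 1 / 2" by simp
      have h: "1 / 2 \<le> cmod (1 + exp w)" "1 / 2 \<le> cmod (exp w - 1)"
        using norm_triangle_ineq2[of 1 "- exp w"] norm_triangle_ineq2[of 1 "exp w"] small
        by (auto simp: norm_minus_commute)
      \<comment> \<open>Near 0: y = b - p b makes \<open>zR w y\<close> of order |exp w|, and kappa
        is of the same order.\<close>
      have "(1 + exp w) *\<^sub>C zR w y = exp w *\<^sub>C (zR w b - c)"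
        using zR_y[of b] by (simp add: lin c_def[symmetric] scaleC.diff_right scaleC_add_left)
      then have "cmod (1 + exp w) * norm (zR w y) = cmod (exp w) * norm (zR w b - c)" by (metis norm_scaleC)
      also have "\<dots> \<le> cmod (exp w) * (M * norm b + norm c)"
        by (intro mult_left_mono norm_triangle_le_diff add_right_mono n) auto
      finally have 21: "1 / 2 * norm (zR w y) \<le> cmod (exp w) * (M * norm b + norm c)"
        using mult_right_mono[OF h(1), of "norm (zR w y)"] by simp
      have "cmod (exp w - 1) * norm (\<kappa> w *\<^sub>C y) = cmod (exp w) * norm y"
        using \<kappa>w(1) by (simp add: norm_scaleC \<kappa>_def norm_divide)
      then have 22: "1 / 2 * norm (\<kappa> w *\<^sub>C y) \<le> cmod (exp w) * norm y"
        using mult_right_mono[OF h(2), of "norm (\<kappa> w *\<^sub>C y)"] by simp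
      have "norm (F w) \<le> norm (zR w y) + norm (\<kappa> w *\<^sub>C y)" unfolding F_def by (rule norm_triangle_ineq4)
      also have "\<dots> \<le> 2 * (M * norm b + norm c + norm y) * exp (Re w)" using 21 22 by (simp add: algebra_simps)
      also have "\<dots> \<le> L * exp (Re w)" by (intro mult_right_mono L) auto
      finally show ?thesis using 2 by simp
    next
      case 3
      have "norm (\<kappa> w *\<^sub>C y) \<le> 1 / s * norm y"
        unfolding norm_scaleC by (intro mult_right_mono \<kappa>w(2)) auto
      moreover have "norm (F w) \<le> norm (zR w y) + norm (\<kappa> w *\<^sub>C y)" unfolding F_def by (rule norm_triangle_ineq4)
      ultimately have "norm (F w) \<le> M * norm y + norm y / s" using n[of y] by simp
      then have "exp 1 * norm (F w) \<le> exp 1 * (M * norm y + norm y / s)" by (rule mult_left_mono) simp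
      also note L(3)
      finally have "exp 1 * norm (F w) \<le> L" .
      then have "norm (F w) \<le> L * exp (-1)" by (simp add: exp_minus field_simps)
      also have "\<dots> \<le> L * exp (- 1 * \<bar>Re w\<bar>)"
        using 3 M s by (intro mult_left_mono) (auto simp: L_def)
      finally show ?thesis by simp
    qed
  qed
  have F_int: "(\<lambda>u. F (Complex u t)) integrable_on UNIV" if t: "t \<in> {\<nu>, - \<nu>}" for t
  proof (rule exp_decay_integrable)
    have r: "cos t < cos \<omega>" by (rule \<nu>_region[OF \<nu>(1) \<nu>0(2) t])
    have "continuous_on UNIV (\<lambda>u. zR (Complex u t) y)"
      by (rule continuous_on_compose2[OF continuous_on_zR[OF order_refl]])
         (use r in \<open>auto intro!: continuous_intros\<close>)
    moreover have "exp (Complex u t) - 1 \<noteq> 0" for u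
      using \<kappa>(1)[of "Complex u t"] t \<nu>0 \<nu> by auto
    ultimately show "continuous_on UNIV (\<lambda>u. F (Complex u t))"
      unfolding F_def \<kappa>_def by (intro continuous_intros) auto
    show "norm (F (Complex u t)) \<le> L * exp (- 1 * \<bar>u + 0\<bar>)" for u
      using F_le[of "Complex u t"] r t \<nu>0 \<nu> by auto
  qed simp
  have F_shift: "integral UNIV (\<lambda>u. F (Complex u (-\<nu>))) = integral UNIV (\<lambda>u. F (Complex u \<nu>))"
  proof -
    have "integral UNIV (\<lambda>u. 1 *\<^sub>C zR (Complex u \<nu>) y - \<kappa> (Complex u \<nu>) *\<^sub>C y) =
      integral UNIV (\<lambda>u. 1 *\<^sub>C zR (Complex u (2 * pi - \<nu>)) y - \<kappa> (Complex u (2 * pi - \<nu>)) *\<^sub>C y)"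
    proof (rule strip_shift_zR[where T=UNIV and T'="{w. exp w - 1 \<noteq> 0}" and e=1 and K=L])
      show "\<kappa> holomorphic_on {w. exp w - 1 \<noteq> 0}"
        unfolding \<kappa>_def by (intro holomorphic_intros) auto
      show "open {w::complex. exp w - 1 \<noteq> 0}" by (intro open_Collect_neq continuous_intros)
      show "{w. Im w \<in> {\<nu>..2 * pi - \<nu>}} \<subseteq> {w. exp w - 1 \<noteq> 0}"
        using \<kappa>(1) \<nu>0 by auto
      show "norm (1 *\<^sub>C zR w y - \<kappa> w *\<^sub>C y) \<le> L * exp (- 1 * \<bar>Re w\<bar>)" if "Im w \<in> {\<nu>..2 * pi - \<nu>}" for w
        using F_le[OF reg[OF that]] that \<nu>0 by (simp add: F_def)
    qed (use \<nu> reg in auto)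
    \<comment> \<open>Heights \<open>2 * pi - \<nu>\<close> and \<open>- \<nu>\<close> describe the
      same ray, which closes the rotation.\<close>
    moreover have e2: "exp (Complex u (2 * pi - \<nu>)) = exp (Complex u (-\<nu>))" for u
      by (simp add: exp_eq_polar cis_divide[symmetric] divide_inverse flip: cis_inverse)
    have "zR (Complex u (2 * pi - \<nu>)) y = zR (Complex u (-\<nu>)) y" "\<kappa> (Complex u (2 * pi - \<nu>)) = \<kappa> (Complex u (-\<nu>))" for u
      by (simp_all add: zR_def \<kappa>_def e2)
    ultimately show ?thesis by (simp add: F_def)
  qed
  have \<rho>_int: "(\<lambda>u. rho (exp (Complex u t))) integrable_on UNIV" if t: "t \<in> {\<nu>, - \<nu>}" for t
    by (rule exp_decay_integrable[of _ 1 K 0]) (use bspec[OF ld[unfolded line_decays_def] t] in auto)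
  have \<rho>_shift: "integral UNIV (\<lambda>u. rho (exp (Complex u (-\<nu>)))) = integral UNIV (\<lambda>u. rho (exp (Complex u \<nu>)))"
  proof (rule integral_strip_shift_scalar[OF _ _ decays_exp[OF \<rho> \<tau>(1,4)] open_strip])
    show "cmod (rho (exp w)) \<le> K * exp (- 1 * \<bar>Re w\<bar>)" if "Im w \<in> {- \<nu>..\<nu>}" for w
      using decaysD(2)[OF \<rho>, of w] that \<tau> by auto
  qed (use \<tau> \<nu>0 in auto)
  have \<rho>\<kappa>_int: "(\<lambda>u. rho (exp (Complex u t)) * \<kappa> (Complex u t)) integrable_on UNIV" if t: "t \<in> {\<nu>, - \<nu>}" for t
  proof (rule exp_decay_integrable[of _ 1 "K / s" 0])
    have ne: "exp (Complex u t) - 1 \<noteq> 0" for u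
      using \<kappa>(1)[of "Complex u t"] t \<nu>0 \<nu> by auto
    then show "continuous_on UNIV (\<lambda>u. rho (exp (Complex u t)) * \<kappa> (Complex u t))"
      unfolding \<kappa>_def using bspec[OF ld[unfolded line_decays_def] t] by (intro continuous_intros) auto
    show "cmod (rho (exp (Complex u t)) * \<kappa> (Complex u t)) \<le> K / s * exp (- 1 * \<bar>u + 0\<bar>)" for u
    proof -
      have "cmod (rho (exp (Complex u t))) * cmod (\<kappa> (Complex u t)) \<le> (K * exp (- 1 * \<bar>u + 0\<bar>)) * (1 / s)"
        using bspec[OF ld[unfolded line_decays_def] t] \<kappa>(2)[of "Complex u t"] t \<nu>0 \<nu> K
        by (intro mult_mono) auto
      then show ?thesis by (simp add: norm_mult)
    qed
  qed simp
  \<comment> \<open>The kernel is that of the point 1 = exp 0, and rho takes the value 1 / 4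
    there.\<close>
  have \<rho>\<kappa>: "integral UNIV (\<lambda>u. rho (exp (Complex u (-\<nu>))) * \<kappa> (Complex u (-\<nu>))) -
      integral UNIV (\<lambda>u. rho (exp (Complex u \<nu>)) * \<kappa> (Complex u \<nu>)) = 2 * pi * \<i> / 4"
    using Cauchy_integral_formula_strip[OF \<rho> \<tau>(4) _ _ \<tau>(3), of 0] \<nu>0 by (simp add: \<kappa>_def rho_def)
  \<comment> \<open>The factor 4 is the reciprocal of rho at 1. In the difference of the two lines
    \<open>F\<close> and rho cancel; only the product of rho and kappa remains and contributes
    exactly y.\<close>
  have decomp: "rho (exp w) *\<^sub>C zR w x = F w + (4 * (rho (exp w) * \<kappa> w) - 2 * rho (exp w)) *\<^sub>C y + rho (exp w) *\<^sub>C b"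
    if w: "cos (Im w) < cos \<omega>" "exp w \<noteq> 1" "exp w \<noteq> -1" for w
  proof -
    define \<alpha> where "\<alpha> = 1 / (1 + exp w)"
    have n1: "1 + exp w \<noteq> 0" using w(3) by (metis add.commute add_eq_0_iff2)
    have inv: "zR w (p z) = \<alpha> *\<^sub>C (exp w *\<^sub>C p z + zR w z)" for z
      unfolding zR_p[OF w(1), symmetric] using n1 by (simp add: scaleC_scaleC \<alpha>_def)
    have lin: "zR w y = zR w b - zR w c"
      using bounded_linear.linear[OF bounded_linear_zR[OF w(1)]] by (simp add: y_def linear_diff)
    have "zR w y = (\<alpha> - \<alpha>\<^sup>2) *\<^sub>C zR w x + (exp w * \<alpha> - exp w * \<alpha>\<^sup>2) *\<^sub>C b - (exp w * \<alpha>) *\<^sub>C c"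
      unfolding lin
      by (simp only: c_def inv) (simp add: b_def inv scaleC_add_right scaleC_add_left scaleC.diff_left scaleC_scaleC power2_eq_square mult_ac)
    moreover have "\<alpha> - \<alpha>\<^sup>2 = rho (exp w)" "exp w * \<alpha>\<^sup>2 = rho (exp w)"
    proof -
      have "1 / n - (1 / n)\<^sup>2 = (n - 1) / n\<^sup>2" if "n \<noteq> 0" for n :: complex
        using that by (simp add: field_simps power2_eq_square)
      from this[OF n1] show "\<alpha> - \<alpha>\<^sup>2 = rho (exp w)" by (simp add: \<alpha>_def rho_def)
      show "exp w * \<alpha>\<^sup>2 = rho (exp w)" by (simp add: \<alpha>_def rho_def power_divide)
    qed
    ultimately have zy: "zR w y = rho (exp w) *\<^sub>C zR w x + (exp w * \<alpha>) *\<^sub>C y - rho (exp w) *\<^sub>C b"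
      by (simp add: y_def scaleC.diff_left scaleC.diff_right)
    have "\<kappa> w - (4 * (rho (exp w) * \<kappa> w) - 2 * rho (exp w)) = exp w * \<alpha>"
    proof -
      have "l / (l - 1) - (4 * (l / (1 + l)\<^sup>2 * (l / (l - 1))) - 2 * (l / (1 + l)\<^sup>2)) = l * (1 / (1 + l))"
        if "l - 1 \<noteq> 0" "1 + l \<noteq> 0" for l :: complex
        using that by (simp add: divide_simps power2_eq_square) algebra
      then show ?thesis unfolding \<kappa>_def rho_def \<alpha>_def using n1 w(2) by simp
    qed
    then have "\<kappa> w *\<^sub>C y - (4 * (rho (exp w) * \<kappa> w) - 2 * rho (exp w)) *\<^sub>C y = (exp w * \<alpha>) *\<^sub>C y"
      by (simp only: scaleC.diff_left[symmetric])
    then show ?thesis unfolding F_def zy by (simp add: algebra_simps)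
  qed
  have ne: "exp (Complex u t) \<noteq> 1" "exp (Complex u t) \<noteq> -1" if t: "t \<in> {\<nu>, - \<nu>}" for u t
    using \<kappa>(1)[of "Complex u t"] exp_quotient_le(1)[of "pi - \<nu>" "Complex u t" "Complex 0 pi"] t \<nu>0 \<nu> by (auto simp: e_pi)
  have int_eq: "integral UNIV (\<lambda>u. rho (exp (Complex u t)) *\<^sub>C zR (Complex u t) x) =
      integral UNIV (\<lambda>u. F (Complex u t)) +
      (4 * integral UNIV (\<lambda>u. rho (exp (Complex u t)) * \<kappa> (Complex u t)) - 2 * integral UNIV (\<lambda>u. rho (exp (Complex u t)))) *\<^sub>C y +
      integral UNIV (\<lambda>u. rho (exp (Complex u t))) *\<^sub>C b" if t: "t \<in> {\<nu>, - \<nu>}" for t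
  proof (rule integral_unique)
    have "((\<lambda>u. F (Complex u t) +
      (4 * (rho (exp (Complex u t)) * \<kappa> (Complex u t)) - 2 * rho (exp (Complex u t))) *\<^sub>C y +
      rho (exp (Complex u t)) *\<^sub>C b) has_integral integral UNIV (\<lambda>u. F (Complex u t)) +
      (4 * integral UNIV (\<lambda>u. rho (exp (Complex u t)) * \<kappa> (Complex u t)) - 2 * integral UNIV (\<lambda>u. rho (exp (Complex u t)))) *\<^sub>C y +
      integral UNIV (\<lambda>u. rho (exp (Complex u t))) *\<^sub>C b) UNIV"
      by (intro has_integral_add integrable_integral F_int t
          has_integral_linear[OF _ scaleC.bounded_linear_left, unfolded o_def]
          has_integral_diff has_integral_mult_right \<rho>\<kappa>_int \<rho>_int)
    then show "((\<lambda>u. rho (exp (Complex u t)) *\<^sub>C zR (Complex u t) x) has_integral integral UNIV (\<lambda>u. F (Complex u t)) +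
      (4 * integral UNIV (\<lambda>u. rho (exp (Complex u t)) * \<kappa> (Complex u t)) - 2 * integral UNIV (\<lambda>u. rho (exp (Complex u t)))) *\<^sub>C y +
      integral UNIV (\<lambda>u. rho (exp (Complex u t))) *\<^sub>C b) UNIV"
      using decomp[of "Complex _ t"] ne[OF t] \<nu>_region[OF \<nu>(1) \<nu>0(2) t] by simp
  qed
  have "calc \<nu> rho x = (1 / (2 * pi * \<i>)) *\<^sub>C (4 * (integral UNIV (\<lambda>u. rho (exp (Complex u (-\<nu>))) * \<kappa> (Complex u (-\<nu>))) -
      integral UNIV (\<lambda>u. rho (exp (Complex u \<nu>)) * \<kappa> (Complex u \<nu>)))) *\<^sub>C y"
    unfolding calc_def int_eq[of "-\<nu>", simplified] int_eq[of \<nu>, simplified] F_shift \<rho>_shift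
    by (simp add: scaleC.diff_left right_diff_distrib)
  then show ?thesis unfolding \<rho>\<kappa> by (simp add: scaleC_scaleC y_def c_def b_def)
qed

text \<open>By \<open>calc_rho\<close> the hypothesis reads p (x - p x) = 0, and p is injective.
  Moreover x - p x is minus \<open>A\<close> applied to the resolvent of x, so injectivity of
  \<open>A\<close> makes that resolvent vanish, and x with it.\<close>

lemma calc_rho_eq_0_imp:
  assumes \<nu>: "\<omega> < \<nu>" "\<nu> < pi" and inj: "inj_on A (dom A)" and 0: "calc \<nu> rho x = 0"
  shows "x = 0"
proof -
  let ?v = "Complex 0 pi"
  let ?r = "resolvent A (exp ?v)"
  have v: "cos (Im ?v) < cos \<omega>" using \<nu> \<omega> by (intro cos_less_cos_\<omega>) auto
  have e: "exp ?v = -1" by (simp add: Complex_eq)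
  have A0: "A 0 = Some 0" using linear by (simp add: linear_op_def)
  have zR_0: "z = 0" if "zR ?v z = 0" for z
    using shifted_resolvent[OF v, of z] that A0 by (simp add: zR_def e shifted_def)
  have "zR ?v (x - zR ?v x) = 0"
    using 0 bounded_linear.linear[OF bounded_linear_zR[OF v]] calc_rho[OF \<nu>] by (simp add: linear_diff)
  then have "the (A (?r x)) = 0"
    using zR_0 op_resolvent[OF v, of x] by fastforce
  then have "A (?r x) = A 0" using resolvent_in_dom[OF v, of x] A0 by auto
  then have "?r x = 0" by (rule inj_onD[OF inj]) (use resolvent_in_dom[OF v] A0 in auto)
  then show ?thesis by - (rule zR_0, simp add: zR_def)
qed

end

section \<open>From the defining notions to decay estimates\<close>

lemma weight_exp: "weight e (exp w) = exp (e * \<bar>Re w\<bar>)" if "e > 0"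
  using that by (auto simp: weight_def exp_powr_real abs_if max_def mult_le_0_iff mult.commute)

lemma H0_inf_decays:
  assumes "\<phi> \<in> H0_inf \<tau>" "0 < \<tau>" "\<tau> \<le> pi"
  obtains e K where "e > 0" "decays \<tau> e K 0 \<phi>"
proof -
  from assms(1) obtain e where e: "e > 0" and bdd: "bdd_above ((\<lambda>z. weight e z * cmod (\<phi> z)) ` sector \<tau>)"
    and h: "\<phi> holomorphic_on sector \<tau>"
    by (auto simp: H0_inf_def H_inf_def)
  from bdd obtain K where K: "\<And>z. z \<in> sector \<tau> \<Longrightarrow> weight e z * cmod (\<phi> z) \<le> K"
    unfolding bdd_above_def by auto
  have "cmod (\<phi> (exp w)) \<le> K * exp (- e * \<bar>Re w + 0\<bar>)" if "\<bar>Im w\<bar> < \<tau>" for w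
    using K[OF exp_in_sector[OF assms(2,3) that]] e by (simp add: weight_exp exp_minus field_simps)
  with h e that[of e K] show ?thesis by (auto simp: decays_def)
qed

lemma dil_exp: "dil r \<phi> (exp w) = \<phi> (exp (w + of_real (ln r)))" if "r > 0"
  using that by (simp add: dil_def exp_add exp_of_real mult.commute)

lemma dil_in_sector:
  assumes "z \<in> sector \<tau>" "r > 0" "0 < \<tau>" "\<tau> \<le> pi"
  shows "complex_of_real r * z \<in> sector \<tau>"
proof -
  obtain w where w: "z = exp w" "\<bar>Im w\<bar> < \<tau>" using assms sector_eq_exp_image by auto
  have "complex_of_real r * z = exp (w + of_real (ln r))"
    using assms(2) by (simp add: w(1) exp_add exp_of_real mult.commute)
  then show ?thesis using exp_in_sector[OF assms(3,4), of "w + of_real (ln r)"] w(2) by simp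
qed

lemma decays_dil:
  assumes "decays \<tau> e K a \<phi>" "r > 0" "0 < \<tau>" "\<tau> \<le> pi"
  shows "decays \<tau> e K (a + ln r) (dil r \<phi>)"
  unfolding decays_def
proof (intro conjI allI impI)
  have "\<phi> \<circ> (\<lambda>z. complex_of_real r * z) holomorphic_on sector \<tau>"
    by (rule holomorphic_on_compose_gen[OF _ decaysD(1)[OF assms(1)]])
       (use dil_in_sector assms in \<open>auto intro!: holomorphic_intros\<close>)
  then show "dil r \<phi> holomorphic_on sector \<tau>" by (simp add: dil_def[abs_def] o_def)
  fix w assume "\<bar>Im w\<bar> < \<tau>"
  then show "cmod (dil r \<phi> (exp w)) \<le> K * exp (- e * \<bar>Re w + (a + ln r)\<bar>)"
    using decaysD(2)[OF assms(1), of "w + of_real (ln r)"] by (simp add: dil_exp[OF assms(2)] algebra_simps)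
qed

text \<open>A type \<open>\<omega>0\<close> below nu exists by definition of the infimum. The
  resolvent bound is available only off sectors strictly larger than that of the type, hence the
  midpoint \<open>\<omega>\<close>.\<close>

lemma exists_sectorial_resolvent:
  assumes "sectorial A" "sectorial_angle A < \<nu>" "\<nu> < pi"
  obtains \<omega> M where "sectorial_resolvent A \<omega> M" "\<omega> < \<nu>"
proof -
  let ?S = "{\<omega>. sectorial_of_type \<omega> A}"
  have "?S \<noteq> {}" using assms(1) by (auto simp: sectorial_def)
  then obtain \<omega>0 where \<omega>0: "sectorial_of_type \<omega>0 A" "\<omega>0 < \<nu>"
    using cInf_lessD[of ?S \<nu>] assms(2) by (auto simp: sectorial_angle_def)
  define \<omega> where "\<omega> = (\<omega>0 + \<nu>) / 2"
  have o: "0 \<le> \<omega>0" "\<omega>0 < \<omega>" "\<omega> < \<nu>" "\<omega> < pi"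
    using \<omega>0 assms(3) by (auto simp: \<omega>_def sectorial_of_type_def)
  from \<omega>0(1) o have spec: "spectrum A \<subseteq> closure (sector \<omega>0)" and lin: "linear_op A"
    and bdd: "bdd_above ((\<lambda>z. onorm (\<lambda>x. z *\<^sub>C resolvent A z x)) ` (- closure (sector \<omega>)))"
    by (auto simp: sectorial_of_type_def)
  from bdd obtain M where M: "\<And>z. z \<notin> closure (sector \<omega>) \<Longrightarrow> onorm (\<lambda>x. z *\<^sub>C resolvent A z x) \<le> M"
    unfolding bdd_above_def by auto
  have res: "bij_betw (shifted A (exp w)) (dom A) UNIV \<and> bounded_linear (resolvent A (exp w))"
    if "cos (Im w) < cos \<omega>" for w
  proof -
    have "cos \<omega> < cos \<omega>0" using o by (intro cos_monotone_0_pi) auto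
    with that have "exp w \<notin> closure (sector \<omega>0)" using o by (intro exp_notin_closure_sector) auto
    with spec show ?thesis by (auto simp: spectrum_def)
  qed
  have "sectorial_resolvent A \<omega> (max 0 M)"
  proof (rule sectorial_resolvent.intro)
    fix w x assume w: "cos (Im w) < cos \<omega>"
    have bl: "bounded_linear (\<lambda>x. exp w *\<^sub>C resolvent A (exp w) x)"
      using res[OF w] by (intro bounded_linear_compose[OF scaleC.bounded_linear_right]) auto
    have "norm (exp w *\<^sub>C resolvent A (exp w) x) \<le> onorm (\<lambda>x. exp w *\<^sub>C resolvent A (exp w) x) * norm x"
      by (rule onorm[OF bl])
    also have "\<dots> \<le> max 0 M * norm x"
      using M[OF exp_notin_closure_sector[OF _ _ w]] o by (intro mult_right_mono) auto
    finally show "norm (exp w *\<^sub>C resolvent A (exp w) x) \<le> max 0 M * norm x" .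
  qed (use o lin res in auto)
  with o(3) show ?thesis by (intro that)
qed

text \<open>\<open>e\<close>, \<open>K\<close>, \<open>L\<close> are shared by a whole family, while
  \<open>r\<close>, \<open>l0\<close>, \<open>l1\<close> belong to a single quotient;
  \<open>l0\<close> and \<open>l1\<close> stand for its values at 0 and infinity. In the error term
  \<open>r\<close> is only the centre \<open>ln r\<close> of the decay, which costs nothing in
  operator norm.\<close>

definition comparable_multiplier ::
    "real \<Rightarrow> real \<Rightarrow> real \<Rightarrow> real \<Rightarrow> (complex \<Rightarrow> complex) \<Rightarrow> bool" where
  "comparable_multiplier \<tau> e K L q \<longleftrightarrow> (\<forall>z\<in>sector \<tau>. cmod (q z) \<le> L) \<and>
     (\<exists>r>0. \<exists>l0 l1. cmod l0 \<le> L \<and> cmod l1 \<le> L \<and> (\<forall>w. \<bar>Im w\<bar> < \<tau> \<longrightarrow>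
        cmod (q (exp w) - (l0 + l1 * (complex_of_real r * exp w)) / (1 + complex_of_real r * exp w))
          \<le> K * exp (- e * \<bar>Re w + ln r\<bar>)))"

text \<open>Let y tend to 0. Applied to an inequality on the positive half-line this bounds
  \<open>lim_zero\<close>, and after the substitution of 1 / y for y also
  \<open>lim_infinity\<close>.\<close>

lemma norm_le_if_affine_le:
  fixes a b :: complex
  assumes "\<And>y. y > 0 \<Longrightarrow> cmod (a + b * complex_of_real y) \<le> B * (1 + y)"
  shows "cmod a \<le> B"
proof (rule field_le_epsilon)
  fix e :: real assume e: "e > 0"
  have "0 \<le> B * (1 + 1)" by (rule order_trans[OF norm_ge_zero assms]) simp
  then have B: "B \<ge> 0" by simp
  \<comment> \<open>Chosen so that \<open>(B + cmod b + 1) * y\<close> is \<open>e\<close>; the 1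
    keeps the denominator positive.\<close>
  define y where "y = e / (B + cmod b + 1)"
  have y: "y > 0" using e B norm_ge_zero[of b] unfolding y_def by (intro divide_pos_pos) linarith+
  have "cmod a \<le> cmod (a + b * complex_of_real y) + cmod (b * complex_of_real y)"
    using norm_triangle_ineq4[of "a + b * complex_of_real y" "b * complex_of_real y"] by simp
  also have "\<dots> \<le> B * (1 + y) + cmod b * y" using assms[OF y] y by (simp add: norm_mult)
  also have "\<dots> = B + (B + cmod b) * y" by (simp add: algebra_simps)
  also have "(B + cmod b) * y \<le> (B + cmod b + 1) * y" using y by simp
  also have "(B + cmod b + 1) * y = e" using B norm_ge_zero[of b] unfolding y_def by (simp add: add_nonneg_eq_0_iff)
  finally show "cmod a \<le> B + e" by simp
qed

lemma Phi_class_multipliers: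
  assumes \<phi>: "\<phi> \<in> Phi_class \<sigma>" and \<sigma>: "0 < \<sigma>" "\<sigma> \<le> pi"
  obtains d :: int and e K L where "e > 0"
    "\<And>j t. t \<in> {1..2} \<Longrightarrow> comparable_multiplier \<sigma> e K L (\<lambda>z. dil (2 powi j * t) \<phi> z / dil (2 powi (j - d)) \<phi> z)"
    "\<And>j t. t \<in> {1..2} \<Longrightarrow> comparable_multiplier \<sigma> e K L (\<lambda>z. dil (2 powi (j + d)) \<phi> z / dil (2 powi j * t) \<phi> z)"
proof -
  from \<phi> obtain d :: int and F e where e: "e > 0"
    and b1: "bdd_above ((\<lambda>(f, z). cmod (f z)) ` (F \<times> sector \<sigma>))"
    and b2: "bdd_above ((\<lambda>(f, z). weight e z *
             cmod (f z - (lim_zero \<sigma> f + lim_infinity \<sigma> f * z) / (1 + z))) ` (F \<times> sector \<sigma>))"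
    and F1: "\<And>j t. t \<in> {1..2} \<Longrightarrow> \<exists>f\<in>F. \<exists>r>0. \<forall>z\<in>sector \<sigma>.
             dil (2 powi j * t) \<phi> z / dil (2 powi (j - d)) \<phi> z = dil r f z"
    and F2: "\<And>j t. t \<in> {1..2} \<Longrightarrow> \<exists>f\<in>F. \<exists>r>0. \<forall>z\<in>sector \<sigma>.
             dil (2 powi (j + d)) \<phi> z / dil (2 powi j * t) \<phi> z = dil r f z"
  proof -
    from \<phi> show ?thesis
      unfolding Phi_class_def mem_Collect_eq
      by (elim conjE exE, intro that) (assumption | blast)+
  qed
  from b1 obtain L0 where L0: "\<And>f z. f \<in> F \<Longrightarrow> z \<in> sector \<sigma> \<Longrightarrow> cmod (f z) \<le> L0"
    unfolding bdd_above_def by auto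
  from b2 obtain K where K: "\<And>f z. f \<in> F \<Longrightarrow> z \<in> sector \<sigma> \<Longrightarrow>
      weight e z * cmod (f z - (lim_zero \<sigma> f + lim_infinity \<sigma> f * z) / (1 + z)) \<le> K"
    unfolding bdd_above_def by auto
  have K': "cmod (f (exp w) - (lim_zero \<sigma> f + lim_infinity \<sigma> f * exp w) / (1 + exp w)) \<le> K * exp (- e * \<bar>Re w\<bar>)"
    if "f \<in> F" "\<bar>Im w\<bar> < \<sigma>" for f w
    using K[OF that(1) exp_in_sector[OF \<sigma> that(2)]] e by (simp add: weight_exp exp_minus field_simps)
  \<comment> \<open>On the positive half-line |1 + y| = 1 + y. So the bounds for \<open>f\<close>
    and for its deviation from the rational function give an affine bound for the numerator.\<close>
  have lims: "cmod (lim_zero \<sigma> f) \<le> L0 + K" "cmod (lim_infinity \<sigma> f) \<le> L0 + K" if f: "f \<in> F" for f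
  proof -
    let ?a = "lim_zero \<sigma> f" and ?b = "lim_infinity \<sigma> f"
    have le: "cmod (?a + ?b * complex_of_real y) \<le> (L0 + K) * (1 + y)" if y: "y > 0" for y
    proof -
      define w where "w = complex_of_real (ln y)"
      have ew: "exp w = complex_of_real y" using y by (simp add: w_def exp_of_real)
      have w: "\<bar>Im w\<bar> < \<sigma>" using \<sigma> by (simp add: w_def)
      have k: "cmod (f (exp w) - (?a + ?b * exp w) / (1 + exp w)) \<le> K * exp (- e * \<bar>Re w\<bar>)" by (rule K'[OF f w])
      have "0 \<le> K * exp (- e * \<bar>Re w\<bar>)" using order_trans[OF norm_ge_zero k] .
      then have "K \<ge> 0" by (simp add: zero_le_mult_iff)
      then have "K * exp (- e * \<bar>Re w\<bar>) \<le> K * 1" using e by (intro mult_left_mono) auto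
      with k have "cmod (f (exp w) - (?a + ?b * exp w) / (1 + exp w)) \<le> K" by simp
      moreover have "cmod (f (exp w)) \<le> L0" by (rule L0[OF f exp_in_sector[OF \<sigma> w]])
      ultimately have "cmod ((?a + ?b * exp w) / (1 + exp w)) \<le> L0 + K"
        using norm_triangle_ineq4[of "f (exp w)" "f (exp w) - (?a + ?b * exp w) / (1 + exp w)"] by simp
      moreover have "cmod (1 + exp w) = 1 + y"
      proof -
        have "1 + exp w = complex_of_real (1 + y)" by (simp add: ew)
        then show ?thesis using y by (simp only: norm_of_real)
      qed
      ultimately have "cmod (?a + ?b * exp w) / (1 + y) \<le> L0 + K" by (simp only: norm_divide)
      then show ?thesis using y by (simp add: divide_le_eq ew)
    qed
    show "cmod ?a \<le> L0 + K" by (rule norm_le_if_affine_le[OF le])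
    show "cmod ?b \<le> L0 + K"
    proof (rule norm_le_if_affine_le)
      fix y :: real assume y: "y > 0"
      have "?b + ?a * complex_of_real y = complex_of_real y * (?a + ?b * complex_of_real (1 / y))"
        using y by (simp add: field_simps)
      then have "cmod (?b + ?a * complex_of_real y) = y * cmod (?a + ?b * complex_of_real (1 / y))"
        using y by (simp add: norm_mult)
      also have "\<dots> \<le> y * ((L0 + K) * (1 + 1 / y))" using y by (intro mult_left_mono le) auto
      also have "\<dots> = (L0 + K) * (1 + y)" using y by (simp add: field_simps)
      finally show "cmod (?b + ?a * complex_of_real y) \<le> (L0 + K) * (1 + y)" .
    qed
  qed
  have cm: "comparable_multiplier \<sigma> e K (max L0 (L0 + K)) q"
    if f: "f \<in> F" and r: "r > 0" and q: "\<forall>z\<in>sector \<sigma>. q z = dil r f z" for f r q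
  proof -
    let ?l0 = "lim_zero \<sigma> f" and ?l1 = "lim_infinity \<sigma> f"
    have "cmod (q z) \<le> max L0 (L0 + K)" if "z \<in> sector \<sigma>" for z
      using q that L0[OF f dil_in_sector[OF that r \<sigma>]] by (auto simp: dil_def)
    moreover have "cmod ?l0 \<le> max L0 (L0 + K)" "cmod ?l1 \<le> max L0 (L0 + K)"
      using lims[OF f] by auto
    moreover have "cmod (q (exp w) - (?l0 + ?l1 * (complex_of_real r * exp w)) / (1 + complex_of_real r * exp w))
          \<le> K * exp (- e * \<bar>Re w + ln r\<bar>)" if w: "\<bar>Im w\<bar> < \<sigma>" for w
    proof -
      have "complex_of_real r * exp w = exp (w + of_real (ln r))"
        using r by (simp add: exp_add exp_of_real mult.commute)
      then show ?thesis
        using K'[OF f, of "w + of_real (ln r)"] w q exp_in_sector[OF \<sigma> w] by (simp add: dil_def)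
    qed
    ultimately show ?thesis unfolding comparable_multiplier_def using r by blast
  qed
  show ?thesis
    by (rule that[OF e, of K "max L0 (L0 + K)" d]) (use F1 F2 cm in meson)+
qed

section \<open>Quotients of dilates as bounded operators\<close>

context sectorial_resolvent
begin

lemma H0_calc_eq_calc:
  "H0_calc \<sigma> A \<phi> x = calc (SOME \<nu>. sectorial_angle A < \<nu> \<and> \<nu> < \<sigma>) \<phi> x"
proof -
  have "ray \<nu> u = exp (Complex u \<nu>)" for \<nu> u by (simp add: ray_def Complex_eq)
  then show ?thesis
    by (simp add: H0_calc_def calc_def sector_contour_integral_def zR_def scaleC_scaleC mult_ac)
qed

lemma calc_cong:
  assumes "\<And>z. z \<in> sector \<tau> \<Longrightarrow> \<phi> z = \<psi> z" "0 < \<nu>" "\<nu> < \<tau>" "\<tau> \<le> pi"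
  shows "calc \<nu> \<phi> x = calc \<nu> \<psi> x"
proof -
  have "\<phi> (exp (Complex u y)) = \<psi> (exp (Complex u y))" if "y \<in> {\<nu>, - \<nu>}" for y u
    by (rule assms(1), rule exp_in_sector) (use assms that in auto)
  then show ?thesis by (simp add: calc_def)
qed

text \<open>\<open>calc_mult\<close> at a single angle: the outer contour is first moved outwards.
  Recentring at 0 and passing to the smaller rate affect only constants, and the conclusion is an
  identity.\<close>

lemma calc_calc:
  assumes \<phi>: "decays \<tau> e K a \<phi>" "e > 0" and \<psi>: "decays \<tau> e' K' a' \<psi>" "e' > 0"
    and \<nu>: "\<omega> < \<nu>" "\<nu> < \<tau>" "\<tau> \<le> pi"
  shows "calc \<nu> \<psi> (calc \<nu> \<phi> x) = calc \<nu> (\<lambda>z. \<psi> z * \<phi> z) x"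
proof -
  have \<tau>: "0 < \<tau>" using \<nu> \<omega> by linarith
  define \<nu>' where "\<nu>' = (\<nu> + \<tau>) / 2"
  have \<nu>': "\<nu> < \<nu>'" "\<nu>' < \<tau>" "\<omega> < \<nu>'" using \<nu> by (auto simp: \<nu>'_def)
  have \<phi>0: "decays \<tau> (min e e') (K * exp (e * \<bar>a - 0\<bar>)) 0 \<phi>"
    by (rule decays_weaken[OF decays_shift[OF \<phi>(1) \<tau>] \<tau>]) (use \<phi>(2) \<tau> in auto)
  have \<psi>0: "decays \<tau> (min e e') (K' * exp (e' * \<bar>a' - 0\<bar>)) 0 \<psi>"
    by (rule decays_weaken[OF decays_shift[OF \<psi>(1) \<tau>] \<tau>]) (use \<psi>(2) \<tau> in auto)
  have "calc \<nu> \<psi> (calc \<nu> \<phi> x) = calc \<nu>' \<psi> (calc \<nu> \<phi> x)"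
    by (rule calc_angle_independent[OF \<psi> \<nu>(3,1,2) \<nu>'(3,2)])
  also have "\<dots> = calc \<nu> (\<lambda>z. \<psi> z * \<phi> z) x"
    by (rule calc_mult[OF \<phi>0 \<psi>0 _ \<nu>(3,1) \<nu>'(1,2)]) (use \<phi>(2) \<psi>(2) in auto)
  finally show ?thesis .
qed

text \<open>1 / (1 + r z) is lambda / (lambda - z) for lambda = -1 / r, with logarithm - ln r + i
  pi. So \<open>calc_resolvent\<close> turns the factor into one value of \<open>zR\<close>, bounded
  by \<open>M\<close> whatever r is.\<close>

lemma norm_calc_mult_resolvent_le:
  assumes \<phi>: "decays \<tau> e K a \<phi>" "e > 0" and \<nu>: "\<omega> < \<nu>" "\<nu> < \<tau>" "\<tau> < pi" and r: "r > 0"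
  shows "norm (calc \<nu> (\<lambda>z. 1 / (1 + complex_of_real r * z) * \<phi> z) x) \<le> M * norm (calc \<nu> \<phi> x)"
proof -
  have \<tau>: "0 < \<tau>" using \<nu> \<omega> by linarith
  let ?v = "Complex (- ln r) pi"
  have ev: "exp ?v = - complex_of_real (1 / r)"
    using r by (simp add: Complex_eq exp_add exp_diff exp_minus exp_of_real divide_inverse)
  have v: "cos (Im ?v) < cos \<omega>" using \<nu> \<omega> by (intro cos_less_cos_\<omega>) auto
  have "exp ?v / (exp ?v - z) = 1 / (1 + complex_of_real r * z)" for z
  proof -
    have "1 + complex_of_real r * z = (exp ?v - z) / exp ?v" using r by (simp add: ev field_simps)
    then show ?thesis by simp
  qed
  then have "calc \<nu> (\<lambda>z. 1 / (1 + complex_of_real r * z) * \<phi> z) x = zR ?v (calc \<nu> \<phi> x)"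
    using calc_resolvent[OF decays_shift[OF \<phi>(1) \<tau>, of 0], where \<nu>=\<nu> and v="?v" and x=x] \<phi> \<nu> by (simp add: mult.commute)
  then show ?thesis using norm_zR_le[OF v] by simp
qed

text \<open>(l0 + l1 r z) / (1 + r z) is l1 + (l0 - l1) / (1 + r z). The three summands of the
  constant belong to the decaying rest \<open>q0\<close>, to l1, and to the resolvent term, where
  |l0 - l1| <= 2 L.\<close>

lemma norm_calc_comparable_le:
  assumes \<phi>: "decays \<sigma> e K a \<phi>" "e > 0" and \<nu>: "\<omega> < \<nu>" "\<nu> < \<sigma>" "\<sigma> \<le> pi"
    and q: "comparable_multiplier \<sigma> e' K' L q" "q holomorphic_on sector \<sigma>" and e': "e' > 0"
  shows "norm (calc \<nu> (\<lambda>z. q z * \<phi> z) x) \<le> (2 * K' * M / (pi * e') + L + 2 * L * M) * norm (calc \<nu> \<phi> x)"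
proof -
  \<comment> \<open>Strictly between nu and sigma, so that tau < pi even if sigma = pi; this keeps
    \<open>\<eta>\<close> bounded on \<open>sector \<tau>\<close>.\<close>
  define \<tau> where "\<tau> = (\<nu> + \<sigma>) / 2"
  have \<tau>: "\<nu> < \<tau>" "\<tau> < \<sigma>" "\<tau> < pi" "0 < \<tau>" "0 < \<sigma>" "0 < \<nu>" "\<tau> \<le> pi" "\<tau> \<le> \<sigma>" "\<nu> \<le> pi" using \<nu> \<omega> by (auto simp: \<tau>_def)
  from q(1) obtain r l0 l1 where r: "r > 0" and l: "cmod l0 \<le> L" "cmod l1 \<le> L"
    and q_le: "\<And>w. \<bar>Im w\<bar> < \<sigma> \<Longrightarrow>
        cmod (q (exp w) - (l0 + l1 * (complex_of_real r * exp w)) / (1 + complex_of_real r * exp w))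
          \<le> K' * exp (- e' * \<bar>Re w + ln r\<bar>)"
    unfolding comparable_multiplier_def by blast
  define \<eta> where "\<eta> z = 1 / (1 + complex_of_real r * z)" for z
  define q0 where "q0 z = q z - (l0 + l1 * (complex_of_real r * z)) * \<eta> z" for z
  have \<phi>': "decays \<tau> e K a \<phi>" by (rule decays_weaken[OF \<phi>(1)]) (use \<tau> in auto)
  let ?s = "sin ((pi - \<tau>) / 2)"
  have ne: "1 + complex_of_real r * z \<noteq> 0" and \<eta>_le: "cmod (\<eta> z) \<le> 1 / ?s" if z: "z \<in> sector \<tau>" for z
  proof -
    obtain w where w: "z = exp w" "\<bar>Im w\<bar> < \<tau>" using z \<tau> sector_eq_exp_image[of \<tau>] by auto
    define v where "v = Complex (- ln r) pi"
    have ev: "exp v = - complex_of_real (1 / r)"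
      using r by (simp add: v_def Complex_eq exp_add exp_diff exp_minus exp_of_real divide_inverse)
    have eq: "1 + complex_of_real r * z = (exp v - exp w) / exp v" using r by (simp add: ev w(1) field_simps)
    note * = exp_quotient_le[of "pi - \<tau>" v w]
    show "1 + complex_of_real r * z \<noteq> 0" using * w(2) \<tau> by (auto simp: eq v_def)
    show "cmod (\<eta> z) \<le> 1 / ?s" unfolding \<eta>_def eq using *(2) w(2) \<tau> by (auto simp: v_def)
  qed
  have \<eta>_hol: "\<eta> holomorphic_on sector \<tau>"
    unfolding \<eta>_def using ne by (intro holomorphic_intros) auto
  have q0: "decays \<tau> e' K' (ln r) q0"
    unfolding decays_def
  proof (intro conjI allI impI)
    show "q0 holomorphic_on sector \<tau>"
      unfolding q0_def using sector_mono[of \<tau> \<sigma>] \<tau>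
      by (intro holomorphic_intros \<eta>_hol holomorphic_on_subset[OF q(2)]) auto
    show "cmod (q0 (exp w)) \<le> K' * exp (- e' * \<bar>Re w + ln r\<bar>)" if "\<bar>Im w\<bar> < \<tau>" for w
      using q_le[of w] that \<tau> by (simp add: q0_def \<eta>_def)
  qed
  note K' = decays_nonneg[OF q0 \<tau>(4)]
  have q0_bd: "cmod (q0 z) \<le> K'" if z: "z \<in> sector \<tau>" for z
  proof -
    obtain w where w: "z = exp w" "\<bar>Im w\<bar> < \<tau>" using z \<tau> sector_eq_exp_image[of \<tau>] by auto
    have "cmod (q0 z) \<le> K' * exp (- e' * \<bar>Re w + ln r\<bar>)" unfolding w(1) by (rule decaysD(2)[OF q0 w(2)])
    also have "\<dots> \<le> K' * 1" using K' e' by (intro mult_left_mono) auto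
    finally show ?thesis by simp
  qed
  note ld = decays_imp_line_decays[OF _ \<tau>(6,1,7)]
  have d1: "decays \<tau> e (K' * K) a (\<lambda>z. q0 z * \<phi> z)"
    by (rule decays_mult_bounded[OF \<phi>' \<tau>(4,7) decaysD(1)[OF q0] q0_bd])
  have d2: "decays \<tau> e (1 / ?s * K) a (\<lambda>z. \<eta> z * \<phi> z)"
    by (rule decays_mult_bounded[OF \<phi>' \<tau>(4,7) \<eta>_hol \<eta>_le])
  have d3: "decays \<tau> e (cmod l1 * K) a (\<lambda>z. l1 * \<phi> z)"
    by (rule decays_mult_bounded[OF \<phi>' \<tau>(4,7)]) auto
  have d4: "decays \<tau> e (cmod (l0 - l1) * (1 / ?s * K)) a (\<lambda>z. (l0 - l1) * (\<eta> z * \<phi> z))"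
    by (rule decays_mult_bounded[OF d2 \<tau>(4,7)]) auto
  have d5: "decays \<tau> e (cmod l1 * K + cmod (l0 - l1) * (1 / ?s * K)) a (\<lambda>z. l1 * \<phi> z + (l0 - l1) * (\<eta> z * \<phi> z))"
    using d3 d4 unfolding decays_def distrib_right
    by (auto intro!: holomorphic_intros order_trans[OF norm_triangle_ineq add_mono])
  have "calc \<nu> (\<lambda>z. q z * \<phi> z) x = calc \<nu> (\<lambda>z. q0 z * \<phi> z + (l1 * \<phi> z + (l0 - l1) * (\<eta> z * \<phi> z))) x"
  proof (rule calc_cong[OF _ \<tau>(6,1,7)])
    fix z assume "z \<in> sector \<tau>"
    from ne[OF this] have "(1 + complex_of_real r * z) * \<eta> z = 1" by (simp add: \<eta>_def)
    then show "q z * \<phi> z = q0 z * \<phi> z + (l1 * \<phi> z + (l0 - l1) * (\<eta> z * \<phi> z))"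
      unfolding q0_def by algebra
  qed
  also have "\<dots> = calc \<nu> (\<lambda>z. q0 z * \<phi> z) x + (l1 *\<^sub>C calc \<nu> \<phi> x + (l0 - l1) *\<^sub>C calc \<nu> (\<lambda>z. \<eta> z * \<phi> z) x)"
    by (simp add: calc_add[OF \<nu>(1) \<tau>(9) ld[OF d1] \<phi>(2) ld[OF d5] \<phi>(2)] calc_add[OF \<nu>(1) \<tau>(9) ld[OF d3] \<phi>(2) ld[OF d4] \<phi>(2)]
        calc_cmult[OF \<nu>(1) \<tau>(9) ld[OF \<phi>'] \<phi>(2)] calc_cmult[OF \<nu>(1) \<tau>(9) ld[OF d2] \<phi>(2)])
  also have "norm \<dots> \<le> norm (calc \<nu> (\<lambda>z. q0 z * \<phi> z) x) + (norm (l1 *\<^sub>C calc \<nu> \<phi> x) + norm ((l0 - l1) *\<^sub>C calc \<nu> (\<lambda>z. \<eta> z * \<phi> z) x))"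
    by (intro order_trans[OF norm_triangle_ineq] add_left_mono norm_triangle_ineq)
  also have "\<dots> \<le> 2 * K' * M / (pi * e') * norm (calc \<nu> \<phi> x) + (L * norm (calc \<nu> \<phi> x) + (2 * L) * (M * norm (calc \<nu> \<phi> x)))"
  proof (intro add_mono)
    show "norm (calc \<nu> (\<lambda>z. q0 z * \<phi> z) x) \<le> 2 * K' * M / (pi * e') * norm (calc \<nu> \<phi> x)"
      unfolding calc_calc[OF \<phi>' \<phi>(2) q0 e' \<nu>(1) \<tau>(1,7), symmetric]
      by (rule norm_calc_le[OF \<nu>(1) \<tau>(9) ld[OF q0] e'])
    show "norm (l1 *\<^sub>C calc \<nu> \<phi> x) \<le> L * norm (calc \<nu> \<phi> x)"
      unfolding norm_scaleC using l by (intro mult_right_mono) auto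
    have "cmod (l0 - l1) \<le> 2 * L" using norm_triangle_ineq4[of l0 l1] l by simp
    moreover have "norm (calc \<nu> (\<lambda>z. \<eta> z * \<phi> z) x) \<le> M * norm (calc \<nu> \<phi> x)"
      unfolding \<eta>_def by (rule norm_calc_mult_resolvent_le[OF \<phi>' \<phi>(2) \<nu>(1) \<tau>(1,3) r])
    ultimately show "norm ((l0 - l1) *\<^sub>C calc \<nu> (\<lambda>z. \<eta> z * \<phi> z) x) \<le> (2 * L) * (M * norm (calc \<nu> \<phi> x))"
      unfolding norm_scaleC using order_trans[OF norm_ge_zero l(1)] by (intro mult_mono) auto
  qed
  finally show ?thesis by (simp add: algebra_simps)
qed

text \<open>A numerator is the quotient times its denominator, and since phi has no zeros the
  quotient is a holomorphic multiplier. The maximum with 1 secures a positive constant.\<close>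

lemma calc_dil_comparable:
  assumes \<phi>: "\<phi> \<in> Phi_class \<sigma>" and \<nu>: "\<omega> < \<nu>" "\<nu> < \<sigma>" "\<sigma> \<le> pi"
  obtains d :: int and C where "C > 0"
    "\<And>j t x. t \<in> {1..2} \<Longrightarrow> norm (calc \<nu> (dil (2 powi j * t) \<phi>) x) \<le> C * norm (calc \<nu> (dil (2 powi (j - d)) \<phi>) x)"
    "\<And>j t x. t \<in> {1..2} \<Longrightarrow> norm (calc \<nu> (dil (2 powi (j + d)) \<phi>) x) \<le> C * norm (calc \<nu> (dil (2 powi j * t) \<phi>) x)"
proof -
  have \<sigma>: "0 < \<sigma>" "0 < \<nu>" using \<nu> \<omega> by auto
  have H0: "\<phi> \<in> H0_inf \<sigma>" and nz: "\<And>z. z \<in> sector \<sigma> \<Longrightarrow> \<phi> z \<noteq> 0" using \<phi> by (auto simp: Phi_class_def)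
  obtain e K where e: "e > 0" and dec: "decays \<sigma> e K 0 \<phi>" by (rule H0_inf_decays[OF H0 \<sigma>(1) \<nu>(3)])
  obtain d e' K' L where e': "e' > 0"
    and q1: "\<And>j t. t \<in> {1..2} \<Longrightarrow> comparable_multiplier \<sigma> e' K' L (\<lambda>z. dil (2 powi j * t) \<phi> z / dil (2 powi (j - d)) \<phi> z)"
    and q2: "\<And>j t. t \<in> {1..2} \<Longrightarrow> comparable_multiplier \<sigma> e' K' L (\<lambda>z. dil (2 powi (j + d)) \<phi> z / dil (2 powi j * t) \<phi> z)"
    by (rule Phi_class_multipliers[OF \<phi> \<sigma>(1) \<nu>(3)]) blast
  let ?C = "2 * K' * M / (pi * e') + L + 2 * L * M"
  have main: "norm (calc \<nu> (dil p \<phi>) x) \<le> ?C * norm (calc \<nu> (dil r \<phi>) x)"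
    if "comparable_multiplier \<sigma> e' K' L (\<lambda>z. dil p \<phi> z / dil r \<phi> z)" "p > 0" "r > 0" for p r x
  proof -
    have nz': "dil r \<phi> z \<noteq> 0" if "z \<in> sector \<sigma>" for z
      using nz[OF dil_in_sector[OF that \<open>r > 0\<close> \<sigma>(1) \<nu>(3)]] by (simp add: dil_def)
    have "calc \<nu> (dil p \<phi>) x = calc \<nu> (\<lambda>z. dil p \<phi> z / dil r \<phi> z * dil r \<phi> z) x"
      by (rule calc_cong[OF _ \<sigma>(2) \<nu>(2,3)]) (simp add: nz')
    also have "norm \<dots> \<le> ?C * norm (calc \<nu> (dil r \<phi>) x)"
      by (rule norm_calc_comparable_le[OF decays_dil[OF dec \<open>r > 0\<close> \<sigma>(1) \<nu>(3)] e \<nu> that(1) _ e'])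
         (use nz' decaysD(1)[OF decays_dil[OF dec _ \<sigma>(1) \<nu>(3)]] that in \<open>auto intro!: holomorphic_intros\<close>)
    finally show ?thesis .
  qed
  have main': "norm (calc \<nu> (dil p \<phi>) x) \<le> max 1 ?C * norm (calc \<nu> (dil r \<phi>) x)"
    if "comparable_multiplier \<sigma> e' K' L (\<lambda>z. dil p \<phi> z / dil r \<phi> z)" "p > 0" "r > 0" for p r x
    by (rule order_trans[OF main[OF that]]) (intro mult_right_mono, auto)
  show ?thesis
    by (rule that[of "max 1 ?C" d]) (auto intro!: main' q1 q2)
qed

end

section \<open>Dyadic sums and a dyadic partition of a constant\<close>

lemma two_powi_eq_exp: "(2::real) powi k = exp (real_of_int k * ln 2)"
  by (simp add: powr_real_of_int'[symmetric] powr_def)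

lemma ln_two_powi: "ln ((2::real) powi k) = real_of_int k * ln 2"
  by (simp add: two_powi_eq_exp)

lemma sum_int_symmetric_interval:
  fixes f :: "int \<Rightarrow> 'b::comm_monoid_add"
  shows "(\<Sum>k = - int N..int N. f k) = (\<Sum>i\<le>N. if i = 0 then f 0 else f (int i) + f (- int i))"
proof (induction N)
  case (Suc N)
  have "{- int (Suc N)..int (Suc N)} = insert (int (Suc N)) (insert (- int (Suc N)) {- int N..int N})" by auto
  then show ?case using Suc by (simp add: add_ac)
qed simp

text \<open>The reflection of k to j - k leads into a symmetric interval, where each power of q
  occurs at most twice.\<close>

lemma sum_int_geometric_le:
  fixes q :: real
  assumes q: "0 \<le> q" "q < 1" and S: "finite S"
  shows "(\<Sum>k\<in>S. q ^ nat \<bar>j - k\<bar>) \<le> 2 / (1 - q)"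
proof -
  have sym: "(\<Sum>k = - int N..int N. q ^ nat \<bar>k\<bar>) \<le> 2 / (1 - q)" for N
  proof -
    have "(\<Sum>k = - int N..int N. q ^ nat \<bar>k\<bar>) = (\<Sum>i\<le>N. if i = 0 then q ^ nat \<bar>0\<bar> else q ^ nat \<bar>int i\<bar> + q ^ nat \<bar>- int i\<bar>)"
      by (rule sum_int_symmetric_interval)
    also have "\<dots> \<le> (\<Sum>i\<le>N. 2 * q ^ i)" using q by (intro sum_mono) auto
    also have "\<dots> = 2 * (\<Sum>i\<le>N. q ^ i)" by (simp add: sum_distrib_left)
    also have "(\<Sum>i\<le>N. q ^ i) \<le> (\<Sum>i. q ^ i)"
      using q by (intro sum_le_suminf summable_geometric) auto
    also have "(\<Sum>i. q ^ i) = 1 / (1 - q)" using q by (intro suminf_geometric) auto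
    finally show ?thesis by simp
  qed
  have fin: "finite ((\<lambda>k. j - k) ` S)" using S by simp
  then obtain N where N: "(\<lambda>k. j - k) ` S \<subseteq> {- int N..int N}"
  proof -
    define N where "N = nat (\<Sum>k\<in>(\<lambda>k. j - k) ` S. \<bar>k\<bar>)"
    have "\<bar>k\<bar> \<le> int N" if "k \<in> (\<lambda>k. j - k) ` S" for k
      unfolding N_def using member_le_sum[OF that, of abs] fin by (simp add: sum_nonneg)
    then have "(\<lambda>k. j - k) ` S \<subseteq> {- int N..int N}" by force
    then show ?thesis by (rule that)
  qed
  have "(\<Sum>k\<in>S. q ^ nat \<bar>j - k\<bar>) = (\<Sum>k\<in>(\<lambda>k. j - k) ` S. q ^ nat \<bar>k\<bar>)"
    by (subst sum.reindex) (auto simp: inj_on_def)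
  also have "\<dots> \<le> (\<Sum>k = - int N..int N. q ^ nat \<bar>k\<bar>)"
    using N q by (intro sum_mono2) auto
  also have "\<dots> \<le> 2 / (1 - q)" by (rule sym)
  finally show ?thesis .
qed

lemma holomorphic_cnj_cnj:
  assumes f: "f holomorphic_on S" and "open S"
  shows "(\<lambda>w. cnj (f (cnj w))) holomorphic_on cnj -` S"
  unfolding holomorphic_on_def
proof
  fix w assume "w \<in> cnj -` S"
  then have "(f has_derivative (*) (deriv f (cnj w))) (at (cnj w))"
    using holomorphic_derivI[OF f \<open>open S\<close>, of "cnj w"] by (simp add: has_field_derivative_def)
  from has_derivative_compose[OF bounded_linear.has_derivative[OF bounded_linear_cnj has_derivative_ident] this]
  have "((\<lambda>w. f (cnj w)) has_derivative (\<lambda>h. deriv f (cnj w) * cnj h)) (at w within cnj -` S)" .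
  from bounded_linear.has_derivative[OF bounded_linear_cnj this]
  have "((\<lambda>w. cnj (f (cnj w))) has_field_derivative cnj (deriv f (cnj w))) (at w within cnj -` S)"
    by (simp add: has_field_derivative_def)
  then show "(\<lambda>w. cnj (f (cnj w))) field_differentiable (at w within cnj -` S)"
    unfolding field_differentiable_def by blast
qed

text \<open>A dyadic partition of a constant: \<open>g\<close> is the increment over one dyadic step of a primitive
  (in logarithmic coordinates) of \<open>\<psi>(z) \<psi>\<^sup>*(z)\<close>, where \<open>\<psi>\<^sup>*(z)\<close> is the conjugate of \<open>\<psi>\<close> at the
  conjugate of \<open>z\<close>. The product is positive on the half-line, so the telescoping sum does not vanish.\<close>

lemma dyadic_partition:
  assumes dec: "decays \<sigma> e K 0 \<psi>" and e: "e > 0" and \<sigma>: "0 < \<sigma>" "\<sigma> \<le> pi"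
    and nz: "\<And>z. z \<in> sector \<sigma> \<Longrightarrow> \<psi> z \<noteq> 0"
    and dom: "\<And>t z. t \<in> {1..2} \<Longrightarrow> z \<in> sector \<sigma> \<Longrightarrow>
      cmod (dil t \<psi> z) \<le> L * cmod (dil (2 powi (- d)) \<psi> z)"
  obtains g c K' where "g holomorphic_on sector \<sigma>" "c \<noteq> 0"
    "\<And>w. \<bar>Im w\<bar> < \<sigma> \<Longrightarrow> cmod (g (exp w)) \<le> K' * exp (- e * \<bar>Re w\<bar>) * cmod (dil (2 powi (- d)) \<psi> (exp w))"
    "\<And>z. z \<in> sector \<sigma> \<Longrightarrow> (\<lambda>N. \<Sum>k = - int N..int N. dil (2 powi k) g z) \<longlonglongrightarrow> c"
proof -
  let ?T = "{w. \<bar>Im w\<bar> < \<sigma>}"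
  note K = decays_nonneg[OF dec \<sigma>(1)]
  define P where "P w = \<psi> (exp w) * cnj (\<psi> (exp (cnj w)))" for w
  have "(\<lambda>w. cnj (\<psi> (exp (cnj w)))) holomorphic_on ?T"
    using holomorphic_cnj_cnj[OF decays_exp[OF dec \<sigma>] open_strip] by (simp add: vimage_def)
  then have P_hol: "P holomorphic_on ?T"
    unfolding P_def by (intro holomorphic_intros decays_exp[OF dec \<sigma>])
  \<comment> \<open>The modulus of psi is kept: it will be absorbed by
    \<open>dil (2 powi (- d)) \<psi>\<close>, while the conjugate factor supplies the decay.\<close>
  have P_le: "cmod (P w) \<le> K * cmod (\<psi> (exp w)) * exp (- e * \<bar>Re w\<bar>)" if "\<bar>Im w\<bar> < \<sigma>" for w
  proof -
    have "cmod (\<psi> (exp w)) * cmod (\<psi> (exp (cnj w))) \<le> cmod (\<psi> (exp w)) * (K * exp (- e * \<bar>Re (cnj w) + 0\<bar>))"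
      using that by (intro mult_left_mono decaysD(2)[OF dec]) auto
    then show ?thesis by (simp add: P_def norm_mult mult_ac)
  qed
  have P_le2: "cmod (P w) \<le> K\<^sup>2 * exp (- e * \<bar>Re w\<bar>)" if "\<bar>Im w\<bar> < \<sigma>" for w
  proof -
    have "cmod (\<psi> (exp w)) \<le> K * exp (- e * \<bar>Re w + 0\<bar>)" by (rule decaysD(2)[OF dec that])
    also have "\<dots> \<le> K * 1" using K e by (intro mult_left_mono) auto
    finally have "K * cmod (\<psi> (exp w)) * exp (- e * \<bar>Re w\<bar>) \<le> K * (K * 1) * exp (- e * \<bar>Re w\<bar>)"
      using K by (intro mult_right_mono mult_left_mono) auto
    with P_le[OF that] show ?thesis by (simp add: power2_eq_square)
  qed
  obtain Q where "\<And>w. w \<in> ?T \<Longrightarrow> (Q has_field_derivative P w) (at w within ?T)"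
    by (rule holomorphic_convex_primitive'[OF convex_strip open_strip P_hol]) blast
  then have Q: "(Q has_field_derivative P w) (at w within S)" if "\<bar>Im w\<bar> < \<sigma>" for w S
    using that at_within_open[OF _ open_strip, of w \<sigma>] has_field_derivative_at_within by fastforce
  have Q_diff: "cmod (Q v - Q w) \<le> B * cmod (v - w)"
    if "\<And>u. u \<in> closed_segment w v \<Longrightarrow> \<bar>Im u\<bar> < \<sigma> \<and> cmod (P u) \<le> B" for v w B
    by (rule field_differentiable_bound[OF convex_closed_segment[of w v]]) (use that Q in auto)
  define l2 where "l2 = complex_of_real (ln 2)"
  define G where "G w = Q (w + l2) - Q w" for w
  define g where "g z = G (Ln z)" for z
  have g_exp: "g (exp w) = G w" if "\<bar>Im w\<bar> < \<sigma>" for w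
    using that \<sigma> by (auto simp: g_def abs_less_iff)
  have dil_g: "dil (2 powi k) g (exp w) = G (w + of_int k * l2)" if "\<bar>Im w\<bar> < \<sigma>" for w k
    using g_exp[of "w + of_int k * l2"] that by (simp add: dil_exp ln_two_powi l2_def)
  have Q_hol: "Q holomorphic_on ?T"
    using Q by (auto simp: holomorphic_on_def field_differentiable_def)
  have Im_Ln_T: "Ln z \<in> ?T" if "z \<in> sector \<sigma>" for z
    using that sector_eq_exp_image[OF \<sigma>] \<sigma> by auto
  have g_hol: "g holomorphic_on sector \<sigma>"
  proof -
    have Lh: "Ln holomorphic_on sector \<sigma>" using \<sigma> by (intro holomorphic_intros) (auto simp: sector_def)
    have "(\<lambda>w. Q (w + l2)) holomorphic_on ?T"
    proof -
      have "Q \<circ> (\<lambda>w. w + l2) holomorphic_on ?T"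
        by (rule holomorphic_on_compose_gen[OF _ Q_hol]) (auto simp: l2_def intro!: holomorphic_intros)
      then show ?thesis by (simp add: o_def)
    qed
    then have "G holomorphic_on ?T" unfolding G_def by (intro holomorphic_intros Q_hol)
    then have "G \<circ> Ln holomorphic_on sector \<sigma>"
      by (rule holomorphic_on_compose_gen[OF Lh]) (use Im_Ln_T in auto)
    then show ?thesis by (simp add: g_def[abs_def] o_def)
  qed
  \<comment> \<open>\<open>K\<close> and \<open>L\<close> bound the two factors of \<open>P\<close>,
    \<open>exp (e * ln 2)\<close> pays for moving by at most ln 2 along the segment, and
    \<open>ln 2\<close> is its length.\<close>
  define K' where "K' = K * L * exp (e * ln 2) * ln 2"
  have G_le: "cmod (G w) \<le> K' * exp (- e * \<bar>Re w\<bar>) * cmod (dil (2 powi (- d)) \<psi> (exp w))"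
    if w: "\<bar>Im w\<bar> < \<sigma>" for w
  proof -
    let ?B = "K * (L * cmod (dil (2 powi (- d)) \<psi> (exp w))) * (exp (e * ln 2) * exp (- e * \<bar>Re w\<bar>))"
    have "cmod (Q (w + l2) - Q w) \<le> ?B * cmod (w + l2 - w)"
    proof (rule Q_diff)
      fix u assume "u \<in> closed_segment w (w + l2)"
      then obtain s where s: "0 \<le> s" "s \<le> 1" "u = w + of_real (s * ln 2)"
        by (auto simp: closed_segment_def l2_def scaleR_conv_of_real algebra_simps)
      have u: "\<bar>Im u\<bar> < \<sigma>" using w s by simp
      \<comment> \<open>The points of the segment from w to w + ln 2 correspond to the dilates by t
        in [1, 2], the range covered by \<open>dom\<close>.\<close>
      have st: "exp (s * ln 2) \<in> {1..2::real}"
      proof -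
        have "s * ln 2 \<le> 1 * ln (2::real)" using s by (intro mult_right_mono) auto
        then have "exp (s * ln 2) \<le> exp (ln (2::real))" unfolding exp_le_cancel_iff by simp
        then have "exp (s * ln 2) \<le> 2" by (simp only: exp_ln)
        with s show ?thesis by simp
      qed
      have psi: "cmod (\<psi> (exp u)) \<le> L * cmod (dil (2 powi (- d)) \<psi> (exp w))"
        using dom[OF st exp_in_sector[OF \<sigma> w]] by (simp add: dil_exp s(3))
      moreover have "exp (- e * \<bar>Re u\<bar>) \<le> exp (e * ln 2) * exp (- e * \<bar>Re w\<bar>)"
      proof -
        have "0 \<le> s * ln 2" "s * ln 2 \<le> ln 2" using s by (auto simp: mult_left_le_one_le)
        moreover have "Re u = Re w + s * ln 2" using s(3) by simp
        ultimately have "\<bar>Re w\<bar> \<le> \<bar>Re u\<bar> + ln 2" by linarith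
        then have "e * \<bar>Re w\<bar> \<le> e * (\<bar>Re u\<bar> + ln 2)" using e by (intro mult_left_mono) auto
        then show ?thesis by (simp add: exp_add[symmetric] algebra_simps)
      qed
      ultimately have "K * cmod (\<psi> (exp u)) * exp (- e * \<bar>Re u\<bar>) \<le> ?B"
        using K order_trans[OF norm_ge_zero psi]
        by (intro mult_mono mult_left_mono mult_nonneg_nonneg[OF K]) (auto simp: psi)
      with P_le[OF u] u show "\<bar>Im u\<bar> < \<sigma> \<and> cmod (P u) \<le> ?B" by linarith
    qed
    then show ?thesis by (simp add: G_def l2_def K'_def mult_ac)
  qed
  have G_le2: "cmod (G (of_real x)) \<le> K\<^sup>2 * ln 2 * exp (e * ln 2) * exp (- e * \<bar>x\<bar>)" for x
  proof -
    have "cmod (Q (of_real x + l2) - Q (of_real x)) \<le> (K\<^sup>2 * (exp (e * ln 2) * exp (- e * \<bar>x\<bar>))) * cmod (of_real x + l2 - of_real x)"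
    proof (rule Q_diff)
      fix u assume "u \<in> closed_segment (of_real x) (of_real x + l2)"
      then obtain s where s: "0 \<le> s" "s \<le> 1" "u = of_real (x + s * ln 2)"
        by (auto simp: closed_segment_def l2_def scaleR_conv_of_real algebra_simps)
      have u: "\<bar>Im u\<bar> < \<sigma>" using \<sigma> s by simp
      have "0 \<le> s * ln 2" "s * ln 2 \<le> ln 2" using s by (auto simp: mult_left_le_one_le)
      moreover have "Re u = x + s * ln 2" using s(3) by simp
      ultimately have "\<bar>x\<bar> \<le> \<bar>Re u\<bar> + ln 2" by linarith
      then have "e * \<bar>x\<bar> \<le> e * (\<bar>Re u\<bar> + ln 2)" using e by (intro mult_left_mono) auto
      then have "exp (- e * \<bar>Re u\<bar>) \<le> exp (e * ln 2) * exp (- e * \<bar>x\<bar>)"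
        by (simp add: exp_add[symmetric] algebra_simps)
      then have "K\<^sup>2 * exp (- e * \<bar>Re u\<bar>) \<le> K\<^sup>2 * (exp (e * ln 2) * exp (- e * \<bar>x\<bar>))"
        by (intro mult_left_mono) auto
      with P_le2[OF u] u show "\<bar>Im u\<bar> < \<sigma> \<and> cmod (P u) \<le> K\<^sup>2 * (exp (e * ln 2) * exp (- e * \<bar>x\<bar>))" by linarith
    qed
    then show ?thesis by (simp add: G_def l2_def mult_ac)
  qed
  have G_pos: "Re (G (of_real x)) > 0" for x
  proof -
    have "Re (Q (of_real x)) < Re (Q (of_real (x + ln 2)))"
    proof (rule DERIV_pos_imp_increasing[where f="\<lambda>y. Re (Q (of_real y))"])
      fix y :: real
      have y: "\<bar>Im (of_real y)\<bar> < \<sigma>" using \<sigma> by simp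
      have "((\<lambda>y. Q (of_real y)) has_vector_derivative P (of_real y)) (at y)"
        using field_vector_diff_chain_at[OF has_vector_derivative_of_real[OF DERIV_ident] Q[OF y]] by (simp add: o_def)
      then have "((\<lambda>y. Re (Q (of_real y))) has_real_derivative Re (P (of_real y))) (at y)"
        unfolding has_real_derivative_iff_has_vector_derivative
        by (rule bounded_linear.has_vector_derivative[OF bounded_linear_Re])
      moreover have "Re (P (of_real y)) > 0"
      proof -
        have "P (of_real y) = complex_of_real ((cmod (\<psi> (exp (of_real y))))\<^sup>2)"
          unfolding complex_norm_square by (simp add: P_def)
        then show ?thesis using nz[OF exp_in_sector[OF \<sigma> y]] by (simp only: Re_complex_of_real) simp
      qed
      ultimately show "\<exists>z. ((\<lambda>y. Re (Q (of_real y))) has_real_derivative z) (at y) \<and> z > 0" by blast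
    qed simp
    then show ?thesis by (simp add: G_def l2_def)
  qed
  define S where "S N w = (\<Sum>k = - int N..int N. G (w + of_int k * l2))" for N w
  have S_eq: "S N w = Q (w + of_nat (Suc N) * l2) - Q (w - of_nat N * l2)" for N w
  proof (induction N)
    case (Suc N)
    have "{- int (Suc N)..int (Suc N)} = insert (int (Suc N)) (insert (- int (Suc N)) {- int N..int N})" by auto
    then have "S (Suc N) w = G (w + of_nat (Suc N) * l2) + G (w - of_nat (Suc N) * l2) + S N w"
      by (simp add: S_def) (simp add: algebra_simps)
    also have "\<dots> = Q (w + of_nat (Suc (Suc N)) * l2) - Q (w - of_nat (Suc N) * l2)"
      unfolding Suc by (simp add: G_def algebra_simps)
    finally show ?case .
  qed (simp add: S_def G_def)
  \<comment> \<open>The indices i and -i are paired, so that the symmetric sums at w = 0 are partial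
    sums of an ordinary series with positive real parts.\<close>
  define a where "a i = (if i = 0 then G 0 else G (of_nat i * l2) + G (- of_nat i * l2))" for i :: nat
  define q where "q = exp (- e * ln 2)"
  have q: "0 < q" "q < 1" using e by (auto simp: q_def)
  have a_le: "cmod (a i) \<le> 2 * (K\<^sup>2 * ln 2 * exp (e * ln 2)) * q ^ i" for i
  proof -
    have qi: "exp (- e * (real i * ln 2)) = q ^ i" by (simp add: q_def exp_of_nat_mult[symmetric] mult_ac)
    have 1: "cmod (G (of_nat i * l2)) \<le> K\<^sup>2 * ln 2 * exp (e * ln 2) * q ^ i"
      using G_le2[of "real i * ln 2"] by (simp add: l2_def abs_mult qi[symmetric])
    have 2: "cmod (G (- of_nat i * l2)) \<le> K\<^sup>2 * ln 2 * exp (e * ln 2) * q ^ i"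
      using G_le2[of "- (real i * ln 2)"] by (simp add: l2_def abs_mult qi[symmetric])
    show ?thesis
    proof (cases "i = 0")
      case True
      have "b \<le> 2 * c" if "b \<le> c" "0 \<le> b" for b c :: real using that by linarith
      from this[OF 1] True show ?thesis by (simp add: a_def)
    next
      case False
      with 1 2 norm_triangle_ineq[of "G (of_nat i * l2)" "G (- of_nat i * l2)"] show ?thesis
        unfolding a_def by simp
    qed
  qed
  have a_sum: "summable a"
  proof (rule summable_comparison_test')
    show "summable (\<lambda>i. 2 * (K\<^sup>2 * ln 2 * exp (e * ln 2)) * q ^ i)"
      using q by (intro summable_mult summable_geometric) auto
  qed (rule a_le)
  have S_0: "S N 0 = (\<Sum>i\<le>N. a i)" for N
    unfolding S_def a_def sum_int_symmetric_interval[of "\<lambda>k. G (0 + of_int k * l2)" N]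
    by (rule sum.cong) auto
  define c where "c = suminf a"
  have S0_lim: "(\<lambda>N. S N 0) \<longlonglongrightarrow> c"
    unfolding S_0 c_def using summable_LIMSEQ'[OF a_sum] .
  have "Re c = (\<Sum>i. Re (a i))" unfolding c_def by (rule Re_suminf[OF a_sum])
  also have "\<dots> > 0"
  proof (rule suminf_pos)
    show "summable (\<lambda>i. Re (a i))" using summable_Re[OF a_sum] .
    show "0 < Re (a i)" for i
      using G_pos[of 0] G_pos[of "real i * ln 2"] G_pos[of "- (real i * ln 2)"] by (simp add: a_def l2_def)
  qed
  finally have c: "c \<noteq> 0" by auto
  have S_lim: "(\<lambda>N. S N w) \<longlonglongrightarrow> c" if w: "\<bar>Im w\<bar> < \<sigma>" for w
  proof -
    \<comment> \<open>The telescoped sum is a difference of two values of \<open>Q\<close> far out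
      on either side. Replacing 0 by w changes them by increments of \<open>Q\<close> over segments
      of length |w| near plus and minus infinity, which vanish; hence one limit for all w.\<close>
    have shift: "cmod (Q (w + of_real x) - Q (of_real x)) \<le> K\<^sup>2 * exp (e * cmod w) * exp (- e * \<bar>x\<bar>) * cmod w" for x
    proof -
      have "cmod (Q (w + of_real x) - Q (of_real x)) \<le> K\<^sup>2 * exp (e * cmod w) * exp (- e * \<bar>x\<bar>) * cmod (w + of_real x - of_real x)"
      proof (rule Q_diff)
        fix u assume "u \<in> closed_segment (of_real x) (w + of_real x)"
        then obtain s where s: "0 \<le> s" "s \<le> 1" "u = of_real x + of_real s * w"
          by (auto simp: closed_segment_def scaleR_conv_of_real algebra_simps)
        have "s * \<bar>Im w\<bar> \<le> \<bar>Im w\<bar>" "s * \<bar>Re w\<bar> \<le> \<bar>Re w\<bar>" using s by (auto simp: mult_left_le_one_le)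
        then have "\<bar>s * Im w\<bar> \<le> \<bar>Im w\<bar>" "\<bar>s * Re w\<bar> \<le> \<bar>Re w\<bar>" using s by (auto simp: abs_mult)
        moreover have "Im u = s * Im w" "Re u = x + s * Re w" using s(3) by auto
        ultimately have u: "\<bar>Im u\<bar> < \<sigma>" and "\<bar>x\<bar> \<le> \<bar>Re u\<bar> + cmod w"
          using w abs_Re_le_cmod[of w] by linarith+
        then have "e * \<bar>x\<bar> \<le> e * (\<bar>Re u\<bar> + cmod w)" using e by (intro mult_left_mono) auto
        then have "exp (- e * \<bar>Re u\<bar>) \<le> exp (e * cmod w) * exp (- e * \<bar>x\<bar>)"
          by (simp add: exp_add[symmetric] algebra_simps)
        then have "K\<^sup>2 * exp (- e * \<bar>Re u\<bar>) \<le> K\<^sup>2 * (exp (e * cmod w) * exp (- e * \<bar>x\<bar>))"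
          by (intro mult_left_mono) auto
        with P_le2[OF u] u show "\<bar>Im u\<bar> < \<sigma> \<and> cmod (P u) \<le> K\<^sup>2 * exp (e * cmod w) * exp (- e * \<bar>x\<bar>)"
          by (simp add: mult.assoc)
      qed
      then show ?thesis by simp
    qed
    have "(\<lambda>N. S N w - S N 0) \<longlonglongrightarrow> 0"
    proof (rule Lim_null_comparison[OF always_eventually])
      let ?C = "K\<^sup>2 * exp (e * cmod w)"
      show "\<forall>N. norm (S N w - S N 0) \<le> ?C * exp (- e * (real (Suc N) * ln 2)) * cmod w + ?C * exp (- e * (real N * ln 2)) * cmod w"
      proof
        fix N
        have "S N w - S N 0 = (Q (w + of_real (real (Suc N) * ln 2)) - Q (of_real (real (Suc N) * ln 2)))
           - (Q (w + of_real (- (real N * ln 2))) - Q (of_real (- (real N * ln 2))))"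
          by (simp add: S_eq l2_def)
        also have "norm \<dots> \<le> ?C * exp (- e * \<bar>real (Suc N) * ln 2\<bar>) * cmod w + ?C * exp (- e * \<bar>- (real N * ln 2)\<bar>) * cmod w"
          by (intro order_trans[OF norm_triangle_ineq4] add_mono shift)
        finally show "norm (S N w - S N 0) \<le> ?C * exp (- e * (real (Suc N) * ln 2)) * cmod w + ?C * exp (- e * (real N * ln 2)) * cmod w"
          by (simp add: abs_mult)
      qed
      have "(\<lambda>N. exp (- e * (real (Suc N) * ln 2))) \<longlonglongrightarrow> 0" "(\<lambda>N. exp (- e * (real N * ln 2))) \<longlonglongrightarrow> 0"
        using e by real_asymp+
      then have "(\<lambda>N. ?C * exp (- e * (real (Suc N) * ln 2)) * cmod w + ?C * exp (- e * (real N * ln 2)) * cmod w) \<longlonglongrightarrow> ?C * 0 * cmod w + ?C * 0 * cmod w"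
        by (intro tendsto_intros)
      then show "(\<lambda>N. ?C * exp (- e * (real (Suc N) * ln 2)) * cmod w + ?C * exp (- e * (real N * ln 2)) * cmod w) \<longlonglongrightarrow> 0"
        by simp
    qed
    from tendsto_add[OF this S0_lim] show ?thesis by simp
  qed
  show ?thesis
  proof (rule that[OF g_hol c, of K'])
    show "cmod (g (exp w)) \<le> K' * exp (- e * \<bar>Re w\<bar>) * cmod (dil (2 powi (- d)) \<psi> (exp w))" if "\<bar>Im w\<bar> < \<sigma>" for w
      unfolding g_exp[OF that] by (rule G_le[OF that])
    show "(\<lambda>N. \<Sum>k = - int N..int N. dil (2 powi k) g z) \<longlonglongrightarrow> c" if z: "z \<in> sector \<sigma>" for z
    proof -
      obtain w where w: "z = exp w" "\<bar>Im w\<bar> < \<sigma>" using z sector_eq_exp_image[OF \<sigma>] by auto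
      show ?thesis using S_lim[OF w(2)] by (simp add: S_def w(1) dil_g[OF w(2)])
    qed
  qed
qed

lemma H_inf_norm_upper:
  assumes "f \<in> H_inf \<sigma>" "z \<in> sector \<sigma>" shows "cmod (f z) \<le> H_inf_norm \<sigma> f"
proof -
  have "bdd_above ((\<lambda>z. cmod (f z)) ` sector \<sigma>)"
    using assms(1) by (auto simp: H_inf_def bounded_iff bdd_above_def)
  then show ?thesis unfolding H_inf_norm_def using assms(2) by (rule cSUP_upper[rotated])
qed

section \<open>Limits in the calculus, the dyadic series and f(A)\<close>

context sectorial_resolvent
begin

lemma line_decays_add:
  assumes "line_decays \<nu> e K a \<phi>" "line_decays \<nu> e K' a \<psi>"
  shows "line_decays \<nu> e (K + K') a (\<lambda>z. \<phi> z + \<psi> z)"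
  using assms unfolding line_decays_def distrib_right
  by (auto intro!: continuous_intros order_trans[OF norm_triangle_ineq add_mono])

lemma line_decays_cmult:
  assumes "line_decays \<nu> e K a \<phi>"
  shows "line_decays \<nu> e (cmod c * K) a (\<lambda>z. c * \<phi> z)"
  using assms unfolding line_decays_def
  by (auto intro!: continuous_intros mult_left_mono simp: norm_mult mult.assoc)

lemma calc_sum:
  assumes \<nu>: "\<omega> < \<nu>" "\<nu> \<le> pi" and e: "e > 0" and "finite S" "\<And>k. k \<in> S \<Longrightarrow> line_decays \<nu> e (K k) a (\<phi> k)"
  shows "line_decays \<nu> e (\<Sum>k\<in>S. K k) a (\<lambda>z. \<Sum>k\<in>S. \<phi> k z) \<and>
    calc \<nu> (\<lambda>z. \<Sum>k\<in>S. \<phi> k z) x = (\<Sum>k\<in>S. calc \<nu> (\<phi> k) x)"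
  using assms(4,5)
proof (induction S rule: finite_induct)
  case empty
  then show ?case by (simp add: line_decays_def calc_def)
next
  case (insert k S)
  then have IH: "line_decays \<nu> e (\<Sum>k\<in>S. K k) a (\<lambda>z. \<Sum>k\<in>S. \<phi> k z)"
      "calc \<nu> (\<lambda>z. \<Sum>k\<in>S. \<phi> k z) x = (\<Sum>k\<in>S. calc \<nu> (\<phi> k) x)"
    and k: "line_decays \<nu> e (K k) a (\<phi> k)" by auto
  show ?case
    using insert.hyps line_decays_add[OF k IH(1)] calc_add[OF \<nu> k e IH(1) e] IH(2) by simp
qed

text \<open>Dominated convergence is applied to the moduli of the scalar differences; the vector
  factor is bounded by \<open>M * norm x\<close>.\<close>

lemma calc_tendsto:
  assumes \<nu>: "\<omega> < \<nu>" "\<nu> \<le> pi" and e: "e > 0"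
    and \<phi>n: "\<And>n. line_decays \<nu> e K a (\<phi>n n)" and \<phi>: "line_decays \<nu> e K' a \<phi>"
    and lim: "\<And>y u. y \<in> {\<nu>, -\<nu>} \<Longrightarrow> (\<lambda>n. \<phi>n n (exp (Complex u y))) \<longlonglongrightarrow> \<phi> (exp (Complex u y))"
  shows "(\<lambda>n. calc \<nu> (\<phi>n n) x) \<longlonglongrightarrow> calc \<nu> \<phi> x"
proof -
  let ?I = "\<lambda>\<phi> y. integral UNIV (\<lambda>u. \<phi> (exp (Complex u y)) *\<^sub>C zR (Complex u y) x)"
  have I: "(\<lambda>n. ?I (\<phi>n n) y) \<longlonglongrightarrow> ?I \<phi> y" if y: "y \<in> {\<nu>, -\<nu>}" for y
  proof -
    let ?d = "\<lambda>n u. cmod (\<phi>n n (exp (Complex u y)) - \<phi> (exp (Complex u y)))"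
    note \<phi>n_y = bspec[OF \<phi>n[unfolded line_decays_def] y] and \<phi>_y = bspec[OF \<phi>[unfolded line_decays_def] y]
    have d_le: "?d n u \<le> (K + K') * exp (- e * \<bar>u + a\<bar>)" for n u
      using \<phi>n_y \<phi>_y unfolding distrib_right by (intro order_trans[OF norm_triangle_ineq4] add_mono) auto
    have d_int: "?d n integrable_on UNIV" for n
      by (rule exp_decay_integrable[OF _ e, where K="K + K'" and a=a]) (use \<phi>n_y \<phi>_y d_le in \<open>auto intro!: continuous_intros\<close>)
    have "(\<lambda>n. integral UNIV (?d n)) \<longlonglongrightarrow> integral UNIV (\<lambda>u :: real. 0 :: real)"
    proof (rule Equivalence_Lebesgue_Henstock_Integration.dominated_convergence(2)[where h="\<lambda>u. (K + K') * exp (- e * \<bar>u + a\<bar>)"])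
      show "(\<lambda>u. (K + K') * exp (- e * \<bar>u + a\<bar>)) integrable_on UNIV"
        using has_integral_integrable[OF has_integral_mult_right[OF has_integral_exp_abs[OF e]]] .
      show "(\<lambda>n. ?d n u) \<longlonglongrightarrow> 0" for u
        using tendsto_norm_zero[OF LIM_zero[OF lim[OF y, of u]]] .
    qed (use d_int d_le in auto)
    then have "(\<lambda>n. integral UNIV (?d n) * (M * norm x)) \<longlonglongrightarrow> 0 * (M * norm x)"
      by (intro tendsto_mult tendsto_const) simp
    then have lim0: "(\<lambda>n. integral UNIV (?d n) * (M * norm x)) \<longlonglongrightarrow> 0" by simp
    have "(\<lambda>n. ?I (\<phi>n n) y - ?I \<phi> y) \<longlonglongrightarrow> 0"
    proof (rule Lim_null_comparison[OF always_eventually lim0], rule allI)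
      fix n
      note i1 = calc_integrable[OF \<nu> \<phi>n e y, of n x] and i2 = calc_integrable[OF \<nu> \<phi> e y, of x]
      have "norm (?I (\<phi>n n) y - ?I \<phi> y) = norm (integral UNIV (\<lambda>u. \<phi>n n (exp (Complex u y)) *\<^sub>C zR (Complex u y) x - \<phi> (exp (Complex u y)) *\<^sub>C zR (Complex u y) x))"
        by (simp add: integral_diff[OF i1 i2])
      also have "\<dots> \<le> integral UNIV (\<lambda>u. ?d n u * (M * norm x))"
      proof (rule integral_norm_bound_integral[OF integrable_diff[OF i1 i2]])
        show "(\<lambda>u. ?d n u * (M * norm x)) integrable_on UNIV"
          using integrable_on_mult_left[OF d_int] .
        fix u
        have "norm (zR (Complex u y) x) \<le> M * norm x"
          by (rule norm_zR_le) (use \<nu>_region[OF \<nu> y] in simp)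
        then show "norm (\<phi>n n (exp (Complex u y)) *\<^sub>C zR (Complex u y) x - \<phi> (exp (Complex u y)) *\<^sub>C zR (Complex u y) x) \<le> ?d n u * (M * norm x)"
          unfolding scaleC.diff_left[symmetric] norm_scaleC by (intro mult_left_mono) auto
      qed
      also have "\<dots> = integral UNIV (?d n) * (M * norm x)" by (rule integral_mult_left)
      finally show "norm (?I (\<phi>n n) y - ?I \<phi> y) \<le> integral UNIV (?d n) * (M * norm x)" .
    qed
    then show ?thesis by (rule LIM_zero_cancel)
  qed
  show ?thesis
    unfolding calc_def by (intro tendsto_diff I bounded_linear.tendsto[OF scaleC.bounded_linear_right]) auto
qed

text \<open>\<open>F\<close> is centred at Re w = - j ln 2 and \<open>G k\<close> at - k ln 2. Half
  of the rate pays for the distance of the centres, which makes q = 2^(-e / 2), and half keeps the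
  product integrable. The \<open>v k\<close> have the right sum because psi(2^(k - d) .) times
  \<open>G k\<close> is g(2^k .).\<close>

lemma calc_dyadic_series:
  assumes \<phi>: "\<phi> \<in> H0_inf \<sigma>" and \<psi>: "\<psi> \<in> Phi_class \<sigma>" and \<nu>: "\<omega> < \<nu>" "\<nu> < \<sigma>" "\<sigma> \<le> pi"
  obtains d :: int and C q where "C \<ge> 0" "0 < q" "q < 1"
    "\<And>f j x. f \<in> H_inf \<sigma> \<Longrightarrow> \<exists>v.
       (\<lambda>N. \<Sum>k = - int N..int N. v k) \<longlonglongrightarrow> calc \<nu> (\<lambda>z. f z * dil (2 powi j) \<phi> z) x \<and>
       (\<forall>k. norm (v k) \<le> C * H_inf_norm \<sigma> f * q ^ nat \<bar>j - k\<bar> * norm (calc \<nu> (dil (2 powi (k - d)) \<psi>) x))"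
proof -
  have \<sigma>: "0 < \<sigma>" and \<nu>0: "0 < \<nu>" "\<nu> \<le> pi" using \<nu> \<omega> by auto
  obtain e1 K1 where e1: "e1 > 0" and \<phi>1: "decays \<sigma> e1 K1 0 \<phi>" by (rule H0_inf_decays[OF \<phi> \<sigma> \<nu>(3)])
  have \<psi>H0: "\<psi> \<in> H0_inf \<sigma>" and nz: "\<And>z. z \<in> sector \<sigma> \<Longrightarrow> \<psi> z \<noteq> 0" using \<psi> by (auto simp: Phi_class_def)
  obtain e2 K2 where e2: "e2 > 0" and \<psi>2: "decays \<sigma> e2 K2 0 \<psi>" by (rule H0_inf_decays[OF \<psi>H0 \<sigma> \<nu>(3)])
  define e where "e = min e1 e2"
  have e: "e > 0" using e1 e2 by (simp add: e_def)
  have \<phi>d: "decays \<sigma> e K1 0 \<phi>" by (rule decays_weaken[OF \<phi>1 \<sigma>]) (use \<sigma> in \<open>auto simp: e_def\<close>)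
  have \<psi>d: "decays \<sigma> e K2 0 \<psi>" by (rule decays_weaken[OF \<psi>2 \<sigma>]) (use \<sigma> in \<open>auto simp: e_def\<close>)
  note K1 = decays_nonneg[OF \<phi>d \<sigma>] and K2 = decays_nonneg[OF \<psi>d \<sigma>]
  have nz_dil: "dil r \<psi> z \<noteq> 0" if "z \<in> sector \<sigma>" "r > 0" for r z
    using nz[OF dil_in_sector[OF that \<sigma> \<nu>(3)]] by (simp add: dil_def)
  obtain d e' K' L where cm: "\<And>j t. t \<in> {1..2} \<Longrightarrow> comparable_multiplier \<sigma> e' K' L (\<lambda>z. dil (2 powi j * t) \<psi> z / dil (2 powi (j - d)) \<psi> z)"
    by (rule Phi_class_multipliers[OF \<psi> \<sigma> \<nu>(3)]) blast
  have dom: "cmod (dil t \<psi> z) \<le> L * cmod (dil (2 powi (- d)) \<psi> z)" if "t \<in> {1..2}" "z \<in> sector \<sigma>" for t z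
  proof -
    have "cmod (dil t \<psi> z / dil (2 powi (- d)) \<psi> z) \<le> L"
      using cm[OF that(1), of 0] that(2) unfolding comparable_multiplier_def by simp
    then show ?thesis using nz_dil[OF that(2), of "2 powi (- d)"] by (simp add: norm_divide divide_le_eq)
  qed
  obtain g c B where g: "g holomorphic_on sector \<sigma>" and c: "c \<noteq> 0"
    and g_le: "\<And>w. \<bar>Im w\<bar> < \<sigma> \<Longrightarrow> cmod (g (exp w)) \<le> B * exp (- e * \<bar>Re w\<bar>) * cmod (dil (2 powi (- d)) \<psi> (exp w))"
    and g_lim: "\<And>z. z \<in> sector \<sigma> \<Longrightarrow> (\<lambda>N. \<Sum>k = - int N..int N. dil (2 powi k) g z) \<longlonglongrightarrow> c"
    by (rule dyadic_partition[OF \<psi>d e \<sigma> \<nu>(3) nz dom]) blast+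
  have B: "B \<ge> 0"
  proof -
    have "0 \<le> B * exp (- e * \<bar>Re 0\<bar>) * cmod (dil (2 powi (- d)) \<psi> (exp 0))"
      by (rule order_trans[OF norm_ge_zero g_le]) (use \<sigma> in simp)
    moreover have "cmod (dil (2 powi (- d)) \<psi> (exp 0)) > 0"
      using nz_dil[of "exp 0" "2 powi (- d)"] exp_in_sector[OF \<sigma> \<nu>(3), of 0] \<sigma> by auto
    ultimately show ?thesis by (simp add: zero_le_mult_iff)
  qed
  define q where "q = exp (- (e / 2) * ln 2)"
  have q: "0 < q" "q < 1" using e by (auto simp: q_def)
  define gk where "gk k = dil (2 powi k) g" for k
  define G where "G k z = gk k z / dil (2 powi (k - d)) \<psi> z" for k z
  have gk_hol: "gk k holomorphic_on sector \<sigma>" for k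
  proof -
    have "g \<circ> (\<lambda>z. complex_of_real (2 powi k) * z) holomorphic_on sector \<sigma>"
      by (rule holomorphic_on_compose_gen[OF _ g]) (use dil_in_sector[OF _ _ \<sigma> \<nu>(3), of _ "2 powi k"] in \<open>auto intro!: holomorphic_intros\<close>)
    then show ?thesis by (simp add: gk_def dil_def[abs_def] o_def)
  qed
  note \<psi>dil = decays_dil[OF \<psi>d _ \<sigma> \<nu>(3)]
  have G_hol: "G k holomorphic_on sector \<sigma>" for k
    unfolding G_def using nz_dil by (intro holomorphic_intros gk_hol decaysD(1)[OF \<psi>dil]) auto
  have G_le: "cmod (G k (exp w)) \<le> B * exp (- e * \<bar>Re w + real_of_int k * ln 2\<bar>)" if w: "\<bar>Im w\<bar> < \<sigma>" for k w
  proof -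
    have "dil (2 powi (- d)) \<psi> (exp (w + of_real (real_of_int k * ln 2))) = dil (2 powi (k - d)) \<psi> (exp w)"
      by (simp add: dil_exp ln_two_powi algebra_simps)
    then have "cmod (gk k (exp w)) \<le> B * exp (- e * \<bar>Re w + real_of_int k * ln 2\<bar>) * cmod (dil (2 powi (k - d)) \<psi> (exp w))"
      using g_le[of "w + of_real (real_of_int k * ln 2)"] w by (simp add: gk_def dil_exp ln_two_powi)
    moreover have "cmod (dil (2 powi (k - d)) \<psi> (exp w)) > 0"
      using nz_dil[OF exp_in_sector[OF \<sigma> \<nu>(3) w], of "2 powi (k - d)"] by simp
    ultimately show ?thesis by (simp add: G_def norm_divide divide_le_eq)
  qed
  \<comment> \<open>From \<open>norm_calc_le\<close> at the halved rate, 2 K1 B M / (pi (e / 2)),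
    divided by |c|.\<close>
  define C where "C = 4 * K1 * B * M / (cmod c * pi * e)"
  have C: "C \<ge> 0" unfolding C_def using K1 B M e by auto
  show ?thesis
  proof (rule that[OF C q, of d])
    fix f j x assume f: "f \<in> H_inf \<sigma>"
    define n where "n = H_inf_norm \<sigma> f"
    note fn = H_inf_norm_upper[OF f, folded n_def]
    have n: "n \<ge> 0" using order_trans[OF norm_ge_zero fn[OF exp_in_sector[OF \<sigma> \<nu>(3), of 0]]] \<sigma> by simp
    have f_hol: "f holomorphic_on sector \<sigma>" using f by (simp add: H_inf_def)
    define a where "a = real_of_int j * ln 2"
    define F where "F z = f z * dil (2 powi j) \<phi> z" for z
    have F: "decays \<sigma> e (n * K1) a F"
      using decays_mult_bounded[OF decays_dil[OF \<phi>d _ \<sigma> \<nu>(3)] \<sigma> \<nu>(3) f_hol fn, of "2 powi j"]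
      by (simp add: F_def[abs_def] a_def ln_two_powi)
    define Q where "Q k = n * K1 * B * q ^ nat \<bar>j - k\<bar>" for k
    have FG: "decays \<sigma> (e / 2) (Q k) a (\<lambda>z. F z * G k z)" for k
      unfolding decays_def
    proof (intro conjI allI impI)
      show "(\<lambda>z. F z * G k z) holomorphic_on sector \<sigma>" by (intro holomorphic_intros decaysD(1)[OF F] G_hol)
      fix w assume w: "\<bar>Im w\<bar> < \<sigma>"
      let ?b = "real_of_int k * ln 2"
      have "cmod (F (exp w)) * cmod (G k (exp w)) \<le> (n * K1 * exp (- e * \<bar>Re w + a\<bar>)) * (B * exp (- e * \<bar>Re w + ?b\<bar>))"
        using n K1 by (intro mult_mono G_le decaysD(2)[OF F] w) auto
      also have "\<dots> = n * K1 * B * exp (- e * \<bar>Re w + a\<bar> + - e * \<bar>Re w + ?b\<bar>)" unfolding exp_add by simp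
      also have "\<dots> \<le> n * K1 * B * exp (- (e / 2) * \<bar>a - ?b\<bar> + - (e / 2) * \<bar>Re w + a\<bar>)"
      proof -
        \<comment> \<open>The triangle inequality through - Re w, with one further |Re w + a| on
          both sides.\<close>
        have "\<bar>a - ?b\<bar> + \<bar>Re w + a\<bar> \<le> 2 * (\<bar>Re w + a\<bar> + \<bar>Re w + ?b\<bar>)"
        proof -
          have "\<bar>r - s\<bar> + \<bar>t + r\<bar> \<le> 2 * (\<bar>t + r\<bar> + \<bar>t + s\<bar>)" for r s t :: real by (smt (verit))
          then show ?thesis .
        qed
        then have "e / 2 * (\<bar>a - ?b\<bar> + \<bar>Re w + a\<bar>) \<le> e / 2 * (2 * (\<bar>Re w + a\<bar> + \<bar>Re w + ?b\<bar>))"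
          using e by (intro mult_left_mono) auto
        then show ?thesis using n K1 B by (intro mult_left_mono) (auto simp: algebra_simps)
      qed
      also have "exp (- (e / 2) * \<bar>a - ?b\<bar> + - (e / 2) * \<bar>Re w + a\<bar>) = q ^ nat \<bar>j - k\<bar> * exp (- (e / 2) * \<bar>Re w + a\<bar>)"
      proof -
        have "a - ?b = real_of_int (j - k) * ln 2" by (simp add: a_def algebra_simps)
        then have "\<bar>a - ?b\<bar> = real (nat \<bar>j - k\<bar>) * ln 2" by (simp add: abs_mult)
        then have "exp (- (e / 2) * \<bar>a - ?b\<bar>) = q ^ nat \<bar>j - k\<bar>"
          unfolding q_def exp_of_nat_mult[symmetric] by (simp add: mult_ac)
        then show ?thesis by (simp only: exp_add)
      qed
      finally show "cmod (F (exp w) * G k (exp w)) \<le> Q k * exp (- (e / 2) * \<bar>Re w + a\<bar>)"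
        by (simp add: norm_mult Q_def mult_ac)
    qed
    have \<psi>_le: "cmod (dil (2 powi k) \<psi> z) \<le> K2" if z: "z \<in> sector \<sigma>" for k z
    proof -
      obtain w where w: "z = exp w" "\<bar>Im w\<bar> < \<sigma>" using z sector_eq_exp_image[OF \<sigma> \<nu>(3)] by auto
      have "cmod (dil (2 powi k) \<psi> z) \<le> K2 * exp (- e * \<bar>Re w + (0 + ln (2 powi k))\<bar>)"
        unfolding w(1) by (rule decaysD(2)[OF \<psi>dil w(2)]) simp
      also have "\<dots> \<le> K2 * 1" using K2 e by (intro mult_left_mono) auto
      finally show ?thesis by simp
    qed
    have Fg_eq: "F z * gk k z = dil (2 powi (k - d)) \<psi> z * (F z * G k z)" if "z \<in> sector \<sigma>" for z k
      using nz_dil[OF that, of "2 powi (k - d)"] by (simp add: G_def)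
    have Fg: "line_decays \<nu> (e / 2) (K2 * Q k) a (\<lambda>z. dil (2 powi (k - d)) \<psi> z * (F z * G k z))" for k
      by (rule decays_imp_line_decays[OF decays_mult_bounded[OF FG \<sigma> \<nu>(3) decaysD(1)[OF \<psi>dil] \<psi>_le] \<nu>0(1) \<nu>(2,3)]) simp
    define v where "v k = (1 / c) *\<^sub>C calc \<nu> (\<lambda>z. dil (2 powi (k - d)) \<psi> z * (F z * G k z)) x" for k
    have v_le: "norm (v k) \<le> C * n * q ^ nat \<bar>j - k\<bar> * norm (calc \<nu> (dil (2 powi (k - d)) \<psi>) x)" for k
    proof -
      have "calc \<nu> (\<lambda>z. dil (2 powi (k - d)) \<psi> z * (F z * G k z)) x = calc \<nu> (\<lambda>z. F z * G k z) (calc \<nu> (dil (2 powi (k - d)) \<psi>) x)"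
        using calc_calc[OF \<psi>dil e FG _ \<nu>, of "2 powi (k - d)" k x] e by (simp add: mult_ac)
      then have "norm (v k) \<le> 1 / cmod c * (2 * Q k * M / (pi * (e / 2)) * norm (calc \<nu> (dil (2 powi (k - d)) \<psi>) x))"
        unfolding v_def norm_scaleC norm_divide norm_one
        using norm_calc_le[OF \<nu>(1) \<nu>0(2) decays_imp_line_decays[OF FG \<nu>0(1) \<nu>(2,3)]] e
        by (intro mult_left_mono) auto
      also have "\<dots> = C * n * q ^ nat \<bar>j - k\<bar> * norm (calc \<nu> (dil (2 powi (k - d)) \<psi>) x)"
        using e c by (simp add: C_def Q_def field_simps)
      finally show ?thesis .
    qed
    have "(\<lambda>N. calc \<nu> (\<lambda>z. \<Sum>k = - int N..int N. dil (2 powi (k - d)) \<psi> z * (F z * G k z)) x) \<longlonglongrightarrow> calc \<nu> (\<lambda>z. c * F z) x"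
    proof (rule calc_tendsto[OF \<nu>(1) \<nu>0(2)])
      show "e / 2 > 0" using e by simp
      have F': "decays \<sigma> (e / 2) (n * K1) a F" by (rule decays_weaken[OF F \<sigma>]) (use e \<sigma> in auto)
      show "line_decays \<nu> (e / 2) (cmod c * (n * K1)) a (\<lambda>z. c * F z)"
        by (rule line_decays_cmult[OF decays_imp_line_decays[OF F' \<nu>0(1) \<nu>(2,3)]])
      \<comment> \<open>The bound must not depend on \<open>N\<close>, as it is the majorant for
        dominated convergence; the constants \<open>Q k\<close> add up to at most a geometric
        sum.\<close>
      show "line_decays \<nu> (e / 2) (K2 * (n * K1 * B) * (2 / (1 - q))) a (\<lambda>z. \<Sum>k = - int N..int N. dil (2 powi (k - d)) \<psi> z * (F z * G k z))" for N
      proof -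
        let ?S = "{- int N..int N}"
        have "(\<Sum>k\<in>?S. K2 * Q k) = K2 * (n * K1 * B) * (\<Sum>k\<in>?S. q ^ nat \<bar>j - k\<bar>)"
          by (simp add: Q_def sum_distrib_left mult_ac)
        also have "\<dots> \<le> K2 * (n * K1 * B) * (2 / (1 - q))"
          using K2 n K1 B q by (intro mult_left_mono sum_int_geometric_le) auto
        finally have le: "(\<Sum>k\<in>?S. K2 * Q k) \<le> K2 * (n * K1 * B) * (2 / (1 - q))" .
        have "line_decays \<nu> (e / 2) (\<Sum>k\<in>?S. K2 * Q k) a (\<lambda>z. \<Sum>k\<in>?S. dil (2 powi (k - d)) \<psi> z * (F z * G k z))"
          using calc_sum[OF \<nu>(1) \<nu>0(2) _ _ Fg, of ?S] e by simp
        then show ?thesis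
          unfolding line_decays_def using le by (meson exp_ge_zero mult_right_mono order_trans)
      qed
      show "(\<lambda>N. \<Sum>k = - int N..int N. dil (2 powi (k - d)) \<psi> (exp (Complex u y)) * (F (exp (Complex u y)) * G k (exp (Complex u y))))
          \<longlonglongrightarrow> c * F (exp (Complex u y))" if y: "y \<in> {\<nu>, - \<nu>}" for y u
      proof -
        let ?z = "exp (Complex u y)"
        have z: "?z \<in> sector \<sigma>" by (rule exp_in_sector[OF \<sigma> \<nu>(3)]) (use y \<nu> \<nu>0 in auto)
        have "(\<Sum>k = - int N..int N. dil (2 powi (k - d)) \<psi> ?z * (F ?z * G k ?z)) = (\<Sum>k = - int N..int N. gk k ?z) * F ?z" for N
          unfolding Fg_eq[OF z, symmetric] sum_distrib_right by (simp only: mult.commute)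
        then show ?thesis using tendsto_mult[OF g_lim[OF z] tendsto_const[of "F ?z"]] by (simp add: gk_def)
      qed
    qed
    then have "(\<lambda>N. (1 / c) *\<^sub>C calc \<nu> (\<lambda>z. \<Sum>k = - int N..int N. dil (2 powi (k - d)) \<psi> z * (F z * G k z)) x) \<longlonglongrightarrow> (1 / c) *\<^sub>C calc \<nu> (\<lambda>z. c * F z) x"
      by (rule bounded_linear.tendsto[OF scaleC.bounded_linear_right])
    moreover have "(1 / c) *\<^sub>C calc \<nu> (\<lambda>z. c * F z) x = calc \<nu> F x"
      using c by (simp add: calc_cmult[OF \<nu>(1) \<nu>0(2) decays_imp_line_decays[OF F \<nu>0(1) \<nu>(2,3)] e] scaleC_scaleC)
    moreover have "(1 / c) *\<^sub>C calc \<nu> (\<lambda>z. \<Sum>k = - int N..int N. dil (2 powi (k - d)) \<psi> z * (F z * G k z)) x = (\<Sum>k = - int N..int N. v k)" for N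
      using calc_sum[OF \<nu>(1) \<nu>0(2) _ _ Fg, where S="{- int N..int N}" and x=x] e by (simp add: v_def scaleC.sum_right)
    ultimately have "(\<lambda>N. \<Sum>k = - int N..int N. v k) \<longlonglongrightarrow> calc \<nu> (\<lambda>z. f z * dil (2 powi j) \<phi> z) x"
      by (simp add: F_def[abs_def])
    with v_le show "\<exists>v. (\<lambda>N. \<Sum>k = - int N..int N. v k) \<longlonglongrightarrow> calc \<nu> (\<lambda>z. f z * dil (2 powi j) \<phi> z) x \<and>
       (\<forall>k. norm (v k) \<le> C * H_inf_norm \<sigma> f * q ^ nat \<bar>j - k\<bar> * norm (calc \<nu> (dil (2 powi (k - d)) \<psi>) x))"
      unfolding n_def by blast
  qed
qed

text \<open>(rho f)(A) phi(A) x equals rho(A) (f phi)(A) x by two uses of \<open>calc_calc\<close>.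
  So the domain condition of \<open>H_calc\<close> holds, and since rho(A) is injective its inverse
  returns (f phi)(A) x.\<close>

lemma H_calc_calc:
  assumes \<nu>_def: "\<nu> = (SOME \<nu>. sectorial_angle A < \<nu> \<and> \<nu> < \<sigma>)" and \<nu>: "\<omega> < \<nu>" "\<nu> < \<sigma>" "\<sigma> \<le> pi"
    and inj: "inj_on A (dom A)" and f: "f \<in> H_inf \<sigma>" and \<phi>: "decays \<sigma> e K a \<phi>" "e > 0"
  shows "H_calc \<sigma> A f (calc \<nu> \<phi> x) = Some (calc \<nu> (\<lambda>z. f z * \<phi> z) x)"
proof -
  \<comment> \<open>The decay of rho is available on sectors of angle below pi, while sigma may
    equal pi.\<close>
  define \<tau> where "\<tau> = (\<nu> + \<sigma>) / 2"
  have \<tau>: "\<nu> < \<tau>" "\<tau> < pi" "0 < \<tau>" "0 < \<sigma>" "0 < \<nu>" "\<tau> \<le> pi" "\<tau> \<le> \<sigma>" "\<nu> \<le> pi" "\<nu> < pi" using \<nu> \<omega> by (auto simp: \<tau>_def)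
  have H0: "H0_calc \<sigma> A \<phi> = calc \<nu> \<phi>" for \<phi> unfolding \<nu>_def by (rule ext) (rule H0_calc_eq_calc)
  obtain K\<rho> where \<rho>: "decays \<tau> 1 K\<rho> 0 rho" using decays_rho[OF \<tau>(3,2)] by blast
  have f': "cmod (f z) \<le> H_inf_norm \<sigma> f" if "z \<in> sector \<tau>" for z
    using sector_mono[OF \<tau>(3,7)] that H_inf_norm_upper[OF f] by auto
  have f_hol: "f holomorphic_on sector \<tau>"
    using f sector_mono[OF \<tau>(3,7)] by (auto simp: H_inf_def intro: holomorphic_on_subset)
  have \<phi>': "decays \<tau> e K a \<phi>" by (rule decays_weaken[OF \<phi>(1) \<tau>(4)]) (use \<tau> in auto)
  have f\<rho>: "decays \<tau> 1 (H_inf_norm \<sigma> f * K\<rho>) 0 (\<lambda>z. f z * rho z)"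
    by (rule decays_mult_bounded[OF \<rho> \<tau>(3,6) f_hol f'])
  have f\<phi>: "decays \<tau> e (H_inf_norm \<sigma> f * K) a (\<lambda>z. f z * \<phi> z)"
    by (rule decays_mult_bounded[OF \<phi>' \<tau>(3,6) f_hol f'])
  let ?y = "calc \<nu> (\<lambda>z. f z * \<phi> z) x"
  have "calc \<nu> (\<lambda>z. rho z * f z) (calc \<nu> \<phi> x) = calc \<nu> rho ?y"
    using calc_calc[OF \<phi>' \<phi>(2) f\<rho> _ \<nu>(1) \<tau>(1,6), of x] calc_calc[OF f\<phi> \<phi>(2) \<rho> _ \<nu>(1) \<tau>(1,6), of x]
    by (simp add: mult_ac)
  moreover have "inj (calc \<nu> rho)"
  proof (rule injI)
    fix u v assume "calc \<nu> rho u = calc \<nu> rho v"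
    then have "calc \<nu> rho (u - v) = 0"
      using calc_diff_arg[OF \<nu>(1) \<tau>(8) decays_imp_line_decays[OF \<rho> \<tau>(5,1,6)]] by simp
    from calc_rho_eq_0_imp[OF \<nu>(1) \<tau>(9) inj this] show "u = v" by simp
  qed
  ultimately show ?thesis unfolding H_calc_def H0 by (simp add: Let_def inv_f_f)
qed

end

section \<open>Powers and sums with values in [0, infinity]\<close>

lemma ennreal_power_mono: "a \<le> b \<Longrightarrow> 0 \<le> p \<Longrightarrow> ennreal_power a p \<le> ennreal_power b p"
  by (auto simp: ennreal_power_def top_unique intro!: ennreal_leI powr_mono2 enn2real_mono simp: less_top)

lemma ennreal_power_cmult:
  assumes "0 \<le> c" "0 < p" shows "ennreal_power (ennreal c * a) p = ennreal (c powr p) * ennreal_power a p"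
proof (cases "c = 0 \<or> a = \<infinity>")
  case True
  then show ?thesis using assms by (auto simp: ennreal_power_def ennreal_mult_top ennreal_top_mult)
next
  case False
  then have "ennreal c * a \<noteq> \<infinity>" by (simp add: ennreal_mult_eq_top_iff)
  with False assms show ?thesis
    by (simp add: ennreal_power_def enn2real_mult powr_mult ennreal_mult)
qed

text \<open>Both sides are transported to the naturals, where they are the same series.\<close>

lemma infsum_int_eq_nn_integral:
  fixes f :: "int \<Rightarrow> ennreal"
  shows "(\<Sum>\<^sub>\<infinity>j\<in>UNIV. f j) = (\<integral>\<^sup>+j. f j \<partial>count_space UNIV)"
proof -
  have "(\<lambda>n. f (int_decode n)) sums (\<Sum>\<^sub>\<infinity>n\<in>UNIV. f (int_decode n))"
    by (intro has_sum_imp_sums has_sum_infsum nonneg_summable_on_complete) auto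
  then have "(\<Sum>\<^sub>\<infinity>n\<in>UNIV. f (int_decode n)) = (\<integral>\<^sup>+n. f (int_decode n) \<partial>count_space UNIV)"
    by (simp add: nn_integral_count_space_nat sums_iff)
  then show ?thesis
    using infsum_reindex_bij_betw[OF bij_int_decode, of f] nn_integral_bij_count_space[OF bij_int_decode, of f] by simp
qed

lemma nn_integral_int_shift:
  fixes f :: "int \<Rightarrow> ennreal"
  shows "(\<integral>\<^sup>+j. f (j - d) \<partial>count_space UNIV) = (\<integral>\<^sup>+j. f j \<partial>count_space UNIV)"
  by (rule nn_integral_bij_count_space) (auto intro!: bij_betwI[where g="\<lambda>j. j + d"])

section \<open>Discrete and continuous norms\<close>

lemma nn_integral_dyadic_interval:
  "(\<integral>\<^sup>+t. indicator {2 powi j..<2 powi (j + 1)} t * ennreal (1 / t) \<partial>lborel) = ennreal (ln 2)"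
proof -
  have less: "(0::real) < 2 powi j" "(2::real) powi j \<le> 2 powi (j + 1)" by (auto simp: power_int_add)
  have "(\<integral>\<^sup>+t. indicator {2 powi j..<2 powi (j + 1)} t * ennreal (1 / t) \<partial>lborel)
      = (\<integral>\<^sup>+t. ennreal (1 / t) * indicator {2 powi j..2 powi (j + 1)} t \<partial>lborel)"
    using AE_lborel_singleton[of "2 powi (j + 1) :: real"]
    by (intro nn_integral_cong_AE) (auto elim!: eventually_mono simp: indicator_def)
  also have "\<dots> = ennreal (ln (2 powi (j + 1)) - ln (2 powi j))"
  proof (rule nn_integral_FTC_Icc[where F=ln and f="\<lambda>t. 1 / t"])
    show "(ln has_real_derivative 1 / t) (at t)" "0 \<le> 1 / t" if "t \<in> {2 powi j..2 powi (j + 1)}" for t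
    proof -
      have "t > 0" using less(1) that by (meson atLeastAtMost_iff less_le_trans)
      then show "(ln has_real_derivative 1 / t) (at t)" "0 \<le> 1 / t" by (auto intro!: derivative_eq_intros)
    qed
  qed (use less in auto)
  also have "ln (2 powi (j + 1)) - ln ((2::real) powi j) = ln 2"
    by (simp add: ln_two_powi algebra_simps)
  finally show ?thesis .
qed

lemma floor_log_dyadic:
  assumes "t > 0"
  shows "t \<in> {2 powi j..<2 powi (j + 1)} \<longleftrightarrow> j = \<lfloor>log 2 t\<rfloor>"
proof -
  have "(2::real) powi k \<le> t \<longleftrightarrow> real_of_int k \<le> log 2 t" for k
    using assms by (simp add: powr_real_of_int'[symmetric] le_log_iff)
  from this[of j] this[of "j + 1"] have "t \<in> {2 powi j..<2 powi (j + 1)} \<longleftrightarrow> real_of_int j \<le> log 2 t \<and> log 2 t < real_of_int j + 1"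
    by (simp add: not_le[symmetric])
  then show ?thesis using floor_eq_iff[of "log 2 t" j] by auto
qed

text \<open>Each dyadic interval has mass ln 2 for dt / t, and the half-open intervals partition the
  half-line, so exactly one index contributes at each t.\<close>

lemma nn_integral_dyadic_step:
  fixes g :: "int \<Rightarrow> ennreal"
  shows "(\<integral>\<^sup>+t\<in>{0<..}. g \<lfloor>log 2 t\<rfloor> * ennreal (1 / t) \<partial>lborel) = ennreal (ln 2) * (\<integral>\<^sup>+j. g j \<partial>count_space UNIV)"
proof -
  have "(\<integral>\<^sup>+t\<in>{0<..}. g \<lfloor>log 2 t\<rfloor> * ennreal (1 / t) \<partial>lborel)
      = (\<integral>\<^sup>+t. \<integral>\<^sup>+j. g j * (indicator {2 powi j..<2 powi (j + 1)} t * ennreal (1 / t)) \<partial>count_space UNIV \<partial>lborel)"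
  proof (rule nn_integral_cong)
    fix t :: real
    show "g \<lfloor>log 2 t\<rfloor> * ennreal (1 / t) * indicator {0<..} t
        = (\<integral>\<^sup>+j. g j * (indicator {2 powi j..<2 powi (j + 1)} t * ennreal (1 / t)) \<partial>count_space UNIV)"
    proof (cases "t > 0")
      case True
      have "(\<integral>\<^sup>+j. g j * (indicator {2 powi j..<2 powi (j + 1)} t * ennreal (1 / t)) \<partial>count_space UNIV)
         = (\<integral>\<^sup>+j. (g j * ennreal (1 / t)) * indicator {\<lfloor>log 2 t\<rfloor>} j \<partial>count_space UNIV)"
        using floor_log_dyadic[OF True] by (intro nn_integral_cong) (auto simp: indicator_def)
      then show ?thesis using True by simp
    next
      case False
      have "t < 2 powi j" for j by (rule le_less_trans[of t 0]) (use False in auto)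
      then have "t \<notin> {2 powi j..<2 powi (j + 1)}" for j by (simp add: not_le)
      then show ?thesis using False by simp
    qed
  qed
  also have "\<dots> = (\<integral>\<^sup>+j. \<integral>\<^sup>+t. g j * (indicator {2 powi j..<2 powi (j + 1)} t * ennreal (1 / t)) \<partial>lborel \<partial>count_space UNIV)"
    by (rule nn_integral_count_space_nn_integral) auto
  also have "\<dots> = (\<integral>\<^sup>+j. g j * ennreal (ln 2) \<partial>count_space UNIV)"
    by (simp add: nn_integral_cmult nn_integral_dyadic_interval)
  also have "\<dots> = ennreal (ln 2) * (\<integral>\<^sup>+j. g j \<partial>count_space UNIV)"
    by (simp add: nn_integral_multc mult.commute)
  finally show ?thesis .
qed

lemma ge_one_ennreal_cases:
  fixes s :: ennreal
  assumes "1 \<le> s" obtains "s = \<infinity>" | "s \<noteq> \<infinity>" "1 \<le> enn2real s"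
  using assms by (cases s) (auto simp: ennreal_1[symmetric] simp del: ennreal_1)

lemma sum_norm_eq: "s \<noteq> \<infinity> \<Longrightarrow> sum_norm s u =
    ennreal_power (\<integral>\<^sup>+j. ennreal (norm (u j) powr enn2real s) \<partial>count_space UNIV) (1 / enn2real s)"
  by (simp add: sum_norm_def infsum_int_eq_nn_integral)

text \<open>\<open>u\<close> is arbitrary here, so its integral is only compared, by monotonicity,
  with that of a step function of floor (log 2 t). The comparison yields (ln 2)^(1/p) C and C (1 /
  ln 2)^(1/p); as ln 2 < 1 and p >= 1, both are at most C / ln 2, one constant for all s.\<close>

lemma
  fixes u :: "real \<Rightarrow> 'b::real_normed_vector"
  assumes s: "1 \<le> s" and C: "C > 0"
  shows int_norm_le_sum_norm: "(\<And>j t. t \<in> {1..2} \<Longrightarrow> norm (u (2 powi j * t)) \<le> C * norm (u (2 powi (j - d)))) \<Longrightarrow>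
      int_norm s u \<le> ennreal (C / ln 2) * sum_norm s (\<lambda>j. u (2 powi j))"
    and sum_norm_le_int_norm: "(\<And>j t. t \<in> {1..2} \<Longrightarrow> norm (u (2 powi (j + d))) \<le> C * norm (u (2 powi j * t))) \<Longrightarrow>
      sum_norm s (\<lambda>j. u (2 powi j)) \<le> ennreal (C / ln 2) * int_norm s u"
proof -
  have ln2: "0 < ln (2::real)" "ln (2::real) \<le> 1" using ln_2_less_1 by auto
  then have C2: "C \<le> C / ln 2" using C by (simp add: field_simps)
  have step: "t = 2 powi \<lfloor>log 2 t\<rfloor> * (t / 2 powi \<lfloor>log 2 t\<rfloor>)" "t / 2 powi \<lfloor>log 2 t\<rfloor> \<in> {1..2}" if "t > 0" for t :: real
    using floor_log_dyadic[OF that, of "\<lfloor>log 2 t\<rfloor>"] by (auto simp: field_simps power_int_add)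
  define p where "p = enn2real s"
  let ?a = "\<lambda>j. ennreal (norm (u (2 powi j)) powr p)"
  {
    assume le: "\<And>j t. t \<in> {1..2} \<Longrightarrow> norm (u (2 powi j * t)) \<le> C * norm (u (2 powi (j - d)))"
    have le': "norm (u t) \<le> C * norm (u (2 powi (\<lfloor>log 2 t\<rfloor> - d)))" if "t > 0" for t
      using le[OF step(2)[OF that], of "\<lfloor>log 2 t\<rfloor>"] step(1)[OF that] by simp
    from s show "int_norm s u \<le> ennreal (C / ln 2) * sum_norm s (\<lambda>j. u (2 powi j))"
    proof (cases rule: ge_one_ennreal_cases)
      case 1
      have "ennreal (norm (u t)) \<le> ennreal (C / ln 2) * (SUP j. ennreal (norm (u (2 powi j))))" if "t > 0" for t
      proof -
        have "ennreal (norm (u t)) \<le> ennreal C * ennreal (norm (u (2 powi (\<lfloor>log 2 t\<rfloor> - d))))"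
          using le'[OF that] C by (simp add: ennreal_mult[symmetric] ennreal_leI)
        also have "\<dots> \<le> ennreal (C / ln 2) * (SUP j. ennreal (norm (u (2 powi j))))"
          using C2 by (intro mult_mono ennreal_leI SUP_upper) auto
        finally show ?thesis .
      qed
      with 1 show ?thesis by (auto simp: int_norm_def sum_norm_def intro!: SUP_least)
    next
      case 2
      then have p: "p \<ge> 1" by (simp add: p_def)
      have "(\<integral>\<^sup>+t\<in>{0<..}. ennreal (norm (u t) powr p / t) \<partial>lborel)
          \<le> (\<integral>\<^sup>+t\<in>{0<..}. (ennreal (C powr p) * ?a (\<lfloor>log 2 t\<rfloor> - d)) * ennreal (1 / t) \<partial>lborel)"
      proof (intro nn_integral_mono)
        fix t :: real
        have "norm (u t) powr p / t \<le> (C powr p * norm (u (2 powi (\<lfloor>log 2 t\<rfloor> - d))) powr p) * (1 / t)" if "t > 0"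
        proof -
          have "norm (u t) powr p \<le> (C * norm (u (2 powi (\<lfloor>log 2 t\<rfloor> - d)))) powr p"
            using le'[OF that] p by (intro powr_mono2) auto
          then show ?thesis using that C by (simp add: powr_mult divide_right_mono)
        qed
        then show "ennreal (norm (u t) powr p / t) * indicator {0<..} t
          \<le> (ennreal (C powr p) * ?a (\<lfloor>log 2 t\<rfloor> - d)) * ennreal (1 / t) * indicator {0<..} t"
          by (auto simp: indicator_def ennreal_mult[symmetric] intro!: ennreal_leI)
      qed
      also have "\<dots> = ennreal (ln 2) * (\<integral>\<^sup>+j. ennreal (C powr p) * ?a (j - d) \<partial>count_space UNIV)"
        by (rule nn_integral_dyadic_step)
      also have "\<dots> = ennreal (ln 2 * C powr p) * (\<integral>\<^sup>+j. ?a j \<partial>count_space UNIV)"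
        using ln2 by (simp add: nn_integral_cmult nn_integral_int_shift[of ?a] ennreal_mult mult.assoc)
      finally have "int_norm s u \<le> ennreal ((ln 2 * C powr p) powr (1 / p)) * sum_norm s (\<lambda>j. u (2 powi j))"
        using 2 p ln2 unfolding int_norm_def sum_norm_eq[OF 2(1)] p_def[symmetric]
        by (simp add: ennreal_power_cmult[symmetric] ennreal_power_mono)
      also have "(ln 2 * C powr p) powr (1 / p) \<le> C / ln 2"
      proof -
        have "(ln 2 * C powr p) powr (1 / p) = ln 2 powr (1 / p) * C"
          using p C ln2 by (simp add: powr_mult powr_powr)
        also have "\<dots> \<le> 1 * C" using C ln2 p by (intro mult_right_mono) (auto intro: powr_le1)
        finally show ?thesis using C2 by simp
      qed
      then have "ennreal ((ln 2 * C powr p) powr (1 / p)) * sum_norm s (\<lambda>j. u (2 powi j)) \<le> ennreal (C / ln 2) * sum_norm s (\<lambda>j. u (2 powi j))"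
        by (intro mult_right_mono ennreal_leI) auto
      finally show ?thesis .
    qed
  next
    assume le: "\<And>j t. t \<in> {1..2} \<Longrightarrow> norm (u (2 powi (j + d))) \<le> C * norm (u (2 powi j * t))"
    have le': "norm (u (2 powi (\<lfloor>log 2 t\<rfloor> + d))) \<le> C * norm (u t)" if "t > 0" for t
      using le[OF step(2)[OF that], of "\<lfloor>log 2 t\<rfloor>"] step(1)[OF that] by simp
    from s show "sum_norm s (\<lambda>j. u (2 powi j)) \<le> ennreal (C / ln 2) * int_norm s u"
    proof (cases rule: ge_one_ennreal_cases)
      case 1
      have "ennreal (norm (u (2 powi j))) \<le> ennreal (C / ln 2) * (SUP t\<in>{0<..}. ennreal (norm (u t)))" for j
      proof -
        \<comment> \<open>The index j is reached from j - d with t = 1.\<close>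
        have "ennreal (norm (u (2 powi j))) \<le> ennreal C * ennreal (norm (u (2 powi (j - d))))"
          using le[of 1 "j - d"] C by (simp add: ennreal_mult[symmetric] ennreal_leI)
        also have "\<dots> \<le> ennreal (C / ln 2) * (SUP t\<in>{0<..}. ennreal (norm (u t)))"
          using C2 by (intro mult_mono ennreal_leI SUP_upper) auto
        finally show ?thesis .
      qed
      with 1 show ?thesis by (auto simp: int_norm_def sum_norm_def intro!: SUP_least)
    next
      case 2
      then have p: "p \<ge> 1" by (simp add: p_def)
      \<comment> \<open>Now the step function must be the minorant, so the constant stands on its
        side as \<open>1 / C powr p\<close>; the shift by \<open>d\<close> is free in a sum over all
        integers.\<close>
      have "ennreal (ln 2) * (\<integral>\<^sup>+j. ennreal (1 / C powr p) * ?a j \<partial>count_space UNIV)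
          = ennreal (ln 2) * (\<integral>\<^sup>+j. ennreal (1 / C powr p) * ?a (j + d) \<partial>count_space UNIV)"
        using nn_integral_int_shift[of "\<lambda>j. ennreal (1 / C powr p) * ?a j" "- d"] by simp
      also have "\<dots> = (\<integral>\<^sup>+t\<in>{0<..}. (ennreal (1 / C powr p) * ?a (\<lfloor>log 2 t\<rfloor> + d)) * ennreal (1 / t) \<partial>lborel)"
        by (rule nn_integral_dyadic_step[symmetric])
      also have "\<dots> \<le> (\<integral>\<^sup>+t\<in>{0<..}. ennreal (norm (u t) powr p / t) \<partial>lborel)"
      proof (intro nn_integral_mono)
        fix t :: real
        have "(1 / C powr p * norm (u (2 powi (\<lfloor>log 2 t\<rfloor> + d))) powr p) * (1 / t) \<le> norm (u t) powr p / t" if "t > 0"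
        proof -
          have "norm (u (2 powi (\<lfloor>log 2 t\<rfloor> + d))) powr p \<le> (C * norm (u t)) powr p"
            using le'[OF that] p by (intro powr_mono2) auto
          then show ?thesis using that C by (simp add: powr_mult field_simps)
        qed
        then show "(ennreal (1 / C powr p) * ?a (\<lfloor>log 2 t\<rfloor> + d)) * ennreal (1 / t) * indicator {0<..} t
          \<le> ennreal (norm (u t) powr p / t) * indicator {0<..} t"
          by (auto simp: indicator_def ennreal_mult[symmetric] intro!: ennreal_leI)
      qed
      also have "ennreal (ln 2) * (\<integral>\<^sup>+j. ennreal (1 / C powr p) * ?a j \<partial>count_space UNIV)
          = ennreal (ln 2 / C powr p) * (\<integral>\<^sup>+j. ?a j \<partial>count_space UNIV)"
        using ln2 by (subst nn_integral_cmult) (auto simp: mult.assoc[symmetric] ennreal_mult[symmetric])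
      finally have "ennreal (C powr p / ln 2) * (ennreal (ln 2 / C powr p) * (\<integral>\<^sup>+j. ?a j \<partial>count_space UNIV))
          \<le> ennreal (C powr p / ln 2) * (\<integral>\<^sup>+t\<in>{0<..}. ennreal (norm (u t) powr p / t) \<partial>lborel)"
        by (rule mult_left_mono) simp
      then have "(\<integral>\<^sup>+j. ?a j \<partial>count_space UNIV) \<le> ennreal (C powr p / ln 2) * (\<integral>\<^sup>+t\<in>{0<..}. ennreal (norm (u t) powr p / t) \<partial>lborel)"
        using ln2 C by (simp add: mult.assoc[symmetric] ennreal_mult[symmetric])
      then have "sum_norm s (\<lambda>j. u (2 powi j)) \<le> ennreal ((C powr p / ln 2) powr (1 / p)) * int_norm s u"
        using 2 p ln2 unfolding int_norm_def sum_norm_eq[OF 2(1)] p_def[symmetric]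
        by (simp add: ennreal_power_cmult[symmetric] ennreal_power_mono)
      also have "(C powr p / ln 2) powr (1 / p) \<le> C / ln 2"
      proof -
        have "(C powr p / ln 2) powr (1 / p) = C * (1 / ln 2) powr (1 / p)"
          using p C ln2 by (simp add: powr_divide powr_powr)
        also have "\<dots> \<le> C * (1 / ln 2) powr 1"
          using C ln2 p by (intro mult_left_mono powr_mono) auto
        finally show ?thesis using ln2 by simp
      qed
      then have "ennreal ((C powr p / ln 2) powr (1 / p)) * int_norm s u \<le> ennreal (C / ln 2) * int_norm s u"
        by (intro mult_right_mono ennreal_leI) auto
      finally show ?thesis .
    qed
  }
qed

text \<open>Jensen's inequality for the normalized weights. Indices with \<open>x k = 0\<close> are
  dropped first, because convexity of \<open>powr\<close> is taken on the open half-line. The total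
  weight enters with exponent p - 1 >= 0, so \<open>Q\<close> may replace it.\<close>

lemma sum_powr_le_weighted:
  fixes w x :: "'b \<Rightarrow> real"
  assumes p: "p \<ge> 1" and S: "finite S" and w: "\<And>k. k \<in> S \<Longrightarrow> 0 < w k" and x: "\<And>k. k \<in> S \<Longrightarrow> 0 \<le> x k"
    and Q: "(\<Sum>k\<in>S. w k) \<le> Q"
  shows "(\<Sum>k\<in>S. w k * x k) powr p \<le> Q powr (p - 1) * (\<Sum>k\<in>S. w k * x k powr p)"
proof -
  define S' where "S' = {k\<in>S. 0 < x k}"
  have S': "finite S'" "S' \<subseteq> S" "\<And>k. k \<in> S - S' \<Longrightarrow> x k = 0" using S x by (auto simp: S'_def less_le)
  have e1: "(\<Sum>k\<in>S. w k * x k) = (\<Sum>k\<in>S'. w k * x k)"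
    by (rule sum.mono_neutral_right) (use S S' in auto)
  have e2: "(\<Sum>k\<in>S. w k * x k powr p) = (\<Sum>k\<in>S'. w k * x k powr p)"
    by (rule sum.mono_neutral_right) (use S S' in auto)
  show ?thesis
  proof (cases "S' = {}")
    case True
    then show ?thesis by (simp add: e1 e2)
  next
    case False
    define W where "W = (\<Sum>k\<in>S'. w k)"
    have W: "W > 0" unfolding W_def using S' False w by (intro sum_pos) auto
    have "W \<le> (\<Sum>k\<in>S. w k)" unfolding W_def using S S' w by (intro sum_mono2) (auto intro: less_imp_le)
    with Q have WQ: "W \<le> Q" by simp
    have "(\<Sum>k\<in>S'. (w k / W) *\<^sub>R x k) powr p \<le> (\<Sum>k\<in>S'. w k / W * x k powr p)"
    proof (rule convex_on_sum[OF S'(1) False powr_convex[OF p]])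
      show "(\<Sum>k\<in>S'. w k / W) = 1" using W by (simp add: W_def sum_divide_distrib[symmetric])
      show "0 \<le> w k / W" if "k \<in> S'" for k using that S'(2) W w[of k] by (auto intro: less_imp_le)
      show "x k \<in> {0<..}" if "k \<in> S'" for k using that by (simp add: S'_def)
    qed
    then have "((\<Sum>k\<in>S'. w k * x k) / W) powr p \<le> (\<Sum>k\<in>S'. w k * x k powr p) / W"
      by (simp add: sum_divide_distrib)
    moreover have nn: "0 \<le> (\<Sum>k\<in>S'. w k * x k)" "0 \<le> (\<Sum>k\<in>S'. w k * x k powr p)"
      using w x S' by (auto intro!: sum_nonneg mult_nonneg_nonneg less_imp_le[OF w] x)
    ultimately have "(\<Sum>k\<in>S'. w k * x k) powr p \<le> W powr p * ((\<Sum>k\<in>S'. w k * x k powr p) / W)"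
      using W by (simp add: powr_divide field_simps)
    also have "\<dots> = W powr (p - 1) * (\<Sum>k\<in>S'. w k * x k powr p)"
      using W by (simp add: powr_diff)
    also have "\<dots> \<le> Q powr (p - 1) * (\<Sum>k\<in>S'. w k * x k powr p)"
      using W WQ p nn by (intro mult_right_mono powr_mono2) auto
    finally show ?thesis by (simp add: e1 e2)
  qed
qed

text \<open>Young's inequality for a summable kernel: Jensen in k with weights q^|j - k| of total
  mass at most Q = 2 / (1 - q), then Tonelli, which gives one more Q. Since Q^(p - 1) Q = Q^p, the
  p-th root leaves a constant free of p.\<close>

lemma sum_norm_convolution_le:
  fixes y :: "int \<Rightarrow> 'b::real_normed_vector" and w :: "int \<Rightarrow> 'c::real_normed_vector"
  assumes s: "1 \<le> s" and D: "0 \<le> D" and q: "0 < q" "q < 1"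
    and lim: "\<And>j. (\<lambda>N. \<Sum>k = - int N..int N. v j k) \<longlonglongrightarrow> y j"
    and v: "\<And>j k. norm (v j k) \<le> D * q ^ nat \<bar>j - k\<bar> * norm (w (k - d))"
  shows "sum_norm s y \<le> ennreal (D * (2 / (1 - q))) * sum_norm s w"
proof -
  define Q where "Q = 2 / (1 - q)"
  have Q: "Q > 0" using q by (simp add: Q_def)
  have geo: "(\<Sum>k\<in>S. q ^ nat \<bar>j - k\<bar>) \<le> Q" if "finite S" for S j
    unfolding Q_def by (rule sum_int_geometric_le) (use q that in auto)
  have part: "norm (\<Sum>k = - int N..int N. v j k) \<le> D * (\<Sum>k = - int N..int N. q ^ nat \<bar>j - k\<bar> * norm (w (k - d)))" for j N
  proof -
    have "norm (\<Sum>k = - int N..int N. v j k) \<le> (\<Sum>k = - int N..int N. D * q ^ nat \<bar>j - k\<bar> * norm (w (k - d)))"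
      by (rule sum_norm_le) (rule v)
    then show ?thesis by (simp add: sum_distrib_left mult.assoc)
  qed
  from s have "sum_norm s y \<le> ennreal (D * Q) * sum_norm s w"
  proof (cases rule: ge_one_ennreal_cases)
    case 1
    let ?S = "SUP k. ennreal (norm (w k))"
    have "ennreal (norm (y j)) \<le> ennreal (D * Q) * ?S" for j
    proof (rule tendsto_upperbound[OF _ always_eventually])
      show "(\<lambda>N. ennreal (norm (\<Sum>k = - int N..int N. v j k))) \<longlonglongrightarrow> ennreal (norm (y j))"
        by (intro tendsto_ennrealI tendsto_norm lim)
      show "\<forall>N. ennreal (norm (\<Sum>k = - int N..int N. v j k)) \<le> ennreal (D * Q) * ?S"
      proof
        fix N
        have "ennreal (norm (\<Sum>k = - int N..int N. v j k)) \<le> ennreal (\<Sum>k = - int N..int N. D * q ^ nat \<bar>j - k\<bar> * norm (w (k - d)))"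
          using part[of j N] by (intro ennreal_leI) (simp add: sum_distrib_left mult.assoc)
        also have "\<dots> = (\<Sum>k = - int N..int N. ennreal (D * q ^ nat \<bar>j - k\<bar>) * ennreal (norm (w (k - d))))"
          using D q by (simp add: sum_ennreal[symmetric] ennreal_mult)
        also have "\<dots> \<le> (\<Sum>k = - int N..int N. ennreal (D * q ^ nat \<bar>j - k\<bar>) * ?S)"
          by (intro sum_mono mult_left_mono SUP_upper) auto
        also have "\<dots> = ennreal (D * (\<Sum>k = - int N..int N. q ^ nat \<bar>j - k\<bar>)) * ?S"
          using D q by (simp add: sum_distrib_right[symmetric] sum_distrib_left)
        also have "\<dots> \<le> ennreal (D * Q) * ?S"
          using D geo by (intro mult_right_mono ennreal_leI mult_left_mono) auto
        finally show "ennreal (norm (\<Sum>k = - int N..int N. v j k)) \<le> ennreal (D * Q) * ?S" .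
      qed
    qed simp
    with 1 show ?thesis by (auto simp: sum_norm_def intro!: SUP_least)
  next
    case 2
    define p where "p = enn2real s"
    have p: "p \<ge> 1" using 2 by (simp add: p_def)
    let ?a = "\<lambda>k. ennreal (norm (w k) powr p)"
    let ?c = "D powr p * Q powr (p - 1)"
    have y_le: "ennreal (norm (y j) powr p) \<le> ennreal ?c * (\<integral>\<^sup>+k. ennreal (q ^ nat \<bar>j - k\<bar>) * ?a (k - d) \<partial>count_space UNIV)" for j
    proof (rule tendsto_upperbound[OF _ always_eventually])
      show "(\<lambda>N. ennreal (norm (\<Sum>k = - int N..int N. v j k) powr p)) \<longlonglongrightarrow> ennreal (norm (y j) powr p)"
        using p by (intro tendsto_ennrealI tendsto_powr' tendsto_norm lim tendsto_const) auto
      show "\<forall>N. ennreal (norm (\<Sum>k = - int N..int N. v j k) powr p) \<le> ennreal ?c * (\<integral>\<^sup>+k. ennreal (q ^ nat \<bar>j - k\<bar>) * ?a (k - d) \<partial>count_space UNIV)"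
      proof
        fix N
        let ?I = "{- int N..int N}"
        have "norm (\<Sum>k\<in>?I. v j k) powr p \<le> (D * (\<Sum>k\<in>?I. q ^ nat \<bar>j - k\<bar> * norm (w (k - d)))) powr p"
          using part p by (intro powr_mono2) auto
        also have "\<dots> = D powr p * (\<Sum>k\<in>?I. q ^ nat \<bar>j - k\<bar> * norm (w (k - d))) powr p"
          by (rule powr_mult)
        also have "\<dots> \<le> D powr p * (Q powr (p - 1) * (\<Sum>k\<in>?I. q ^ nat \<bar>j - k\<bar> * norm (w (k - d)) powr p))"
          by (intro mult_left_mono sum_powr_le_weighted p geo) (use q in auto)
        finally have "ennreal (norm (\<Sum>k\<in>?I. v j k) powr p) \<le> ennreal (?c * (\<Sum>k\<in>?I. q ^ nat \<bar>j - k\<bar> * norm (w (k - d)) powr p))"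
          by (intro ennreal_leI) (simp add: mult.assoc)
        also have "\<dots> = ennreal ?c * (\<Sum>k\<in>?I. ennreal (q ^ nat \<bar>j - k\<bar>) * ?a (k - d))"
          using D q Q by (subst ennreal_mult) (auto intro!: sum_nonneg simp: sum_ennreal[symmetric] ennreal_mult)
        also have "(\<Sum>k\<in>?I. ennreal (q ^ nat \<bar>j - k\<bar>) * ?a (k - d)) = (\<integral>\<^sup>+k. ennreal (q ^ nat \<bar>j - k\<bar>) * ?a (k - d) \<partial>count_space ?I)"
          by (simp add: nn_integral_count_space_finite)
        also have "\<dots> \<le> (\<integral>\<^sup>+k. ennreal (q ^ nat \<bar>j - k\<bar>) * ?a (k - d) \<partial>count_space UNIV)"
          by (subst nn_integral_count_space_indicator) (auto intro!: nn_integral_mono simp: indicator_def)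
        finally show "ennreal (norm (\<Sum>k\<in>?I. v j k) powr p) \<le> ennreal ?c * (\<integral>\<^sup>+k. ennreal (q ^ nat \<bar>j - k\<bar>) * ?a (k - d) \<partial>count_space UNIV)"
          by (simp add: mult_left_mono)
      qed
    qed simp
    have geo_int: "(\<integral>\<^sup>+j. ennreal (q ^ nat \<bar>j - k\<bar>) \<partial>count_space UNIV) \<le> ennreal Q" for k
      unfolding infsum_int_eq_nn_integral[symmetric]
      by (subst nonneg_infsum_complete)
         (use geo[of _ k] q in \<open>auto intro!: SUP_least ennreal_leI simp: abs_minus_commute\<close>)
    let ?I = "\<integral>\<^sup>+j. \<integral>\<^sup>+k. ennreal (q ^ nat \<bar>j - k\<bar>) * ?a (k - d) \<partial>count_space UNIV \<partial>count_space UNIV"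
    have "?I = (\<integral>\<^sup>+k. \<integral>\<^sup>+j. ennreal (q ^ nat \<bar>j - k\<bar>) * ?a (k - d) \<partial>count_space UNIV \<partial>count_space UNIV)"
      by (rule nn_integral_count_space_nn_integral) auto
    also have "\<dots> \<le> (\<integral>\<^sup>+k. ennreal Q * ?a (k - d) \<partial>count_space UNIV)"
      by (intro nn_integral_mono) (simp add: nn_integral_multc mult_right_mono geo_int)
    also have "\<dots> = ennreal Q * (\<integral>\<^sup>+k. ?a k \<partial>count_space UNIV)"
      by (simp add: nn_integral_cmult nn_integral_int_shift[of ?a])
    finally have I: "?I \<le> ennreal Q * (\<integral>\<^sup>+k. ?a k \<partial>count_space UNIV)" .
    have "(\<integral>\<^sup>+j. ennreal (norm (y j) powr p) \<partial>count_space UNIV)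
        \<le> (\<integral>\<^sup>+j. ennreal ?c * (\<integral>\<^sup>+k. ennreal (q ^ nat \<bar>j - k\<bar>) * ?a (k - d) \<partial>count_space UNIV) \<partial>count_space UNIV)"
      by (intro nn_integral_mono y_le)
    also have "\<dots> = ennreal ?c * ?I"
      by (simp add: nn_integral_cmult)
    also have "\<dots> \<le> ennreal ?c * (ennreal Q * (\<integral>\<^sup>+k. ?a k \<partial>count_space UNIV))"
      by (rule mult_left_mono[OF I]) simp
    also have "\<dots> = ennreal ((D * Q) powr p) * (\<integral>\<^sup>+k. ?a k \<partial>count_space UNIV)"
    proof -
      have "(D * Q) powr p = ?c * Q" using D Q by (simp add: powr_mult powr_diff)
      moreover have "ennreal (?c * Q) = ennreal ?c * ennreal Q" using Q by (intro ennreal_mult) auto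
      ultimately show ?thesis by (simp only: mult.assoc)
    qed
    finally have "(\<integral>\<^sup>+j. ennreal (norm (y j) powr p) \<partial>count_space UNIV) \<le> ennreal ((D * Q) powr p) * (\<integral>\<^sup>+k. ?a k \<partial>count_space UNIV)" .
    then have "sum_norm s y \<le> ennreal (((D * Q) powr p) powr (1 / p)) * sum_norm s w"
      using 2 p unfolding sum_norm_eq[OF 2(1)] p_def[symmetric]
      by (simp add: ennreal_power_cmult[symmetric] ennreal_power_mono)
    then show ?thesis using p D Q by (simp add: powr_powr)
  qed
  then show ?thesis by (simp only: Q_def)
qed

theorem mainTheorem4:
  fixes A :: "'a::complex_banach \<rightharpoonup> 'a" and s :: ennreal and \<sigma> :: real
  assumes "sectorial A" and "inj_on A (dom A)"
    and "closure (dom A) = UNIV" and "closure (ran A) = UNIV"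
    and "1 \<le> s"
    and "sectorial_angle A < \<sigma>" and "\<sigma> \<le> pi"
  shows
    "(\<forall>\<phi>\<in>Phi_class \<sigma>. \<exists>C::real. C > 0 \<and> (\<forall>x.
        ennreal (1 / C) * sum_norm s (\<lambda>j. H0_calc \<sigma> A (dil (2 powi j) \<phi>) x)
          \<le> int_norm s (\<lambda>t. H0_calc \<sigma> A (dil t \<phi>) x) \<and>
        int_norm s (\<lambda>t. H0_calc \<sigma> A (dil t \<phi>) x)
          \<le> ennreal C * sum_norm s (\<lambda>j. H0_calc \<sigma> A (dil (2 powi j) \<phi>) x))) \<and>
     (\<forall>\<phi>\<in>Phi_class \<sigma>. \<forall>\<psi>\<in>Phi_class \<sigma>. \<exists>C::real. C > 0 \<and> (\<forall>f\<in>H_inf \<sigma>. \<forall>x.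
        sum_norm s (\<lambda>j. the (H_calc \<sigma> A f (H0_calc \<sigma> A (dil (2 powi j) \<phi>) x)))
          \<le> ennreal (C * H_inf_norm \<sigma> f) * sum_norm s (\<lambda>j. H0_calc \<sigma> A (dil (2 powi j) \<psi>) x)))"
proof -
  \<comment> \<open>The very choice made inside \<open>H0_calc\<close>. It depends on
    \<open>A\<close> and \<open>\<sigma>\<close> only, so one contour serves all symbols.\<close>
  define \<nu> where "\<nu> = (SOME \<nu>. sectorial_angle A < \<nu> \<and> \<nu> < \<sigma>)"
  have \<nu>: "sectorial_angle A < \<nu>" "\<nu> < \<sigma>"
    unfolding \<nu>_def using someI_ex[OF dense[OF assms(6)]] by auto
  then have "\<nu> < pi" using assms(7) by simp
  obtain \<omega> M where "sectorial_resolvent A \<omega> M" and \<omega>\<nu>: "\<omega> < \<nu>"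
    by (rule exists_sectorial_resolvent[OF assms(1) \<nu>(1) \<open>\<nu> < pi\<close>])
  then interpret sectorial_resolvent A \<omega> M by simp
  have H0: "H0_calc \<sigma> A = calc \<nu>" unfolding \<nu>_def by (intro ext H0_calc_eq_calc)
  have \<sigma>: "0 < \<sigma>" using \<nu>(2) \<omega>\<nu> \<omega> by linarith
  show ?thesis unfolding H0
  proof (intro conjI ballI)
    fix \<phi> assume \<phi>: "\<phi> \<in> Phi_class \<sigma>"
    obtain d :: int and C where C: "C > 0" and
      le: "\<And>j t x. t \<in> {1..2} \<Longrightarrow> norm (calc \<nu> (dil (2 powi j * t) \<phi>) x) \<le> C * norm (calc \<nu> (dil (2 powi (j - d)) \<phi>) x)"
      and ge: "\<And>j t x. t \<in> {1..2} \<Longrightarrow> norm (calc \<nu> (dil (2 powi (j + d)) \<phi>) x) \<le> C * norm (calc \<nu> (dil (2 powi j * t) \<phi>) x)"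
      by (rule calc_dil_comparable[OF \<phi> \<omega>\<nu> \<nu>(2) assms(7)]) blast
    define E where "E = C / ln 2"
    have E: "E > 0" using C by (simp add: E_def)
    show "\<exists>C::real. C > 0 \<and> (\<forall>x.
        ennreal (1 / C) * sum_norm s (\<lambda>j. calc \<nu> (dil (2 powi j) \<phi>) x)
          \<le> int_norm s (\<lambda>t. calc \<nu> (dil t \<phi>) x) \<and>
        int_norm s (\<lambda>t. calc \<nu> (dil t \<phi>) x)
          \<le> ennreal C * sum_norm s (\<lambda>j. calc \<nu> (dil (2 powi j) \<phi>) x))"
    proof (intro exI[of _ E] conjI allI E)
      fix x
      show "int_norm s (\<lambda>t. calc \<nu> (dil t \<phi>) x) \<le> ennreal E * sum_norm s (\<lambda>j. calc \<nu> (dil (2 powi j) \<phi>) x)"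
        unfolding E_def by (rule int_norm_le_sum_norm[OF assms(5) C le])
      have "sum_norm s (\<lambda>j. calc \<nu> (dil (2 powi j) \<phi>) x) \<le> ennreal E * int_norm s (\<lambda>t. calc \<nu> (dil t \<phi>) x)"
        unfolding E_def by (rule sum_norm_le_int_norm[OF assms(5) C ge])
      then have "ennreal (1 / E) * sum_norm s (\<lambda>j. calc \<nu> (dil (2 powi j) \<phi>) x)
          \<le> ennreal (1 / E) * (ennreal E * int_norm s (\<lambda>t. calc \<nu> (dil t \<phi>) x))"
        by (rule mult_left_mono) simp
      also have "\<dots> = ennreal (1 / E * E) * int_norm s (\<lambda>t. calc \<nu> (dil t \<phi>) x)"
        unfolding mult.assoc[symmetric] using E by (subst ennreal_mult) auto
      also have "1 / E * E = 1" using E by simp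
      finally show "ennreal (1 / E) * sum_norm s (\<lambda>j. calc \<nu> (dil (2 powi j) \<phi>) x) \<le> int_norm s (\<lambda>t. calc \<nu> (dil t \<phi>) x)"
        by simp
    qed
  next
    fix \<phi> \<psi> assume \<phi>: "\<phi> \<in> Phi_class \<sigma>" and \<psi>: "\<psi> \<in> Phi_class \<sigma>"
    then have \<phi>H0: "\<phi> \<in> H0_inf \<sigma>" by (simp add: Phi_class_def)
    obtain e K where e: "e > 0" and dec: "decays \<sigma> e K 0 \<phi>" by (rule H0_inf_decays[OF \<phi>H0 \<sigma> assms(7)])
    obtain d :: int and C q where C: "C \<ge> 0" and q: "0 < q" "q < 1"
      and series: "\<And>f j x. f \<in> H_inf \<sigma> \<Longrightarrow> \<exists>v.
       (\<lambda>N. \<Sum>k = - int N..int N. v k) \<longlonglongrightarrow> calc \<nu> (\<lambda>z. f z * dil (2 powi j) \<phi> z) x \<and>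
       (\<forall>k. norm (v k) \<le> C * H_inf_norm \<sigma> f * q ^ nat \<bar>j - k\<bar> * norm (calc \<nu> (dil (2 powi (k - d)) \<psi>) x))"
      by (rule calc_dyadic_series[OF \<phi>H0 \<psi> \<omega>\<nu> \<nu>(2) assms(7)]) blast
    \<comment> \<open>The added 1 keeps the constant positive even if \<open>C\<close> is 0.\<close>
    let ?C = "C * (2 / (1 - q)) + 1"
    have C': "?C > 0" using C q by (auto intro: add_nonneg_pos)
    show "\<exists>C::real. C > 0 \<and> (\<forall>f\<in>H_inf \<sigma>. \<forall>x.
        sum_norm s (\<lambda>j. the (H_calc \<sigma> A f (calc \<nu> (dil (2 powi j) \<phi>) x)))
          \<le> ennreal (C * H_inf_norm \<sigma> f) * sum_norm s (\<lambda>j. calc \<nu> (dil (2 powi j) \<psi>) x))"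
    proof (intro exI[of _ ?C] conjI ballI allI C')
      fix f x assume f: "f \<in> H_inf \<sigma>"
      have n: "H_inf_norm \<sigma> f \<ge> 0"
        using order_trans[OF norm_ge_zero H_inf_norm_upper[OF f exp_in_sector[OF \<sigma> assms(7), of 0]]] \<sigma> by simp
      \<comment> \<open>On vectors phi(2^j A) x the value of \<open>H_calc\<close> is defined, so
        \<open>the\<close> returns a genuine value.\<close>
      have the_H: "the (H_calc \<sigma> A f (calc \<nu> (dil (2 powi j) \<phi>) x)) = calc \<nu> (\<lambda>z. f z * dil (2 powi j) \<phi> z) x" for j
        using H_calc_calc[OF \<nu>_def \<omega>\<nu> \<nu>(2) assms(7,2) f decays_dil[OF dec _ \<sigma> assms(7)] e, of "2 powi j"] by simp
      have "\<forall>j. \<exists>v. (\<lambda>N. \<Sum>k = - int N..int N. v k) \<longlonglongrightarrow> calc \<nu> (\<lambda>z. f z * dil (2 powi j) \<phi> z) x \<and>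
         (\<forall>k. norm (v k) \<le> C * H_inf_norm \<sigma> f * q ^ nat \<bar>j - k\<bar> * norm (calc \<nu> (dil (2 powi (k - d)) \<psi>) x))"
        using series[OF f] by (intro allI)
      from choice[OF this] obtain v where vv: "\<forall>j. (\<lambda>N. \<Sum>k = - int N..int N. v j k) \<longlonglongrightarrow> calc \<nu> (\<lambda>z. f z * dil (2 powi j) \<phi> z) x \<and>
         (\<forall>k. norm (v j k) \<le> C * H_inf_norm \<sigma> f * q ^ nat \<bar>j - k\<bar> * norm (calc \<nu> (dil (2 powi (k - d)) \<psi>) x))" ..
      have v: "(\<lambda>N. \<Sum>k = - int N..int N. v j k) \<longlonglongrightarrow> calc \<nu> (\<lambda>z. f z * dil (2 powi j) \<phi> z) x" for j
        using vv by blast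
      have v_le: "norm (v j k) \<le> C * H_inf_norm \<sigma> f * q ^ nat \<bar>j - k\<bar> * norm (calc \<nu> (dil (2 powi (k - d)) \<psi>) x)" for j k
        using vv by blast
      have "sum_norm s (\<lambda>j. the (H_calc \<sigma> A f (calc \<nu> (dil (2 powi j) \<phi>) x)))
          \<le> ennreal (C * H_inf_norm \<sigma> f * (2 / (1 - q))) * sum_norm s (\<lambda>j. calc \<nu> (dil (2 powi j) \<psi>) x)"
        unfolding the_H using C n by (intro sum_norm_convolution_le[OF assms(5) _ q v v_le] mult_nonneg_nonneg)
      also have "\<dots> \<le> ennreal (?C * H_inf_norm \<sigma> f) * sum_norm s (\<lambda>j. calc \<nu> (dil (2 powi j) \<psi>) x)"
        using n by (intro mult_right_mono ennreal_leI) (auto simp: algebra_simps)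
      finally show "sum_norm s (\<lambda>j. the (H_calc \<sigma> A f (calc \<nu> (dil (2 powi j) \<phi>) x)))
          \<le> ennreal (?C * H_inf_norm \<sigma> f) * sum_norm s (\<lambda>j. calc \<nu> (dil (2 powi j) \<psi>) x)" .
    qed
  qed
qed

end
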